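(* Let $E$ be a JB$^*$-triple and let $T:E\to E$ be a linear mapping (not assumed continuous). Suppose that for every norm-one element $a\in E$ and every tripotent $e\in E^{**}$ such that $e\le s(a)$, where $s(a)$ is the support tripotent of $a$ in $E^{**}$, we have $P_2(e)T(a)=-Q(e)T(a)$ in $E^{**}$. Then $T$ is continuous.
   Context: A JB$^*$-triple is a complex Banach space $E$ with a continuous triple product $\{\cdot,\cdot,\cdot\}:E\times E\times E\to E$, $(x,y,z)\mapsto\{x,y,z\}$, linear and symmetric in $x$ and $z$ and conjugate linear in $y$, satisfying the Jordan identity $\{x,y,\{a,b,c\}\}=\{\{x,y,a\},b,c\}-\{a,\{y,x,b\},c\}+\{a,b,\{x,y,c\}\}$ for all $x,y,a,b,c\in E$, and such that for each $a\in E$ the operator $L(a,a):x\mapsto\{a,a,x\}$ is hermitian with non-negative spectrum and $\|L(a,a)\|=\|a\|^2$. The bidual $E^{**}$ is again a JB$^*$-triple, with triple product extending that of $E$ and separately weak$^*$-continuous; $E$ is regarded as a subspace of $E^{**}$. Elements $a,b$ are orthogonal, $a\perp b$, if $L(a,b)=0$, where $L(a,b)(x)=\{a,b,x\}$. A tripotent is an element $e$ with $\{e,e,e\}=e$. For a tripotent $e$, $Q(e)(x)=\{e,x,e\}$ (a conjugate linear operator) and $P_2(e)=Q(e)^2$. For tripotents $u,e$, $u\le e$ means that $e-u$ is a tripotent with $e-u\perp u$. For a norm-one $a\in E$ put $a^{[1]}=a$, $a^{[2n+1]}=\{a,a^{[2n-1]},a\}$; the sequence $(a^{[2n-1]})_n$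 converges in the weak$^*$ topology of $E^{**}$ to a tripotent $s(a)\in E^{**}$, the support tripotent of $a$. *)

theory Defs
  imports "HOL-Analysis.Analysis" "HOL-Library.Nonpos_Ints"
begin

section \<open>Complex Banach spaces\<close>

class complex_normed_vector = real_normed_vector +
  fixes scaleC :: "complex \<Rightarrow> 'a \<Rightarrow> 'a"  (infixr "*\<^sub>C" 75)
  assumes scaleC_add_right: "c *\<^sub>C (x + y) = c *\<^sub>C x + c *\<^sub>C y"
    and scaleC_add_left: "(c + d) *\<^sub>C x = c *\<^sub>C x + d *\<^sub>C x"
    and scaleC_scaleC: "c *\<^sub>C (d *\<^sub>C x) = (c * d) *\<^sub>C x"
    and scaleC_of_real: "of_real r *\<^sub>C x = r *\<^sub>R x"
    and norm_scaleC: "norm (c *\<^sub>C x) = cmod c * norm x"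

class cbanach = complex_normed_vector + banach

instantiation complex :: cbanach
begin

definition scaleC_complex :: "complex \<Rightarrow> complex \<Rightarrow> complex"
  where "scaleC_complex c z = c * z"

instance
  by standard (auto simp: scaleC_complex_def algebra_simps norm_mult scaleR_conv_of_real)

end

lemma vector_space_scaleC:
  "vector_space (scaleC :: complex \<Rightarrow> 'a::complex_normed_vector \<Rightarrow> 'a)"
proof
  show "1 *\<^sub>C x = x" for x :: 'a
    using scaleC_of_real[of 1 x] by simp
qed (auto simp: scaleC_add_right scaleC_add_left scaleC_scaleC)

lemma vector_space_cnj_scaleC:
  "vector_space (\<lambda>c (x :: 'a::complex_normed_vector). cnj c *\<^sub>C x)"
proof -
  interpret vector_space "scaleC :: complex \<Rightarrow> 'a \<Rightarrow> 'a"
    by (rule vector_space_scaleC)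
  show ?thesis
    by standard (auto simp: scale_right_distrib scale_left_distrib)
qed

definition clinear :: "('a::complex_normed_vector \<Rightarrow> 'b::complex_normed_vector) \<Rightarrow> bool"
  where "clinear = Vector_Spaces.linear (*\<^sub>C) (*\<^sub>C)"

definition conj_linear :: "('a::complex_normed_vector \<Rightarrow> 'b::complex_normed_vector) \<Rightarrow> bool"
  where "conj_linear = Vector_Spaces.linear (*\<^sub>C) (\<lambda>c x. cnj c *\<^sub>C x)"

lemma clinear_iff:
  "clinear f \<longleftrightarrow> (\<forall>x y. f (x + y) = f x + f y) \<and> (\<forall>c x. f (c *\<^sub>C x) = c *\<^sub>C f x)"
  unfolding clinear_def Vector_Spaces.linear_iff_module_hom
  unfolding module_hom_iff module_iff_vector_space
  by (simp add: vector_space_scaleC)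

lemma conj_linear_iff:
  "conj_linear f \<longleftrightarrow> (\<forall>x y. f (x + y) = f x + f y) \<and> (\<forall>c x. f (c *\<^sub>C x) = cnj c *\<^sub>C f x)"
  unfolding conj_linear_def Vector_Spaces.linear_iff_module_hom
  unfolding module_hom_iff module_iff_vector_space
  by (simp add: vector_space_scaleC vector_space_cnj_scaleC)


section \<open>Dual and bidual\<close>

typedef (overloaded) ('a::complex_normed_vector) cdual =
  "{f :: 'a \<Rightarrow>\<^sub>L complex. clinear (blinfun_apply f)}"
  by (rule exI[of _ 0]) (auto simp: clinear_iff scaleC_complex_def)

setup_lifting type_definition_cdual

lift_definition cdual_apply :: "'a::complex_normed_vector cdual \<Rightarrow> 'a \<Rightarrow> complex"
  is blinfun_apply .

instantiation cdual :: (complex_normed_vector) complex_normed_vector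
begin

lift_definition zero_cdual :: "'a cdual" is 0
  by (auto simp: clinear_iff scaleC_complex_def)

lift_definition plus_cdual :: "'a cdual \<Rightarrow> 'a cdual \<Rightarrow> 'a cdual" is "(+)"
  by (auto simp: clinear_iff scaleC_complex_def blinfun.add_left algebra_simps)

lift_definition minus_cdual :: "'a cdual \<Rightarrow> 'a cdual \<Rightarrow> 'a cdual" is "(-)"
  by (auto simp: clinear_iff scaleC_complex_def blinfun.diff_left algebra_simps)

lift_definition uminus_cdual :: "'a cdual \<Rightarrow> 'a cdual" is uminus
  by (auto simp: clinear_iff scaleC_complex_def blinfun.minus_left)

lift_definition scaleR_cdual :: "real \<Rightarrow> 'a cdual \<Rightarrow> 'a cdual" is "(*\<^sub>R)"
  by (auto simp: clinear_iff scaleC_complex_def blinfun.scaleR_left algebra_simps)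

lift_definition scaleC_cdual :: "complex \<Rightarrow> 'a cdual \<Rightarrow> 'a cdual"
  is "\<lambda>c f. blinfun_compose (blinfun_mult_right c) f"
  by (auto simp: clinear_iff scaleC_complex_def algebra_simps)

lift_definition norm_cdual :: "'a cdual \<Rightarrow> real" is norm .

definition dist_cdual :: "'a cdual \<Rightarrow> 'a cdual \<Rightarrow> real"
  where "dist_cdual f g = norm (f - g)"

definition sgn_cdual :: "'a cdual \<Rightarrow> 'a cdual"
  where "sgn_cdual f = scaleR (inverse (norm f)) f"

definition uniformity_cdual :: "('a cdual \<times> 'a cdual) filter"
  where "uniformity_cdual = (INF e\<in>{0<..}. principal {(x, y). dist x y < e})"

definition open_cdual :: "'a cdual set \<Rightarrow> bool"
  where "open_cdual S = (\<forall>x\<in>S. \<forall>\<^sub>F (x', y) in uniformity. x' = x \<longrightarrow> y \<in> S)"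

instance
proof
  fix f g h :: "'a cdual" and a b :: real and c d :: complex
  show "f + g + h = f + (g + h)" by transfer (simp add: algebra_simps)
  show "f + g = g + f" by transfer (simp add: algebra_simps)
  show "0 + f = f" by transfer simp
  show "- f + f = 0" by transfer simp
  show "f - g = f + - g" by transfer simp
  show "a *\<^sub>R (f + g) = a *\<^sub>R f + a *\<^sub>R g" by transfer (simp add: algebra_simps)
  show "(a + b) *\<^sub>R f = a *\<^sub>R f + b *\<^sub>R f" by transfer (simp add: algebra_simps)
  show "a *\<^sub>R b *\<^sub>R f = (a * b) *\<^sub>R f" by transfer simp
  show "1 *\<^sub>R f = f" by transfer simp
  show "dist f g = norm (f - g)" by (rule dist_cdual_def)
  show "sgn f = inverse (norm f) *\<^sub>R f" by (rule sgn_cdual_def)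
  show "(uniformity :: ('a cdual \<times> 'a cdual) filter) = (INF e\<in>{0<..}. principal {(x, y). dist x y < e})"
    by (rule uniformity_cdual_def)
  show "open U = (\<forall>x\<in>U. \<forall>\<^sub>F (x', y) in uniformity. x' = x \<longrightarrow> y \<in> U)" for U :: "'a cdual set"
    by (rule open_cdual_def)
  show "norm f = 0 \<longleftrightarrow> f = 0" by transfer simp
  show "norm (f + g) \<le> norm f + norm g" by transfer (rule norm_triangle_ineq)
  show "norm (a *\<^sub>R f) = \<bar>a\<bar> * norm f" by transfer simp
  show "c *\<^sub>C (f + g) = c *\<^sub>C f + c *\<^sub>C g"
    by transfer (auto intro!: blinfun_eqI simp: blinfun.bilinear_simps algebra_simps)
  show "(c + d) *\<^sub>C f = c *\<^sub>C f + d *\<^sub>C f"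
    by transfer (auto intro!: blinfun_eqI simp: blinfun.bilinear_simps algebra_simps)
  show "c *\<^sub>C d *\<^sub>C f = (c * d) *\<^sub>C f"
    by transfer (auto intro!: blinfun_eqI simp: algebra_simps)
  show "of_real a *\<^sub>C f = a *\<^sub>R f"
    by transfer (auto intro!: blinfun_eqI simp: blinfun.bilinear_simps scaleR_conv_of_real)
  show "norm (c *\<^sub>C f) = cmod c * norm f"
  proof transfer
    fix c :: complex and f :: "'a \<Rightarrow>\<^sub>L complex"
    have le: "norm (blinfun_compose (blinfun_mult_right c) f) \<le> cmod c * norm f" for c and f :: "'a \<Rightarrow>\<^sub>L complex"
      by (rule norm_blinfun_bound)
        (auto simp: norm_mult mult.assoc intro!: mult_left_mono norm_blinfun)
    have "cmod c * norm f \<le> norm (blinfun_compose (blinfun_mult_right c) f)"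
    proof (cases "c = 0")
      case False
      have "f = blinfun_compose (blinfun_mult_right (inverse c)) (blinfun_compose (blinfun_mult_right c) f)"
        using False by (auto intro!: blinfun_eqI)
      then have "norm f \<le> cmod (inverse c) * norm (blinfun_compose (blinfun_mult_right c) f)"
        using le by metis
      with False show ?thesis by (simp add: norm_divide field_simps)
    qed simp
    with le show "norm (blinfun_compose (blinfun_mult_right c) f) = cmod c * norm f"
      by (simp add: antisym)
  qed
qed

end

lemma cdual_apply_simps:
  "cdual_apply 0 x = 0"
  "cdual_apply (f + g) x = cdual_apply f x + cdual_apply g x"
  "cdual_apply (f - g) x = cdual_apply f x - cdual_apply g x"
  "cdual_apply (- f) x = - cdual_apply f x"
  "cdual_apply (r *\<^sub>R f) x = r *\<^sub>R cdual_apply f x"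
  "cdual_apply (c *\<^sub>C f) x = c * cdual_apply f x"
  by (transfer; simp add: blinfun.bilinear_simps)+

lemma cdual_eqI: "(\<And>x. cdual_apply f x = cdual_apply g x) \<Longrightarrow> f = g"
  by transfer (rule blinfun_eqI)

lemma norm_cdual_onorm: "norm f = onorm (cdual_apply f)"
  by transfer (rule norm_blinfun.rep_eq)

lemma norm_cdual_apply: "cmod (cdual_apply f x) \<le> norm f * norm x"
  by transfer (rule norm_blinfun)

lemma clinear_cdual_apply: "clinear (cdual_apply f)"
  by transfer simp

instance cdual :: (complex_normed_vector) cbanach
proof
  fix X :: "nat \<Rightarrow> 'a cdual"
  assume "Cauchy X"
  have dist: "dist (Rep_cdual f) (Rep_cdual g) = dist f g" for f g :: "'a cdual"
    unfolding dist_norm by (simp add: norm_cdual.rep_eq minus_cdual.rep_eq)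
  have "Cauchy (\<lambda>n. Rep_cdual (X n))"
    using \<open>Cauchy X\<close> by (simp add: Cauchy_def dist)
  then obtain L where L: "(\<lambda>n. Rep_cdual (X n)) \<longlonglongrightarrow> L"
    using convergentD Cauchy_convergent by blast
  have lim: "(\<lambda>n. Rep_cdual (X n) x) \<longlonglongrightarrow> L x" for x
    by (intro tendsto_intros L)
  have "L (c *\<^sub>C x) = c * L x" for c x
  proof (rule LIMSEQ_unique[OF lim])
    have "Rep_cdual (X n) (c *\<^sub>C x) = c * Rep_cdual (X n) x" for n
      using Rep_cdual[of "X n"] by (simp add: clinear_iff scaleC_complex_def)
    then show "(\<lambda>n. Rep_cdual (X n) (c *\<^sub>C x)) \<longlonglongrightarrow> c * L x"
      by (simp add: tendsto_mult_left[OF lim])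
  qed
  then have "clinear (blinfun_apply L)"
    by (simp add: clinear_iff scaleC_complex_def blinfun.add_right)
  then have "Rep_cdual (Abs_cdual L) = L"
    by (simp add: Abs_cdual_inverse)
  with L have "X \<longlonglongrightarrow> Abs_cdual L"
    by (simp add: tendsto_iff dist[symmetric])
  then show "convergent X"
    by (rule convergentI)
qed

lift_definition bidual_embed :: "'a::complex_normed_vector \<Rightarrow> 'a cdual cdual"
  is "\<lambda>x. Blinfun (\<lambda>f. cdual_apply f x)"
proof -
  fix x :: 'a
  have "bounded_linear (\<lambda>f. cdual_apply f x)"
    by (rule bounded_linear_intro[where K = "norm x"])
      (auto simp: cdual_apply_simps norm_cdual_apply)
  then show "clinear (blinfun_apply (Blinfun (\<lambda>f. cdual_apply f x)))"
    by (simp add: bounded_linear_Blinfun_apply clinear_iff scaleC_complex_def cdual_apply_simps)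
qed

lemma bidual_embed_apply: "cdual_apply (bidual_embed x) f = cdual_apply f x"
proof -
  have "bounded_linear (\<lambda>f. cdual_apply f x)"
    by (rule bounded_linear_intro[where K = "norm x"])
      (auto simp: cdual_apply_simps norm_cdual_apply)
  then show ?thesis
    by (simp add: cdual_apply.rep_eq bidual_embed.rep_eq bounded_linear_Blinfun_apply)
qed

text \<open>The function space carries the topology of pointwise convergence.\<close>

definition weak_star_topology :: "'a::complex_normed_vector cdual topology"
  where "weak_star_topology = pullback_topology UNIV cdual_apply euclidean"

lemma limitin_weak_star_iff:
  "limitin weak_star_topology X f F \<longleftrightarrow>
    (\<forall>x. ((\<lambda>i. cdual_apply (X i) x) \<longlongrightarrow> cdual_apply f x) F)"
proof -
  have "limitin weak_star_topology X f F \<longleftrightarrow>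
      limitin euclidean (\<lambda>i. cdual_apply (X i)) (cdual_apply f) F"
    unfolding limitin_def weak_star_topology_def openin_pullback_topology
      topspace_pullback_topology by auto
  also have "\<dots> \<longleftrightarrow> limitin (product_topology (\<lambda>i. euclidean) UNIV) (\<lambda>i. cdual_apply (X i)) (cdual_apply f) F"
    by (subst euclidean_product_topology) (rule refl)
  also have "\<dots> \<longleftrightarrow> (\<forall>x. ((\<lambda>i. cdual_apply (X i) x) \<longlongrightarrow> cdual_apply f x) F)"
    unfolding limitin_componentwise by simp
  finally show ?thesis .
qed

lemma limitin_weak_star_unique:
  assumes "limitin weak_star_topology X f F" "limitin weak_star_topology X g F" "F \<noteq> bot"
  shows "f = g"
proof (rule cdual_eqI)
  fix x
  have "((\<lambda>i. cdual_apply (X i) x) \<longlongrightarrow> cdual_apply f x) F"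
    using assms(1) unfolding limitin_weak_star_iff by blast
  moreover have "((\<lambda>i. cdual_apply (X i) x) \<longlongrightarrow> cdual_apply g x) F"
    using assms(2) unfolding limitin_weak_star_iff by blast
  ultimately show "cdual_apply f x = cdual_apply g x"
    by (rule tendsto_unique[OF assms(3)])
qed


section \<open>Hermitian operators and spectrum\<close>

definition op_exp :: "('a::cbanach \<Rightarrow> 'a) \<Rightarrow> 'a \<Rightarrow> 'a"
  where "op_exp A x = (\<Sum>n. (A ^^ n) x /\<^sub>R fact n)"

text \<open>A bounded operator \<open>A\<close> is hermitian if \<open>exp (i t A)\<close> has norm one for all real \<open>t\<close>; as
  these operators form a group, this says that they are isometries. The latter form
  also covers the zero space.\<close>

definition hermitian_op :: "('a::cbanach \<Rightarrow> 'a) \<Rightarrow> bool"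
  where "hermitian_op A \<longleftrightarrow> clinear A \<and> bounded_linear A \<and>
    (\<forall>t::real. \<forall>x. norm (op_exp (\<lambda>y. (\<i> * of_real t) *\<^sub>C A y) x) = norm x)"

definition op_spectrum :: "('a::cbanach \<Rightarrow> 'a) \<Rightarrow> complex set"
  where "op_spectrum A = {\<mu>. \<not> (\<exists>B. clinear B \<and> bounded_linear B \<and>
    (\<forall>x. B (A x - \<mu> *\<^sub>C x) = x) \<and> (\<forall>x. A (B x) - \<mu> *\<^sub>C B x = x))}"


section \<open>JB*-triples\<close>

locale jbstar_triple =
  fixes tp :: "'a::cbanach \<Rightarrow> 'a \<Rightarrow> 'a \<Rightarrow> 'a"
  assumes continuous_tp: "continuous_on UNIV (\<lambda>(x, y, z). tp x y z)"
    and clinear_tp_left: "clinear (\<lambda>x. tp x y z)"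
    and symmetric_tp: "tp x y z = tp z y x"
    and conj_linear_tp_middle: "conj_linear (\<lambda>y. tp x y z)"
    and Jordan_identity:
      "tp x y (tp a b c) = tp (tp x y a) b c - tp a (tp y x b) c + tp a b (tp x y c)"
    and hermitian_L: "hermitian_op (tp a a)"
    and nonneg_spectrum_L: "op_spectrum (tp a a) \<subseteq> \<real>\<^sub>\<ge>\<^sub>0"
    and norm_L: "onorm (tp a a) = (norm a)\<^sup>2"

definition orthogonal_elems :: "('a::cbanach \<Rightarrow> 'a \<Rightarrow> 'a \<Rightarrow> 'a) \<Rightarrow> 'a \<Rightarrow> 'a \<Rightarrow> bool"
  where "orthogonal_elems tp a b \<longleftrightarrow> (\<forall>x. tp a b x = 0)"

definition tripotent :: "('a::cbanach \<Rightarrow> 'a \<Rightarrow> 'a \<Rightarrow> 'a) \<Rightarrow> 'a \<Rightarrow> bool"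
  where "tripotent tp e \<longleftrightarrow> tp e e e = e"

definition tripotent_le :: "('a::cbanach \<Rightarrow> 'a \<Rightarrow> 'a \<Rightarrow> 'a) \<Rightarrow> 'a \<Rightarrow> 'a \<Rightarrow> bool"
  where "tripotent_le tp u e \<longleftrightarrow> tripotent tp (e - u) \<and> orthogonal_elems tp (e - u) u"

definition Q_op :: "('a::cbanach \<Rightarrow> 'a \<Rightarrow> 'a \<Rightarrow> 'a) \<Rightarrow> 'a \<Rightarrow> 'a \<Rightarrow> 'a"
  where "Q_op tp e x = tp e x e"

definition P2_op :: "('a::cbanach \<Rightarrow> 'a \<Rightarrow> 'a \<Rightarrow> 'a) \<Rightarrow> 'a \<Rightarrow> 'a \<Rightarrow> 'a"
  where "P2_op tp e = Q_op tp e \<circ> Q_op tp e"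

text \<open>The properties that single out the triple product of the bidual; uniqueness follows from
  weak*-density of the space in its bidual.\<close>

definition bidual_triple_product ::
    "('a::cbanach \<Rightarrow> 'a \<Rightarrow> 'a \<Rightarrow> 'a) \<Rightarrow>
     ('a cdual cdual \<Rightarrow> 'a cdual cdual \<Rightarrow> 'a cdual cdual \<Rightarrow> 'a cdual cdual) \<Rightarrow> bool"
  where "bidual_triple_product tp tpb \<longleftrightarrow>
    jbstar_triple tpb \<and>
    (\<forall>x y z. tpb (bidual_embed x) (bidual_embed y) (bidual_embed z) = bidual_embed (tp x y z)) \<and>
    (\<forall>u v. continuous_map weak_star_topology weak_star_topology (\<lambda>w. tpb w u v) \<and>
           continuous_map weak_star_topology weak_star_topology (\<lambda>w. tpb u w v) \<and>
           continuous_map weak_star_topology weak_star_topology (\<lambda>w. tpb u v w))"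

text \<open>\<open>odd_power tp a n\<close> is the power of \<open>a\<close> with exponent \<open>2 * n + 1\<close>.\<close>

primrec odd_power :: "('a::cbanach \<Rightarrow> 'a \<Rightarrow> 'a \<Rightarrow> 'a) \<Rightarrow> 'a \<Rightarrow> nat \<Rightarrow> 'a"
  where "odd_power tp a 0 = a"
  | "odd_power tp a (Suc n) = tp a (odd_power tp a n) a"

definition support_tripotent :: "('a::cbanach \<Rightarrow> 'a \<Rightarrow> 'a \<Rightarrow> 'a) \<Rightarrow> 'a \<Rightarrow> 'a cdual cdual"
  where "support_tripotent tp a =
    (THE s. limitin weak_star_topology (\<lambda>n. bidual_embed (odd_power tp a n)) s sequentially)"

lemma support_tripotent_eqI:
  assumes "limitin weak_star_topology (\<lambda>n. bidual_embed (odd_power tp a n)) s sequentially"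
  shows "support_tripotent tp a = s"
  unfolding support_tripotent_def
proof (rule the_equality)
  show "t = s"
    if "limitin weak_star_topology (\<lambda>n. bidual_embed (odd_power tp a n)) t sequentially" for t
    using that assms sequentially_bot by (rule limitin_weak_star_unique)
qed (rule assms)

end

(* For tripotents s and elements b with P_2(s) b = - Q(s) b, the element x = P_2(s) b is skew
   in the unital JB*-algebra of the Peirce-2 space of s, so s - t x is, up to O(t^2), the image
   of s under an isometry, and |s - t x| >= |s| - O(t^2). If s is the support tripotent of a
   norm-one element a, then P_2(s) a = s and |s| = 1; as P_2(s) is contractive and
   t |-> |a - t b| is convex, |a - t b| >= |a| for all t > 0. With b = T a this makes T
   dissipative, hence closed, hence continuous by the closed graph theorem.

   The existence of s(a) and |s(a)| = 1 have to be proved as well. By Sinclair's theorem on the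
   spectral radius of hermitian operators, h = L(a, a) is an average of the identity and a
   contraction, so h^n (1 - h) -> 0 and all weak* cluster points of the odd powers of a coincide.
   Moreover 1 is an approximate eigenvalue of h; on approximate fixed vectors y of h all
   operators L(a^[j], a^[k]) are close to the identity, so that |z|^2 = |L(z, z)| >= 1 for all
   convex combinations z of odd powers. The Hahn-Banach theorem then gives a functional that
   is bounded below on all odd powers. *)

theory Submission
  imports Defs "HOL-Complex_Analysis.Complex_Analysis"
begin

subsection \<open>A Hahn--Banach separation theorem\<close>

text \<open>The usual treatment of \<open>s(a)\<close> represents the subtriple generated by
  \<open>a\<close> as a function space. The proof avoids this and works with \<open>L(z, z)\<close>
  for well-chosen \<open>z\<close>: norms of vectors become operator norms, and positivity enters
  through the fact that \<open>L(z, z) - k/2\<close> has norm at most \<open>k/2\<close> when the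
  spectrum lies in \<open>[0, k]\<close>.

  Two losses have to be avoided. The norm is only lower semicontinuous under weak* limits, so
  contractive powers alone do not exclude \<open>s(a) = 0\<close>, for which the hypothesis says
  nothing; a functional that is at least 1 on all powers survives the limit. And the error
  \<open>O(t^2)\<close> has a factor depending on \<open>a\<close> and \<open>T a\<close>, which is
  not under control before \<open>T\<close> is known to be bounded. Convexity of the norm removes
  this error entirely, and the resulting inequality is homogeneous in \<open>a\<close> and stable
  under limits.\<close>

definition sublinear :: "('a::real_vector \<Rightarrow> real) \<Rightarrow> bool"
  where "sublinear q \<longleftrightarrow> (\<forall>x y. q (x + y) \<le> q x + q y) \<and> (\<forall>t>0. \<forall>x. q (t *\<^sub>R x) \<le> t * q x)"

lemma sublinear_zero: "sublinear q \<Longrightarrow> q 0 = 0"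
proof -
  assume "sublinear q"
  then have "q (t *\<^sub>R 0) \<le> t * q 0" if "t > 0" for t
    using that unfolding sublinear_def by blast
  from this[of 2] this[of "1/2"] show ?thesis by auto
qed

lemma sublinear_scale:
  assumes "sublinear q" "t > 0"
  shows "q (t *\<^sub>R x) = t * q x"
proof (rule antisym)
  show "q (t *\<^sub>R x) \<le> t * q x" using assms unfolding sublinear_def by blast
  have "q ((1/t) *\<^sub>R (t *\<^sub>R x)) \<le> (1/t) * q (t *\<^sub>R x)"
    using assms unfolding sublinear_def by (meson zero_less_divide_1_iff)
  then show "t * q x \<le> q (t *\<^sub>R x)" using assms(2) by (simp add: field_simps)
qed

lemma sublinear_neg:
  assumes "sublinear q"
  shows "- q (- x) \<le> q x"
proof -
  have "q (x + - x) \<le> q x + q (- x)" using assms unfolding sublinear_def by blast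
  then show ?thesis using sublinear_zero[OF assms] by simp
qed

text \<open>Take the infimum of \<open>q (x + t c) - t b\<close> over \<open>t >= 0\<close> and
  \<open>c\<close> in \<open>C\<close>. The last property at \<open>x = - c\<close> gives
  \<open>q' (- c) <= - b\<close>, so a linear functional below \<open>q'\<close> is at least
  \<open>b\<close> on \<open>C\<close>. A singleton \<open>C\<close> shows that minimal sublinear
  functions are additive; a general convex \<open>C\<close> gives the separation theorem.\<close>

lemma sublinear_shift:
  fixes q :: "'a::real_vector \<Rightarrow> real"
  assumes q: "sublinear q" and C: "convex C" "C \<noteq> {}" and b: "\<And>c. c \<in> C \<Longrightarrow> b \<le> q c"
  obtains q' where "sublinear q'" "\<And>x. q' x \<le> q x"
    "\<And>x c. c \<in> C \<Longrightarrow> q' x \<le> q (x + c) - b"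
proof -
  define g where "g x = (\<lambda>(t, c). q (x + t *\<^sub>R c) - t * b)" for x
  define I where "I = {0::real..} \<times> C"
  define q' where "q' x = (INF i\<in>I. g x i)" for x
  from C obtain c0 where c0: "c0 \<in> C" by blast
  have add: "q (x + y) \<le> q x + q y" for x y using q unfolding sublinear_def by blast
  \<comment> \<open>A lower bound independent of \<open>i\<close>, so that the infimum is finite;
    this is where \<open>b <= q c\<close> enters.\<close>
  have low: "- q (- x) \<le> g x i" if iI: "i \<in> I" for x i
  proof -
    obtain t c where i: "i = (t, c)" "t \<ge> 0" "c \<in> C" using iI unfolding I_def by auto
    have "t * b \<le> q (t *\<^sub>R c)"
    proof (cases "t = 0")
      case False
      then show ?thesis using i b[of c] sublinear_scale[OF q, of t c] by simp
    qed (simp add: sublinear_zero[OF q])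
    also have "\<dots> \<le> q (x + t *\<^sub>R c) + q (- x)"
      using add[of "x + t *\<^sub>R c" "- x"] by simp
    finally show ?thesis unfolding g_def i by simp
  qed
  then have bdd: "bdd_below (g x ` I)" for x by (meson bdd_below.I2)
  have ne: "I \<noteq> {}" using c0 unfolding I_def by auto
  have lower: "q' x \<le> g x i" if "i \<in> I" for x i
    unfolding q'_def using bdd that by (rule cINF_lower)
  have greatest: "m \<le> q' x" if "\<And>i. i \<in> I \<Longrightarrow> m \<le> g x i" for x m
    unfolding q'_def using ne that by (rule cINF_greatest)
  have sum: "q' (x + y) \<le> g x i + g y j" if ij: "i \<in> I" "j \<in> I" for x y i j
  proof -
    obtain t c where i: "i = (t, c)" "t \<ge> 0" "c \<in> C" using ij unfolding I_def by auto
    obtain u d where j: "j = (u, d)" "u \<ge> 0" "d \<in> C" using ij unfolding I_def by auto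
    \<comment> \<open>By convexity the multiples \<open>t c\<close> with \<open>t >= 0\<close> are
      closed under addition.\<close>
    obtain e where e: "e \<in> C" "(t + u) *\<^sub>R e = t *\<^sub>R c + u *\<^sub>R d"
    proof (cases "t + u = 0")
      case True
      then have "t = 0" "u = 0" using i j by auto
      then show ?thesis using that[of c] i by simp
    next
      case False
      then have "t + u > 0" using i j by auto
      then have "(t / (t + u)) *\<^sub>R c + (u / (t + u)) *\<^sub>R d \<in> C"
        using C(1) i j by (intro convexD) (auto simp: add_divide_distrib[symmetric])
      moreover have "(t + u) *\<^sub>R ((t / (t + u)) *\<^sub>R c + (u / (t + u)) *\<^sub>R d) = t *\<^sub>R c + u *\<^sub>R d"
        using False by (simp add: scaleR_add_right)
      ultimately show ?thesis using that by blast
    qed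
    have "q' (x + y) \<le> g (x + y) (t + u, e)" using e i j by (intro lower) (auto simp: I_def)
    also have "\<dots> = q ((x + t *\<^sub>R c) + (y + u *\<^sub>R d)) - (t + u) * b"
      unfolding g_def by (simp add: e(2) add_ac)
    also have "\<dots> \<le> g x i + g y j"
      using add[of "x + t *\<^sub>R c" "y + u *\<^sub>R d"] unfolding g_def i j by (simp add: algebra_simps)
    finally show ?thesis .
  qed
  have "q' (x + y) \<le> q' x + q' y" for x y
  proof -
    have "q' (x + y) - g x i \<le> q' y" if "i \<in> I" for i
      using sum[OF that] by (intro greatest) (simp add: algebra_simps)
    then have "q' (x + y) - q' y \<le> q' x"
      by (intro greatest) (simp add: algebra_simps)
    then show ?thesis by simp
  qed
  moreover have "q' (s *\<^sub>R x) \<le> s * q' x" if "s > 0" for s x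
  proof -
    have "(1/s) * q' (s *\<^sub>R x) \<le> q' x"
    proof (rule greatest)
      fix i assume "i \<in> I"
      then obtain t c where i: "i = (t, c)" "t \<ge> 0" "c \<in> C" unfolding I_def by auto
      have "q' (s *\<^sub>R x) \<le> g (s *\<^sub>R x) (s * t, c)"
        using i that by (intro lower) (auto simp: I_def)
      also have "\<dots> = q (s *\<^sub>R (x + t *\<^sub>R c)) - s * t * b"
        unfolding g_def by (simp add: scaleR_add_right)
      also have "\<dots> = s * g x i"
        unfolding sublinear_scale[OF q that] g_def i by (simp add: algebra_simps)
      finally show "(1/s) * q' (s *\<^sub>R x) \<le> g x i" using that by (simp add: field_simps)
    qed
    then show ?thesis using that by (simp add: field_simps)
  qed
  ultimately have "sublinear q'" unfolding sublinear_def by blast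
  moreover have "q' x \<le> q x" for x
    using lower[of "(0, c0)" x] c0 by (simp add: I_def g_def)
  moreover have "q' x \<le> q (x + c) - b" if "c \<in> C" for x c
    using lower[of "(1, c)" x] that by (simp add: I_def g_def)
  ultimately show thesis by (rule that)
qed

text \<open>Zorn's lemma gives a minimal sublinear function below \<open>p\<close>; if it were not
  additive, \<open>sublinear_shift\<close> would produce a smaller one.\<close>

lemma sublinear_dominates_linear:
  fixes p :: "'a::real_vector \<Rightarrow> real"
  assumes p: "sublinear p"
  obtains u where "linear u" "\<And>x. u x \<le> p x"
proof -
  define A where "A = {q. sublinear q \<and> (\<forall>x. q x \<le> p x)}"
  \<comment> \<open>The pointwise order reversed: the maximal element of Zorn's lemma is then a
    minimal function.\<close>
  define P where "P q q' \<longleftrightarrow> (\<forall>x. q' x \<le> q x)" for q q' :: "'a \<Rightarrow> real"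
  have "\<exists>m\<in>A. \<forall>a\<in>A. P m a \<longrightarrow> a = m"
  proof (rule predicate_Zorn)
    show "partial_order_on A (relation_of P A)"
      unfolding partial_order_on_def preorder_on_def refl_on_def trans_def antisym_def
        relation_of_def P_def
      by (auto intro: order_trans intro!: ext order.antisym)
    fix C assume "C \<in> Chains (relation_of P A)"
    then have CA: "C \<subseteq> A" and chain: "\<And>q q'. q \<in> C \<Longrightarrow> q' \<in> C \<Longrightarrow> P q q' \<or> P q' q"
      unfolding Chains_def relation_of_def by auto
    show "\<exists>u\<in>A. \<forall>a\<in>C. P a u"
    proof (cases "C = {}")
      case True
      have "p \<in> A" using p unfolding A_def by auto
      then show ?thesis using True by blast
    next
      case False
      define u where "u x = (INF q\<in>C. q x)" for x
      have "- p (- x) \<le> q x" if "q \<in> C" for q x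
      proof -
        have "sublinear q" "q (- x) \<le> p (- x)" using that CA unfolding A_def by auto
        then show ?thesis using sublinear_neg[of q x] by simp
      qed
      then have bdd: "bdd_below ((\<lambda>q. q x) ` C)" for x by (meson bdd_below.I2)
      have lower: "u x \<le> q x" if "q \<in> C" for q x
        unfolding u_def using bdd that by (rule cINF_lower)
      have greatest: "m \<le> u x" if "\<And>q. q \<in> C \<Longrightarrow> m \<le> q x" for m x
        unfolding u_def using False that by (rule cINF_greatest)
      have sum: "u (x + y) \<le> q x + q' y" if qq: "q \<in> C" "q' \<in> C" for x y q q'
      proof -
        obtain r where r: "r \<in> C" "P q r" "P q' r"
          using chain[OF qq] qq unfolding P_def by (meson order_refl)
        have "u (x + y) \<le> r (x + y)" using r by (intro lower)
        also have "\<dots> \<le> r x + r y" using r CA unfolding A_def sublinear_def by blast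
        also have "\<dots> \<le> q x + q' y" using r unfolding P_def by (intro add_mono) auto
        finally show ?thesis .
      qed
      have "u (x + y) \<le> u x + u y" for x y
      proof -
        have "u (x + y) - q x \<le> u y" if "q \<in> C" for q
          using sum[OF that] by (intro greatest) (simp add: algebra_simps)
        then have "u (x + y) - u y \<le> u x" by (intro greatest) (simp add: algebra_simps)
        then show ?thesis by simp
      qed
      moreover have "u (t *\<^sub>R x) \<le> t * u x" if "t > 0" for t x
      proof -
        have "(1/t) * u (t *\<^sub>R x) \<le> u x"
        proof (rule greatest)
          fix q assume q: "q \<in> C"
          then have "sublinear q" using CA unfolding A_def by auto
          then show "(1/t) * u (t *\<^sub>R x) \<le> q x"
            using lower[OF q, of "t *\<^sub>R x"] sublinear_scale[of q t x] that by (simp add: field_simps)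
        qed
        then show ?thesis using that by (simp add: field_simps)
      qed
      ultimately have "sublinear u" unfolding sublinear_def by blast
      moreover have "u x \<le> p x" for x
      proof -
        obtain q where "q \<in> C" using False by blast
        moreover from this have "q x \<le> p x" using CA unfolding A_def by auto
        ultimately show ?thesis using lower[of q x] by linarith
      qed
      ultimately have "u \<in> A" unfolding A_def by blast
      then show ?thesis using lower unfolding P_def by blast
    qed
  qed
  then obtain q where qA: "q \<in> A" and min: "\<And>r. r \<in> A \<Longrightarrow> P q r \<Longrightarrow> r = q" by blast
  have q: "sublinear q" and qp: "q x \<le> p x" for x using qA unfolding A_def by auto
  have add: "q (x + y) = q x + q y" for x y
  proof (rule antisym)
    obtain q' where q': "sublinear q'" "\<And>x. q' x \<le> q x" "\<And>x. q' x \<le> q (x + y) - q y"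
      using sublinear_shift[OF q, of "{y}" "q y"] by auto
    have "q' = q" using q' qp by (intro min) (auto simp: A_def P_def intro: order_trans)
    then show "q x + q y \<le> q (x + y)" using q'(3)[of x] by simp
  qed (use q in \<open>auto simp: sublinear_def\<close>)
  have neg: "q (- x) = - q x" for x
    using add[of x "- x"] sublinear_zero[OF q] by simp
  have "q (t *\<^sub>R x) = t * q x" for t x
  proof (cases t "0::real" rule: linorder_cases)
    case less
    then show ?thesis
      using sublinear_scale[OF q, of "- t" x] neg[of "t *\<^sub>R x"] by simp
  qed (auto simp: sublinear_zero[OF q] sublinear_scale[OF q])
  then have "linear q" using add by (intro linearI) auto
  then show thesis using qp by (rule that)
qed

section \<open>Complex scalars and norming functionals\<close>

lemma scaleC_zero [simp]: "c *\<^sub>C (0 :: 'a::complex_normed_vector) = 0"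
  "0 *\<^sub>C (x :: 'a::complex_normed_vector) = 0"
  using norm_scaleC[of c "0::'a"] norm_scaleC[of 0 x] by auto

lemma scaleC_one [simp]: "1 *\<^sub>C (x :: 'a::complex_normed_vector) = x"
  using scaleC_of_real[of 1 x] by simp

lemma scaleC_minus [simp]: "(- c) *\<^sub>C x = - (c *\<^sub>C (x :: 'a::complex_normed_vector))"
  "c *\<^sub>C (- x) = - (c *\<^sub>C x)"
  using scaleC_add_left[of c "-c" x] scaleC_add_right[of c x "-x"]
  by (auto simp: add_eq_0_iff2 add_eq_0_iff)

lemma scaleC_diff_right: "c *\<^sub>C (x - y) = c *\<^sub>C x - c *\<^sub>C (y :: 'a::complex_normed_vector)"
  using scaleC_add_right[of c x "-y"] by simp

lemma scaleC_diff_left: "(c - d) *\<^sub>C x = c *\<^sub>C x - d *\<^sub>C (x :: 'a::complex_normed_vector)"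
  using scaleC_add_left[of c "-d" x] by simp

lemma scaleC_scaleR: "c *\<^sub>C (r *\<^sub>R x) = r *\<^sub>R (c *\<^sub>C (x :: 'a::complex_normed_vector))"
  by (simp add: scaleC_of_real[symmetric] scaleC_scaleC mult.commute)

text \<open>A real functional \<open>u\<close> below the norm shifted along \<open>C\<close> is at
  least 1 on \<open>C\<close>. Then \<open>f x = u x - i u (i x)\<close> is the complex functional
  with real part \<open>u\<close>, and rotating \<open>f x\<close> onto the positive axis transfers
  the norm bound from \<open>u\<close> to \<open>f\<close>.\<close>

lemma cdual_separation:
  fixes C :: "'a::complex_normed_vector set"
  assumes C: "convex C" "C \<noteq> {}" and norm: "\<And>c. c \<in> C \<Longrightarrow> 1 \<le> norm c"
  obtains \<phi> where "norm \<phi> \<le> 1" "\<And>c. c \<in> C \<Longrightarrow> 1 \<le> Re (cdual_apply \<phi> c)"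
proof -
  have "sublinear (norm :: 'a \<Rightarrow> real)" unfolding sublinear_def by (auto intro: norm_triangle_ineq)
  then obtain q where q: "sublinear q" "\<And>x. q x \<le> norm x" "\<And>x c. c \<in> C \<Longrightarrow> q x \<le> norm (x + c) - 1"
    using sublinear_shift[of norm C 1] C norm by blast
  then obtain u where u: "linear u" "\<And>x. u x \<le> q x"
    using sublinear_dominates_linear by blast
  interpret linear u by fact
  define f where "f x = Complex (u x) (- u (\<i> *\<^sub>C x))" for x
  have f_add: "f (x + y) = f x + f y" for x y
    unfolding f_def by (simp add: complex_eq_iff scaleC_add_right add)
  have f_scaleR: "f (r *\<^sub>R x) = of_real r * f x" for r x
    unfolding f_def by (simp add: complex_eq_iff scaleC_scaleR scale)
  have f_i: "f (\<i> *\<^sub>C x) = \<i> * f x" for x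
    unfolding f_def by (simp add: complex_eq_iff scaleC_scaleC neg)
  have f_scale: "f (c *\<^sub>C x) = c * f x" for c x
  proof -
    have "c *\<^sub>C x = Re c *\<^sub>R x + \<i> *\<^sub>C (Im c *\<^sub>R x)"
      by (subst complex_eq[of c]) (simp add: scaleC_add_left scaleC_scaleC[symmetric] scaleC_of_real)
    then have "f (c *\<^sub>C x) = of_real (Re c) * f x + \<i> * (of_real (Im c) * f x)"
      by (simp only: f_add f_scaleR f_i)
    also have "\<dots> = (of_real (Re c) + \<i> * of_real (Im c)) * f x" by (simp add: algebra_simps)
    finally show ?thesis by (simp add: complex_eq[symmetric])
  qed
  have f_bound: "cmod (f x) \<le> norm x" for x
  proof (cases "f x = 0")
    case False
    define c where "c = cnj (f x) / of_real (cmod (f x))"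
    have "c * f x = of_real (cmod (f x))"
      unfolding c_def using False complex_norm_square[of "f x"]
      by (simp add: power2_eq_square mult.commute divide_eq_eq)
    then have "cmod (f x) = Re (f (c *\<^sub>C x))" by (simp add: f_scale)
    also have "\<dots> = u (c *\<^sub>C x)" by (simp add: f_def)
    also have "\<dots> \<le> norm (c *\<^sub>C x)" using u(2) q(2) order_trans by blast
    also have "\<dots> = norm x" using False by (simp add: norm_scaleC c_def norm_divide)
    finally show ?thesis .
  qed simp
  have bl: "bounded_linear f"
    by (rule bounded_linear_intro[where K = 1])
      (auto simp: f_add f_scaleR f_bound scaleR_conv_of_real)
  define \<phi> where "\<phi> = Abs_cdual (Blinfun f)"
  have Rep: "Rep_cdual \<phi> = Blinfun f"
    unfolding \<phi>_def by (rule Abs_cdual_inverse)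
      (auto simp: bl bounded_linear_Blinfun_apply clinear_iff f_add f_scale scaleC_complex_def)
  have ap: "cdual_apply \<phi> x = f x" for x
    by (simp add: cdual_apply.rep_eq Rep bl bounded_linear_Blinfun_apply)
  show thesis
  proof
    show "norm \<phi> \<le> 1"
      unfolding norm_cdual.rep_eq Rep
      by (rule norm_blinfun_bound) (auto simp: bl bounded_linear_Blinfun_apply f_bound)
    fix c assume "c \<in> C"
    then have "u (- c) \<le> - 1" using u(2)[of "- c"] q(3)[of c "- c"] by simp
    then show "1 \<le> Re (cdual_apply \<phi> c)" by (simp add: ap f_def neg)
  qed
qed

lemma norm_le_by_cdual:
  fixes v :: "'a::complex_normed_vector"
  assumes "\<And>\<phi>. norm \<phi> \<le> 1 \<Longrightarrow> cmod (cdual_apply \<phi> v) \<le> B"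
  shows "norm v \<le> B"
proof (cases "v = 0")
  case True
  then show ?thesis using assms[of 0] by (simp add: cdual_apply_simps)
next
  case False
  define w where "w = v /\<^sub>R norm v"
  obtain \<phi> where \<phi>: "norm \<phi> \<le> 1" "1 \<le> Re (cdual_apply \<phi> w)"
    using cdual_separation[of "{w}"] False unfolding w_def by auto
  interpret linear "cdual_apply \<phi>"
    using clinear_cdual_apply[of \<phi>] unfolding clinear_iff
    by (intro linearI) (auto simp: scaleC_of_real[symmetric])
  have "1 \<le> cmod (cdual_apply \<phi> w)" using \<phi>(2) complex_Re_le_cmod order_trans by blast
  also have "cdual_apply \<phi> w = cdual_apply \<phi> v /\<^sub>R norm v" unfolding w_def by (rule scale)
  finally have "norm v \<le> cmod (cdual_apply \<phi> v)" using False by (simp add: field_simps)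
  then show ?thesis using assms[OF \<phi>(1)] by simp
qed

subsection \<open>Bernstein's inequality\<close>

text \<open>The even terms make up a quarter of the Basel sum \<open>pi^2 / 6\<close>.\<close>

lemma sum_inverse_odd_squares_le: "(\<Sum>j<n. 1 / (2 * real j + 1)\<^sup>2) \<le> pi\<^sup>2 / 8"
proof -
  define odd_sum where "odd_sum n = (\<Sum>j<n. 1 / (2 * real j + 1)\<^sup>2)" for n
  define s where "s n = (\<Sum>j<n. 1 / (real j + 1)\<^sup>2)" for n
  have "s (2 * n) = odd_sum n + s n / 4" for n
  proof (induction n)
    case (Suc n)
    have "s (2 * Suc n) = s (2 * n) + 1 / (2 * real n + 1)\<^sup>2 + 1 / (2 * real n + 2)\<^sup>2"
      by (simp add: s_def algebra_simps)
    also have "1 / (2 * real n + 2)\<^sup>2 = (1 / (real n + 1)\<^sup>2) / 4"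
      by (simp add: power2_eq_square field_simps)
    finally show ?case using Suc by (simp add: odd_sum_def s_def add_divide_distrib)
  qed (simp add: odd_sum_def s_def)
  then have eq: "odd_sum n = s (2 * n) - s n / 4" for n by simp
  have "s \<longlonglongrightarrow> pi\<^sup>2 / 6"
    using inverse_squares_sums by (simp add: sums_def s_def[abs_def] add.commute)
  then have "(\<lambda>n. s (2 * n) - s n / 4) \<longlonglongrightarrow> pi\<^sup>2 / 6 - (pi\<^sup>2 / 6) / 4"
    by (intro tendsto_intros LIMSEQ_subseq_LIMSEQ[of s _ "\<lambda>n. 2 * n", unfolded o_def])
      (auto simp: strict_mono_def)
  then have "odd_sum \<longlonglongrightarrow> pi\<^sup>2 / 8" by (simp add: eq[symmetric])
  moreover have "incseq odd_sum" by (intro incseq_SucI) (simp add: odd_sum_def)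
  ultimately have "odd_sum n \<le> pi\<^sup>2 / 8" by (rule incseq_le[rotated])
  then show ?thesis by (simp add: odd_sum_def)
qed

text \<open>Where \<open>cos (Re z) ^ 2 = 1\<close>, the modulus of \<open>cos z\<close> is
  \<open>cosh (Im z)\<close>. The factor 1/4, where 1/2 would do, is the one that also serves the
  horizontal sides of the contour.\<close>

lemma norm_cos_ge_vertical:
  assumes "cos (Re z) ^ 2 = 1"
  shows "exp \<bar>Im z\<bar> / 4 \<le> cmod (cos z)"
proof -
  define E where "E = exp (Im z)"
  have E: "E > 0" "exp (- Im z) = inverse E" by (simp_all add: E_def exp_minus)
  have "1 + (E - I)\<^sup>2 / 4 = ((E + I) / 2)\<^sup>2" if "E * I = 1" for I
    using that by (simp add: power_divide power2_sum power2_diff field_simps)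
  from this[of "inverse E"] have "cmod (cos z) ^ 2 = ((E + inverse E) / 2) ^ 2"
    using E unfolding norm_cos_squared assms E_def[symmetric] by simp
  then have "cmod (cos z) = (E + inverse E) / 2"
    by (rule power2_eq_imp_eq) (use E(1) in auto)
  moreover have "exp \<bar>Im z\<bar> \<le> E + inverse E"
  proof -
    have "exp \<bar>Im z\<bar> = E \<or> exp \<bar>Im z\<bar> = inverse E"
      unfolding E_def by (cases "Im z \<ge> 0") (simp_all add: exp_minus)
    moreover have "inverse E > 0" using E by simp
    ultimately show ?thesis using E(1) by linarith
  qed
  ultimately have "exp \<bar>Im z\<bar> / 2 \<le> cmod (cos z)" by simp
  moreover have "exp \<bar>Im z\<bar> / 4 \<le> exp \<bar>Im z\<bar> / 2" by simp
  ultimately show ?thesis by (rule order_trans[rotated])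
qed

lemma norm_cos_ge_horizontal:
  assumes "1 \<le> \<bar>Im z\<bar>"
  shows "exp \<bar>Im z\<bar> / 4 \<le> cmod (cos z)"
proof -
  define F where "F = exp \<bar>Im z\<bar>"
  have "F \<ge> 1 + \<bar>Im z\<bar>" unfolding F_def by (rule exp_ge_add_one_self)
  then have F: "F \<ge> 2" using assms by simp
  have inv: "inverse F \<le> 1/2" using F by (simp add: field_simps)
  have "(F / 4) ^ 2 \<le> ((F - inverse F) / 2) ^ 2"
    using F inv by (intro power_mono) auto
  also have "\<dots> = (exp (Im z) - inverse (exp (Im z)))\<^sup>2 / 4"
    using power2_commute[of "exp (- Im z)" "exp (Im z)"]
    by (cases "Im z \<ge> 0") (simp_all add: F_def exp_minus power_divide)
  also have "\<dots> \<le> cmod (cos z) ^ 2" unfolding norm_cos_squared by simp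
  finally show ?thesis unfolding F_def by (rule power2_le_imp_le) simp
qed

text \<open>The function \<open>f z / (z\<^sup>2 * cos z)\<close> has residue \<open>f' 0\<close> at the origin, and
  its residues at the zeros of the cosine have total absolute value at most \<open>M\<close>.\<close>

lemma bernstein_unit:
  fixes f :: "complex \<Rightarrow> complex"
  assumes f: "f holomorphic_on UNIV" and M: "\<And>x::real. cmod (f (of_real x)) \<le> M"
    and C: "\<And>z. cmod (f z) \<le> C * exp \<bar>Im z\<bar>"
  shows "cmod (deriv f 0) \<le> M"
proof -
  define g where "g z = f z / (z\<^sup>2 * cos z)" for z
  define p where "p k = complex_of_real ((of_int k + 1/2) * pi)" for k :: int
  have C0: "C \<ge> 0" using C[of 0] norm_ge_zero[of "f 0"] by (simp del: norm_ge_zero)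
  have M0: "M \<ge> 0" using M[of 0] norm_ge_zero[of "f 0"] by (simp del: norm_ge_zero)
  have p_nz: "p k \<noteq> 0" for k
  proof
    assume "p k = 0"
    then have "(of_int k + 1/2) * pi = 0" unfolding p_def of_real_eq_0_iff .
    then have "of_int k + 1/2 = (0::real)" by simp
    then have "2 * k + 1 = 0" by linarith
    then show False by presburger
  qed
  have cos_p: "cos (p k) = 0" for k
    unfolding cos_eq_0 by (rule exI[of _ k]) (simp add: p_def distrib_right)
  have sin_p: "cmod (sin (p k)) = 1" for k
  proof -
    have "sin (p k) ^ 2 = 1" using sin_cos_squared_add[of "p k"] by (simp add: cos_p)
    then have "cmod (sin (p k)) ^ 2 = 1" by (metis norm_one norm_power)
    then show ?thesis by (simp add: power2_eq_1_iff) (smt (verit) norm_ge_zero)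
  qed
  \<comment> \<open>The contour is the square of half-side \<open>n pi\<close>; its integral
    contributes the error term, which disappears for large \<open>n\<close>.\<close>
  have bound: "cmod (deriv f 0) \<le> M + 16 * C / (real n * pi)" if n: "n \<ge> 1" for n :: nat
  proof -
    define S where "S = {z::complex. \<bar>Re z\<bar> < (real n + 1/2) * pi}"
    define K where "K = {- int n..int n - 1}"
    define pts where "pts = insert 0 (p ` K)"
    \<comment> \<open>The vertical sides then run midway between consecutive zeros of the cosine,
      where \<open>cos (Re z) ^ 2 = 1\<close>. The strip \<open>S\<close> is wider than the square
      but contains no further zeros.\<close>
    define L where "L = real n * pi"
    define a where "a = Complex (- L) (- L)"
    define b where "b = Complex L L"
    have L: "L \<ge> 1" using n pi_gt3 mult_mono[of 1 "real n" 1 pi] unfolding L_def by simp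
    have LS: "L < (real n + 1/2) * pi" unfolding L_def using pi_gt_zero by (simp add: algebra_simps)
    have S_eq: "S = {z. Re z < (real n + 1/2) * pi} \<inter> {z. Re z > - ((real n + 1/2) * pi)}"
      unfolding S_def by auto
    have S: "open S" "connected S"
      unfolding S_eq
      by (intro open_Int open_halfspace_Re_lt open_halfspace_Re_gt convex_connected
        convex_Int convex_halfspace_Re_lt convex_halfspace_Re_gt)+
    have zeros: "z \<in> pts" if "z \<in> S" "z\<^sup>2 * cos z = 0" for z
    proof (cases "z = 0")
      case False
      with that(2) have "cos z = 0" by simp
      then obtain k :: int where k: "z = p k" unfolding cos_eq_0 p_def by (auto simp: distrib_right)
      with that(1) have "\<bar>(of_int k + 1/2) * pi\<bar> < (real n + 1/2) * pi"
        unfolding S_def p_def by simp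
      then have "\<bar>of_int k + 1/2 :: real\<bar> < real n + 1/2" by (simp add: abs_mult)
      then have "k \<in> K" unfolding K_def by (auto simp: abs_less_iff)
      then show ?thesis using k unfolding pts_def by blast
    qed (simp add: pts_def)
    have g_holo: "g holomorphic_on S - pts"
      unfolding g_def using zeros
      by (intro holomorphic_intros holomorphic_on_subset[OF f]) auto
    have pts_box: "z \<in> box a b" if z: "z \<in> pts" for z
    proof -
      have "\<bar>Re z\<bar> < L \<and> Im z = 0"
      proof (cases "z = 0")
        case False
        then obtain k where k: "k \<in> K" "z = p k" using z unfolding pts_def by auto
        then have "\<bar>of_int k + 1/2 :: real\<bar> < real n" unfolding K_def by (auto simp: abs_less_iff)
        then have "\<bar>of_int k + 1/2 :: real\<bar> * pi < real n * pi" by simp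
        then show ?thesis unfolding k p_def L_def by (simp add: abs_mult)
      qed (use L in auto)
      then show ?thesis using L unfolding in_box_complex_iff a_def b_def by (auto simp: abs_less_iff)
    qed
    have path: "\<bar>Re z\<bar> = L \<and> \<bar>Im z\<bar> \<le> L \<or> \<bar>Im z\<bar> = L \<and> \<bar>Re z\<bar> \<le> L"
      if "z \<in> path_image (rectpath a b)" for z
      using that L by (subst (asm) path_image_rectpath) (auto simp: a_def b_def abs_if split: if_splits)
    have path_S: "path_image (rectpath a b) \<subseteq> S - pts"
    proof
      fix z assume z: "z \<in> path_image (rectpath a b)"
      then have "z \<in> S" using path[OF z] LS unfolding S_def by auto
      moreover have "z \<notin> box a b" using path[OF z] unfolding in_box_complex_iff a_def b_def
        by (auto simp: abs_if split: if_splits)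
      ultimately show "z \<in> S - pts" using pts_box by blast
    qed
    have "contour_integral (rectpath a b) g =
        2 * pi * \<i> * (\<Sum>p\<in>pts. winding_number (rectpath a b) p * residue g p)"
    proof (rule Residue_theorem[OF S _ g_holo])
      show "finite pts" unfolding pts_def K_def by simp
      show "\<forall>z. z \<notin> S \<longrightarrow> winding_number (rectpath a b) z = 0"
      proof (intro allI impI winding_number_rectpath_outside)
        fix z assume "z \<notin> S"
        then show "z \<notin> cbox a b"
          using LS unfolding S_def in_cbox_complex_iff a_def b_def by auto
      qed (use L in \<open>auto simp: a_def b_def\<close>)
    qed (use path_S in auto)
    also have "(\<Sum>p\<in>pts. winding_number (rectpath a b) p * residue g p) = (\<Sum>p\<in>pts. residue g p)"
      by (intro sum.cong refl) (simp add: winding_number_rectpath pts_box)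
    also have "\<dots> = residue g 0 + (\<Sum>k\<in>K. residue g (p k))"
    proof -
      have "inj_on p K" unfolding p_def inj_on_def by simp
      moreover have "0 \<notin> p ` K" using p_nz by force
      ultimately show ?thesis unfolding pts_def by (simp add: K_def sum.reindex)
    qed
    also have "residue g 0 = deriv f 0"
    proof -
      have cos_nz: "cos z \<noteq> 0" if "z \<in> ball 0 1" for z :: complex
      proof
        assume "cos z = 0"
        then obtain k :: int where k: "z = p k" unfolding cos_eq_0 p_def by (auto simp: distrib_right)
        have "\<bar>of_int k + 1/2 :: real\<bar> \<ge> 1/2" by (cases "k \<ge> 0") auto
        then have "\<bar>of_int k + 1/2 :: real\<bar> * pi \<ge> 1/2 * 3" using pi_gt3 by (intro mult_mono) auto
        then show False using that unfolding k p_def by (simp add: norm_mult abs_mult del: of_real_mult)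
      qed
      have df: "(f has_field_derivative deriv f 0) (at 0)"
        using f by (simp add: holomorphic_derivI)
      have "((\<lambda>z. f z / cos z) has_field_derivative deriv f 0) (at 0)"
        by (rule derivative_eq_intros df refl | simp)+
      then have "deriv (\<lambda>z. f z / cos z) 0 = deriv f 0" by (rule DERIV_imp_deriv)
      moreover have "residue (\<lambda>z. (f z / cos z) / z ^ Suc 1) 0 = (deriv ^^ 1) (\<lambda>z. f z / cos z) 0 / fact 1"
        by (rule residue_holomorphic_over_power'[of "ball 0 1"])
          (use cos_nz in \<open>auto intro!: holomorphic_on_divide holomorphic_on_cos
            holomorphic_on_ident holomorphic_on_subset[OF f]\<close>)
      moreover have "(\<lambda>z. (f z / cos z) / z ^ Suc 1) = g"
        unfolding g_def by (auto simp: power2_eq_square field_simps)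
      ultimately show ?thesis by simp
    qed
    finally have res: "contour_integral (rectpath a b) g =
        2 * pi * \<i> * (deriv f 0 + (\<Sum>k\<in>K. residue g (p k)))" .
    have res_le: "cmod (residue g (p k)) \<le> M * (1 / ((of_int k + 1/2) * pi)\<^sup>2)" if "k \<in> K" for k
    proof -
      have "p k \<in> S" using pts_box[of "p k"] that LS
        unfolding pts_def in_box_complex_iff a_def b_def S_def by auto
      then have "open (S - (pts - {p k}))" "p k \<in> S - (pts - {p k})"
        using S by (auto intro!: open_Diff finite_imp_closed simp: pts_def K_def)
      moreover have "S - (pts - {p k}) - {p k} = S - pts" using that unfolding pts_def by auto
      moreover have "((\<lambda>w. g w * (w - p k)) \<longlongrightarrow> f (p k) / (p k)\<^sup>2 / (- sin (p k))) (at (p k))"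
      proof -
        have "(cos has_field_derivative - sin (p k)) (at (p k))"
          by (auto intro!: derivative_eq_intros)
        then have "((\<lambda>w. (cos w - cos (p k)) / (w - p k)) \<longlongrightarrow> - sin (p k)) (at (p k))"
          unfolding has_field_derivative_iff .
        then have "((\<lambda>w. cos w / (w - p k)) \<longlongrightarrow> - sin (p k)) (at (p k))" by (simp add: cos_p)
        moreover have "isCont f (p k)"
          using f holomorphic_on_imp_continuous_on continuous_on_eq_continuous_at by blast
        ultimately have "((\<lambda>w. f w / w\<^sup>2 / (cos w / (w - p k))) \<longlongrightarrow> f (p k) / (p k)\<^sup>2 / (- sin (p k))) (at (p k))"
          using sin_p[of k] p_nz[of k] by (intro tendsto_intros) (auto simp: isCont_def)
        then show ?thesis unfolding g_def by (simp add: field_simps)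
      qed
      ultimately have "residue g (p k) = f (p k) / (p k)\<^sup>2 / (- sin (p k))"
        using g_holo by (intro residue_simple'[of "S - (pts - {p k})"]) auto
      then have "cmod (residue g (p k)) = cmod (f (p k)) * (1 / cmod (p k) ^ 2)"
        by (simp add: norm_divide norm_mult norm_power sin_p)
      also have "cmod (p k) ^ 2 = ((of_int k + 1/2) * pi)\<^sup>2"
        unfolding p_def norm_of_real by simp
      also have "cmod (f (p k)) * (1 / ((of_int k + 1/2) * pi)\<^sup>2) \<le> M * (1 / ((of_int k + 1/2) * pi)\<^sup>2)"
        unfolding p_def by (intro mult_right_mono M) auto
      finally show ?thesis .
    qed
    \<comment> \<open>Over all zeros of the cosine the sum is exactly
      \<open>8 / pi^2 * (pi^2 / 8) = 1\<close>, which is the origin of the constant 1 in the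
      inequality. The zeros with indices \<open>k\<close> and \<open>- k - 1\<close> contribute
      equally.\<close>
    have "(\<Sum>k\<in>K. 1 / ((of_int k + 1/2) * pi)\<^sup>2) \<le> 1"
    proof -
      define q where "q k = 1 / ((of_int k + 1/2) * pi)\<^sup>2" for k :: int
      have "K = int ` {..<n} \<union> (\<lambda>j. - int j - 1) ` {..<n}" (is "_ = ?A \<union> ?B")
      proof (intro equalityI subsetI)
        fix k assume "k \<in> K"
        then show "k \<in> ?A \<union> ?B"
        proof (cases "k \<ge> 0")
          case True
          then have "k = int (nat k)" "nat k < n" using \<open>k \<in> K\<close> unfolding K_def by auto
          then show ?thesis by blast
        next
          case False
          then have "k = - int (nat (- k - 1)) - 1" "nat (- k - 1) < n"
            using \<open>k \<in> K\<close> unfolding K_def by auto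
          then show ?thesis by blast
        qed
      qed (auto simp: K_def)
      moreover have "?A \<inter> ?B = {}" by auto
      ultimately have "sum q K = sum q ?A + sum q ?B" by (simp add: sum.union_disjoint)
      also have "sum q ?A = (\<Sum>j<n. q (int j))" by (subst sum.reindex) (auto simp: inj_on_def)
      also have "sum q ?B = (\<Sum>j<n. q (- int j - 1))" by (subst sum.reindex) (auto simp: inj_on_def)
      also have "(\<Sum>j<n. q (- int j - 1)) = (\<Sum>j<n. q (int j))"
        by (intro sum.cong refl) (simp add: q_def power2_eq_square algebra_simps)
      also have "(\<Sum>j<n. q (int j)) = 4 / pi\<^sup>2 * (\<Sum>j<n. 1 / (2 * real j + 1)\<^sup>2)"
        unfolding sum_distrib_left
        by (intro sum.cong refl) (simp add: q_def power2_eq_square divide_simps, simp add: algebra_simps)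
      also have "\<dots> + \<dots> \<le> 1"
        using mult_left_mono[OF sum_inverse_odd_squares_le[of n], of "8 / pi\<^sup>2"] by simp
      finally show ?thesis unfolding q_def .
    qed
    then have sum_le: "cmod (\<Sum>k\<in>K. residue g (p k)) \<le> M"
    proof -
      assume *: "(\<Sum>k\<in>K. 1 / ((of_int k + 1/2) * pi)\<^sup>2) \<le> 1"
      have "cmod (\<Sum>k\<in>K. residue g (p k)) \<le> (\<Sum>k\<in>K. M * (1 / ((of_int k + 1/2) * pi)\<^sup>2))"
        by (intro sum_norm_le res_le)
      also have "\<dots> = M * (\<Sum>k\<in>K. 1 / ((of_int k + 1/2) * pi)\<^sup>2)" by (simp add: sum_distrib_left)
      also have "\<dots> \<le> M * 1" using M0 * by (intro mult_left_mono)
      finally show ?thesis by simp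
    qed
    define B where "B = 4 * C / L\<^sup>2"
    have B0: "B \<ge> 0" unfolding B_def using C0 by simp
    have g_le: "cmod (g z) \<le> B" if z: "z \<in> path_image (rectpath a b)" for z
    proof -
      have "\<bar>Re z\<bar> = L \<Longrightarrow> cos (Re z) ^ 2 = 1"
      proof -
        assume "\<bar>Re z\<bar> = L"
        then have "cos (Re z) = cos L" by (metis cos_abs_real)
        then show ?thesis unfolding L_def by (simp add: cos_npi minus_one_power_iff)
      qed
      then have cos: "exp \<bar>Im z\<bar> / 4 \<le> cmod (cos z)"
        using path[OF z] norm_cos_ge_vertical[of z] norm_cos_ge_horizontal[of z] L by auto
      have "L \<le> cmod z" using path[OF z] abs_Re_le_cmod[of z] abs_Im_le_cmod[of z] by linarith
      then have "L\<^sup>2 \<le> cmod z ^ 2" using L by (intro power_mono) auto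
      then have "L\<^sup>2 * (exp \<bar>Im z\<bar> / 4) \<le> cmod (z\<^sup>2 * cos z)"
        unfolding norm_mult norm_power using cos by (intro mult_mono) auto
      then have "cmod (g z) \<le> C * exp \<bar>Im z\<bar> / (L\<^sup>2 * (exp \<bar>Im z\<bar> / 4))"
        unfolding g_def norm_divide using C C0 L by (intro frac_le) auto
      also have "\<dots> = B" unfolding B_def by simp
      finally show ?thesis .
    qed
    have "cmod (contour_integral (rectpath a b) g) \<le> B * (8 * L)"
    proof -
      define c where "c = Complex L (- L)"
      define d where "d = Complex (- L) L"
      have rp: "rectpath a b = linepath a c +++ linepath c b +++ linepath b d +++ linepath d a"
        unfolding rectpath_def a_def b_def c_def d_def by (simp add: Let_def)
      have im: "path_image (rectpath a b) =
          closed_segment a c \<union> closed_segment c b \<union> closed_segment b d \<union> closed_segment d a"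
        unfolding rp by (simp add: path_image_join Un_assoc)
      have cont: "continuous_on (path_image (rectpath a b)) g"
        using holomorphic_on_imp_continuous_on[OF g_holo] path_S continuous_on_subset by blast
      have int: "g contour_integrable_on linepath u v \<and>
          cmod (contour_integral (linepath u v) g) \<le> B * cmod (v - u)"
        if "closed_segment u v \<subseteq> path_image (rectpath a b)" for u v
      proof -
        have "g contour_integrable_on linepath u v"
          using cont that by (intro contour_integrable_continuous_linepath) (rule continuous_on_subset)
        then show ?thesis
          using that g_le B0 by (auto intro!: contour_integral_bound_linepath)
      qed
      have i: "g contour_integrable_on linepath a c" "g contour_integrable_on linepath c b"
        "g contour_integrable_on linepath b d" "g contour_integrable_on linepath d a"
        using int im by auto
      have "contour_integral (rectpath a b) g = contour_integral (linepath a c) g +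
          (contour_integral (linepath c b) g + (contour_integral (linepath b d) g + contour_integral (linepath d a) g))"
        unfolding rp using i by (simp add: contour_integrable_join valid_path_join)
      also have "cmod \<dots> \<le> B * cmod (c - a) + (B * cmod (b - c) + (B * cmod (d - b) + B * cmod (a - d)))"
        by (intro norm_triangle_le add_mono) (use int im in auto)
      also have "\<dots> = B * (8 * L)"
      proof -
        have "cmod (c - a) = 2 * L" "cmod (b - c) = 2 * L" "cmod (d - b) = 2 * L" "cmod (a - d) = 2 * L"
          using L unfolding a_def b_def c_def d_def by (auto simp: cmod_def real_sqrt_mult)
        then show ?thesis by (simp add: algebra_simps)
      qed
      finally show ?thesis .
    qed
    also have "B * (8 * L) = 32 * C / L" unfolding B_def using L by (simp add: power2_eq_square)
    finally have "2 * pi * cmod (deriv f 0 + (\<Sum>k\<in>K. residue g (p k))) \<le> 32 * C / L"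
      unfolding res by (simp add: norm_mult)
    then have "cmod (deriv f 0 + (\<Sum>k\<in>K. residue g (p k))) \<le> 32 * C / L / (2 * pi)"
      by (subst pos_le_divide_eq) (simp_all only: mult.commute, simp)
    also have "\<dots> \<le> 32 * C / L / 2"
      using C0 L pi_gt3 by (intro divide_left_mono) auto
    finally have "cmod (deriv f 0 + (\<Sum>k\<in>K. residue g (p k))) \<le> 16 * C / L" by simp
    then show ?thesis
      using sum_le norm_triangle_ineq4[of "deriv f 0 + (\<Sum>k\<in>K. residue g (p k))" "\<Sum>k\<in>K. residue g (p k)"]
      unfolding L_def by simp
  qed
  have "(\<lambda>n. M + 16 * C / pi * (1 / real n)) \<longlonglongrightarrow> M + 16 * C / pi * 0"
    by (intro tendsto_intros lim_1_over_n)
  then show ?thesis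
    using bound by (intro LIMSEQ_le_const[of "\<lambda>n. M + 16 * C / pi * (1 / real n)"])
      (auto intro!: exI[of _ 1] simp: mult.commute)
qed

lemma bernstein:
  fixes f :: "complex \<Rightarrow> complex"
  assumes f: "f holomorphic_on UNIV" and M: "\<And>x::real. cmod (f (of_real x)) \<le> M"
    and C: "\<And>z. cmod (f z) \<le> C * exp (r * \<bar>Im z\<bar>)" and r: "r > 0"
  shows "cmod (deriv f 0) \<le> r * M"
proof -
  define g where "g z = f (z / of_real r)" for z
  have df: "(f has_field_derivative deriv f 0) (at (0 / of_real r))"
    using f by (simp add: holomorphic_derivI)
  have "(g has_field_derivative deriv f 0 * (1 / of_real r)) (at 0)"
    unfolding g_def
    by (rule DERIV_chain2[where g = "\<lambda>z. z / of_real r" and f = f, OF df]) (use r in \<open>auto intro!: derivative_eq_intros\<close>)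
  then have "deriv g 0 = deriv f 0 / of_real r" by (simp add: DERIV_imp_deriv)
  moreover have "cmod (deriv g 0) \<le> M"
  proof (rule bernstein_unit)
    show "g holomorphic_on UNIV"
      unfolding g_def
      by (rule holomorphic_on_compose_gen[OF _ f, of "\<lambda>z. z / of_real r" UNIV, unfolded o_def])
        (use r in \<open>auto intro!: holomorphic_intros\<close>)
    show "cmod (g (of_real x)) \<le> M" for x unfolding g_def using M[of "x / r"] by simp
    show "cmod (g z) \<le> C * exp \<bar>Im z\<bar>" for z
      unfolding g_def using C[of "z / of_real r"] r by simp
  qed
  ultimately show ?thesis using r by (simp add: norm_divide divide_le_eq mult.commute)
qed

subsection \<open>Hermitian operators\<close>

lemma bounded_linear_cdual_apply: "bounded_linear (cdual_apply \<phi>)"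
  by transfer (rule blinfun.bounded_linear_right)

lemma cdual_apply_vector:
  "cdual_apply \<phi> 0 = 0"
  "cdual_apply \<phi> (x + y) = cdual_apply \<phi> x + cdual_apply \<phi> y"
  "cdual_apply \<phi> (x - y) = cdual_apply \<phi> x - cdual_apply \<phi> y"
  "cdual_apply \<phi> (- x) = - cdual_apply \<phi> x"
  "cdual_apply \<phi> (r *\<^sub>R x) = of_real r * cdual_apply \<phi> x"
  "cdual_apply \<phi> (c *\<^sub>C x) = c * cdual_apply \<phi> x"
proof -
  interpret bounded_linear "cdual_apply \<phi>" by (rule bounded_linear_cdual_apply)
  show "cdual_apply \<phi> 0 = 0"
    "cdual_apply \<phi> (x + y) = cdual_apply \<phi> x + cdual_apply \<phi> y"
    "cdual_apply \<phi> (x - y) = cdual_apply \<phi> x - cdual_apply \<phi> y"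
    "cdual_apply \<phi> (- x) = - cdual_apply \<phi> x"
    by (rule zero add diff neg)+
  show "cdual_apply \<phi> (r *\<^sub>R x) = of_real r * cdual_apply \<phi> x"
    by (simp add: scale scaleR_conv_of_real)
  show "cdual_apply \<phi> (c *\<^sub>C x) = c * cdual_apply \<phi> x"
    using clinear_cdual_apply[of \<phi>] by (simp add: clinear_iff scaleC_complex_def)
qed

lemma clinear_simps:
  assumes "clinear f"
  shows "f 0 = 0" "f (x + y) = f x + f y" "f (x - y) = f x - f y" "f (- x) = - f x"
    "f (r *\<^sub>R x) = r *\<^sub>R f x" "f (c *\<^sub>C x) = c *\<^sub>C f x"
proof -
  show add: "f (x + y) = f x + f y" and scale: "f (c *\<^sub>C x) = c *\<^sub>C f x" for x y c
    using assms by (auto simp: clinear_iff)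
  show scaleR: "f (r *\<^sub>R x) = r *\<^sub>R f x" for r x
    using scale[of "of_real r" x] by (simp add: scaleC_of_real)
  show "f 0 = 0" using scaleR[of 0 0] by simp
  show minus: "f (- x) = - f x" for x using scaleR[of "-1" x] by simp
  show "f (x - y) = f x - f y" using add[of x "- y"] minus[of y] by simp
qed

lemma clinear_funpow:
  fixes f :: "'a::complex_normed_vector \<Rightarrow> 'a"
  shows "clinear f \<Longrightarrow> clinear (f ^^ n)"
  by (induction n) (auto simp: clinear_iff)

lemma norm_funpow_le:
  fixes f :: "'a::real_normed_vector \<Rightarrow> 'a"
  assumes "\<And>x. norm (f x) \<le> K * norm x" "K \<ge> 0"
  shows "norm ((f ^^ n) x) \<le> K ^ n * norm x"
proof (induction n)
  case (Suc n)
  have "norm ((f ^^ Suc n) x) \<le> K * norm ((f ^^ n) x)" using assms(1) by simp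
  also have "\<dots> \<le> K * (K ^ n * norm x)" using Suc assms(2) by (intro mult_left_mono)
  finally show ?case by (simp add: mult.assoc)
qed simp

text \<open>The spectrum is defined through bounded linear inverses; for an inverse \<open>B\<close>
  given merely as a function, linearity follows from the injectivity of
  \<open>A - \<mu>\<close>.\<close>

lemma not_in_op_spectrumI:
  fixes A :: "'a::cbanach \<Rightarrow> 'a"
  assumes A: "clinear A" and B: "\<And>x. A (B x) - \<mu> *\<^sub>C B x = x" "\<And>x. B (A x - \<mu> *\<^sub>C x) = x"
    and b: "b \<ge> 0" "\<And>x. norm (B x) \<le> b * norm x"
  shows "\<mu> \<notin> op_spectrum A"
proof -
  note lin = clinear_simps[OF A]
  have inj: "x = y" if "A x - \<mu> *\<^sub>C x = A y - \<mu> *\<^sub>C y" for x y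
    using B(2)[of x] B(2)[of y] that by metis
  have "B (x + y) = B x + B y" for x y
  proof (rule inj)
    have "A (B x + B y) - \<mu> *\<^sub>C (B x + B y) = (A (B x) - \<mu> *\<^sub>C B x) + (A (B y) - \<mu> *\<^sub>C B y)"
      by (simp add: lin scaleC_add_right)
    then show "A (B (x + y)) - \<mu> *\<^sub>C B (x + y) = A (B x + B y) - \<mu> *\<^sub>C (B x + B y)"
      by (simp only: B(1))
  qed
  moreover have scale: "B (c *\<^sub>C x) = c *\<^sub>C B x" for c x
  proof (rule inj)
    have "A (c *\<^sub>C B x) - \<mu> *\<^sub>C c *\<^sub>C B x = c *\<^sub>C (A (B x) - \<mu> *\<^sub>C B x)"
      by (simp add: lin scaleC_diff_right scaleC_scaleC mult.commute)
    then show "A (B (c *\<^sub>C x)) - \<mu> *\<^sub>C B (c *\<^sub>C x) = A (c *\<^sub>C B x) - \<mu> *\<^sub>C c *\<^sub>C B x"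
      by (simp only: B(1))
  qed
  ultimately have cl: "clinear B" by (simp add: clinear_iff)
  have "bounded_linear B"
    using b by (intro bounded_linear_intro[where K = b])
      (auto simp: clinear_simps[OF cl] mult.commute)
  with cl B show ?thesis unfolding op_spectrum_def by blast
qed

text \<open>\<open>A x - \<nu> x = v\<close> is the fixed point equation
  \<open>x = B (v + (\<nu> - \<mu>) x)\<close>, whose right-hand side is a contraction in
  \<open>x\<close> by the last assumption. Thus the resolvent set is open, with a radius controlled
  by the bound on the inverse.\<close>

lemma op_spectrum_perturb:
  fixes A :: "'a::cbanach \<Rightarrow> 'a"
  assumes A: "clinear A" and B: "clinear B" "\<And>x. A (B x) - \<mu> *\<^sub>C B x = x" "\<And>x. B (A x - \<mu> *\<^sub>C x) = x"
    and b: "b \<ge> 0" "\<And>x. norm (B x) \<le> b * norm x" and \<nu>: "cmod (\<nu> - \<mu>) * b < 1"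
  shows "\<nu> \<notin> op_spectrum A"
proof -
  define d where "d = \<nu> - \<mu>"
  define c where "c = cmod d * b"
  have c: "0 \<le> c" "c < 1" using b \<nu> by (auto simp: c_def d_def)
  note linB = clinear_simps[OF B(1)]
  have fix_iff: "B (v + d *\<^sub>C x) = x \<longleftrightarrow> A x - \<nu> *\<^sub>C x = v" for v x
  proof -
    have "B (v + d *\<^sub>C x) = x \<longleftrightarrow> v + d *\<^sub>C x = A x - \<mu> *\<^sub>C x"
      using B(2,3) by metis
    also have "\<dots> \<longleftrightarrow> A x - \<nu> *\<^sub>C x = v"
      unfolding d_def by (auto simp: scaleC_diff_left algebra_simps)
    finally show ?thesis .
  qed
  have ex1: "\<exists>!x. A x - \<nu> *\<^sub>C x = v" for v
  proof -
    have "\<exists>!x. B (v + d *\<^sub>C x) = x"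
    proof (rule banach_fix_type[OF c], intro allI)
      fix x y
      have "dist (B (v + d *\<^sub>C x)) (B (v + d *\<^sub>C y)) = norm (B (d *\<^sub>C (x - y)))"
        by (simp add: dist_norm linB scaleC_diff_right)
      also have "\<dots> \<le> b * norm (d *\<^sub>C (x - y))" by (rule b)
      finally show "dist (B (v + d *\<^sub>C x)) (B (v + d *\<^sub>C y)) \<le> c * dist x y"
        by (simp add: norm_scaleC dist_norm c_def mult_ac)
    qed
    then show ?thesis unfolding fix_iff .
  qed
  define R where "R v = (THE x. A x - \<nu> *\<^sub>C x = v)" for v
  have R1: "A (R v) - \<nu> *\<^sub>C R v = v" for v
    unfolding R_def by (rule theI'[OF ex1])
  have R2: "R (A x - \<nu> *\<^sub>C x) = x" for x
    using R1 ex1 by metis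
  have "norm (R v) \<le> b / (1 - c) * norm v" for v
  proof -
    have "norm (R v) = norm (B (v + d *\<^sub>C R v))"
      using fix_iff[of v "R v"] R1 by simp
    also have "\<dots> \<le> b * (norm v + cmod d * norm (R v))"
      using b by (intro order_trans[OF b(2)] mult_left_mono norm_triangle_le) (auto simp: norm_scaleC)
    finally show ?thesis using c by (simp add: c_def field_simps)
  qed
  moreover have "b / (1 - c) \<ge> 0" using b c by simp
  ultimately show ?thesis using not_in_op_spectrumI[OF A R1 R2] by blast
qed

text \<open>At distance \<open>c / 4\<close> from \<open>\<mu>\<close>, off the real axis, the
  inverse exists. The lower bound persists there with constant \<open>3 c / 4\<close>, so the
  inverse has norm at most \<open>4 / (3 c)\<close>. As
  \<open>c / 4 * 4 / (3 c) = 1 / 3 < 1\<close>, the perturbation lemma reaches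
  \<open>\<mu>\<close>.\<close>

lemma not_in_real_spectrum_if_bounded_below:
  fixes A :: "'a::cbanach \<Rightarrow> 'a"
  assumes A: "clinear A" and sp: "op_spectrum A \<subseteq> \<real>" and c: "c > 0"
    and below: "\<And>v. c * norm v \<le> norm (A v - \<mu> *\<^sub>R v)"
  shows "of_real \<mu> \<notin> op_spectrum A"
proof -
  define \<mu>0 where "\<mu>0 = Complex \<mu> (c / 4)"
  have "\<mu>0 \<notin> \<real>" using c by (simp add: \<mu>0_def complex_is_Real_iff)
  then obtain B where B: "clinear B" "\<And>x. B (A x - \<mu>0 *\<^sub>C x) = x" "\<And>x. A (B x) - \<mu>0 *\<^sub>C B x = x"
    using sp unfolding op_spectrum_def by blast
  have d: "cmod (of_real \<mu> - \<mu>0) = c / 4"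
    using c by (simp add: \<mu>0_def cmod_def)
  have "norm (B x) \<le> 4 / (3 * c) * norm x" for x
  proof -
    have "A (B x) - \<mu> *\<^sub>R B x = x - (of_real \<mu> - \<mu>0) *\<^sub>C B x"
      using B(3)[of x] by (simp add: scaleC_diff_left scaleC_of_real algebra_simps)
    then have "c * norm (B x) \<le> norm x + c / 4 * norm (B x)"
      using below[of "B x"] norm_triangle_ineq4[of x "(of_real \<mu> - \<mu>0) *\<^sub>C B x"]
      by (simp only: norm_scaleC d)
    then show ?thesis using c by (simp add: field_simps)
  qed
  then show ?thesis
    using c d by (intro op_spectrum_perturb[OF A B(1,3,2), of "4 / (3 * c)"]) auto
qed

text \<open>The growth of the powers is read off from Cauchy's inequality for the holomorphic
  functions \<open>w \<mapsto> \<phi> ((1 - w H)\<^sup>-\<^sup>1 v)\<close>.\<close>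

lemma funpow_growth:
  fixes H :: "'a::cbanach \<Rightarrow> 'a"
  assumes H: "clinear H" "bounded_linear H" and \<rho>: "\<rho> \<ge> 0" "r > \<rho>"
    and sp: "\<And>\<mu>. cmod \<mu> > \<rho> \<Longrightarrow> \<mu> \<notin> op_spectrum H"
  obtains C where "C \<ge> 0" "\<And>n v. norm ((H ^^ n) v) \<le> C * r ^ n * norm v"
proof -
  note lin = clinear_simps[OF H(1)]
  obtain h where h: "h > 0" "\<And>x. norm (H x) \<le> h * norm x"
    using bounded_linear.pos_bounded[OF H(2)] by (auto simp: mult.commute)
  \<comment> \<open>Strictly between \<open>\<rho>\<close> and \<open>r\<close>: resolvents exist on
    the open disc of radius \<open>1 / s\<close>, and the closed disc of radius \<open>1 / r\<close>
    is a compact subset of it, which yields one bound for all its points.\<close>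
  define s where "s = (\<rho> + r) / 2"
  have s: "s > 0" "s > \<rho>" "s < r" using \<rho> by (auto simp: s_def)
  define D where "D = ball (0::complex) (1 / s)"
  \<comment> \<open>For \<open>w = 1 / \<mu>\<close> the inverse of \<open>1 - w H\<close> is
    \<open>- \<mu>\<close> times the inverse of \<open>H - \<mu>\<close>.\<close>
  have "\<exists>B. clinear B \<and> bounded_linear B \<and> (\<forall>x. B (x - w *\<^sub>C H x) = x)" if "w \<in> D" for w
  proof (cases "w = 0")
    case True
    have "clinear (\<lambda>x::'a. x)" by (simp add: clinear_iff)
    then show ?thesis using True by (intro exI[of _ "\<lambda>x. x"]) (auto intro: bounded_linear_ident)
  next
    case False
    define \<mu> where "\<mu> = 1 / w"
    have "cmod w < 1 / s" using that by (simp add: D_def)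
    then have "s < cmod \<mu>" using False s by (simp add: \<mu>_def norm_divide field_simps)
    then have "\<mu> \<notin> op_spectrum H" using s sp by simp
    then obtain B where B: "clinear B" "bounded_linear B" "\<And>x. B (H x - \<mu> *\<^sub>C x) = x"
      unfolding op_spectrum_def by blast
    note linB = clinear_simps[OF B(1)]
    have "(- \<mu>) *\<^sub>C B (x - w *\<^sub>C H x) = x" for x
    proof -
      have "(- \<mu>) *\<^sub>C (x - w *\<^sub>C H x) = H x - \<mu> *\<^sub>C x"
        using False by (simp add: \<mu>_def scaleC_diff_right scaleC_scaleC)
      then show ?thesis using B(3)[of x] by (metis linB(6))
    qed
    moreover have "clinear (\<lambda>x. (- \<mu>) *\<^sub>C B x)"
      by (simp add: clinear_iff linB scaleC_add_right scaleC_scaleC mult.commute)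
    moreover have "bounded_linear (\<lambda>x. (- \<mu>) *\<^sub>C B x)"
    proof -
      obtain K where K: "\<And>x. norm (B x) \<le> norm x * K" using bounded_linear.bounded[OF B(2)] by blast
      have "norm ((- \<mu>) *\<^sub>C B x) \<le> norm x * (cmod \<mu> * K)" for x
        using mult_left_mono[OF K[of x], of "cmod \<mu>"] by (simp add: norm_scaleC mult_ac)
      then show ?thesis
        by (intro bounded_linear_intro[where K = "cmod \<mu> * K"])
          (simp_all add: linB scaleC_add_right scaleC_scaleR)
    qed
    ultimately show ?thesis by (intro exI[of _ "\<lambda>x. (- \<mu>) *\<^sub>C B x"]) simp
  qed
  then obtain R where R: "\<And>w. w \<in> D \<Longrightarrow> clinear (R w)" "\<And>w. w \<in> D \<Longrightarrow> bounded_linear (R w)"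
    "\<And>w x. w \<in> D \<Longrightarrow> R w (x - w *\<^sub>C H x) = x"
    by metis
  have inv: "R w x - w *\<^sub>C H (R w x) = x" if w: "w \<in> D" for w x
  proof (cases "w = 0")
    case True
    then show ?thesis using R(3)[OF w, of x] by simp
  next
    case False
    define \<mu> where "\<mu> = 1 / w"
    have "cmod w < 1 / s" using w by (simp add: D_def)
    then have "s < cmod \<mu>" using False s by (simp add: \<mu>_def norm_divide field_simps)
    then have "\<mu> \<notin> op_spectrum H" using s sp by simp
    then obtain B where B: "\<And>x. H (B x) - \<mu> *\<^sub>C B x = x"
      unfolding op_spectrum_def by blast
    define y where "y = (- \<mu>) *\<^sub>C B x"
    have "y - w *\<^sub>C H y = H (B x) - \<mu> *\<^sub>C B x"
      using False by (simp add: y_def lin scaleC_scaleC \<mu>_def)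
    then have "y - w *\<^sub>C H y = x" using B by simp
    then show ?thesis using R(3)[OF w, of y] by simp
  qed
  have resolvent: "R w x - R w0 x = (w - w0) *\<^sub>C R w (H (R w0 x))" if "w \<in> D" "w0 \<in> D" for w w0 x
  proof -
    note lw = clinear_simps[OF R(1)[OF that(1)]]
    define y where "y = R w0 x"
    have "x = (y - w *\<^sub>C H y) + (w - w0) *\<^sub>C H y"
      using inv[OF that(2), of x] by (simp add: y_def scaleC_diff_left)
    then have "R w x = R w (y - w *\<^sub>C H y) + (w - w0) *\<^sub>C R w (H y)" by (metis lw(2,6))
    then show ?thesis using R(3)[OF that(1)] by (simp add: y_def)
  qed
  \<comment> \<open>The resolvent identity bounds the difference of \<open>R w0 x\<close> and
    \<open>R w x\<close> by half the norm of \<open>R w x\<close> once \<open>w\<close> is close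
    enough; absorbing that half doubles the bound.\<close>
  have local_bound: "\<exists>\<delta>>0. \<exists>K\<ge>0. \<forall>w\<in>D. dist w0 w < \<delta> \<longrightarrow> (\<forall>x. norm (R w x) \<le> K * norm x)"
    if w0: "w0 \<in> D" for w0
  proof -
    obtain K where K: "K > 0" "\<And>x. norm (R w0 x) \<le> K * norm x"
      using bounded_linear.pos_bounded[OF R(2)[OF w0]] by (auto simp: mult.commute)
    have "norm (R w x) \<le> 2 * K * norm x" if w: "w \<in> D" and d: "dist w0 w < 1 / (2 * h * K)" for w x
    proof -
      have "R w0 x - R w x = (w0 - w) *\<^sub>C R w0 (H (R w x))" by (rule resolvent[OF w0 w])
      then have "R w x = R w0 x - (w0 - w) *\<^sub>C R w0 (H (R w x))" by (simp add: algebra_simps)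
      then have "norm (R w x) \<le> norm (R w0 x) + norm ((w0 - w) *\<^sub>C R w0 (H (R w x)))"
        by (metis norm_triangle_ineq4)
      also have "norm ((w0 - w) *\<^sub>C R w0 (H (R w x))) \<le> 1 / (2 * h * K) * (K * (h * norm (R w x)))"
        unfolding norm_scaleC
        using d K h by (intro mult_mono order_trans[OF K(2)] mult_left_mono[OF h(2)])
          (auto simp: dist_norm)
      also have "\<dots> = norm (R w x) / 2" using h K by simp
      finally show ?thesis using K(2)[of x] by simp
    qed
    moreover have "1 / (2 * h * K) > 0" "2 * K \<ge> 0" using h K by auto
    ultimately show ?thesis by blast
  qed
  have cont: "((\<lambda>w. R w x) \<longlongrightarrow> R w0 x) (at w0)" if w0: "w0 \<in> D" for w0 x
  proof -
    obtain \<delta> K where K: "\<delta> > 0" "K \<ge> 0" "\<And>w x. w \<in> D \<Longrightarrow> dist w0 w < \<delta> \<Longrightarrow> norm (R w x) \<le> K * norm x"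
      using local_bound[OF w0] by blast
    have "\<forall>\<^sub>F w in at w0. w \<in> D"
      using w0 by (intro eventually_at_in_open') (auto simp: D_def)
    moreover have "\<forall>\<^sub>F w in at w0. dist w0 w < \<delta>"
      using K(1) by (auto simp: eventually_at dist_commute intro!: exI[of _ \<delta>])
    ultimately have "\<forall>\<^sub>F w in at w0. norm (R w x - R w0 x) \<le> cmod (w - w0) * (K * norm (H (R w0 x)))"
    proof eventually_elim
      case (elim w)
      then show ?case unfolding resolvent[OF elim(1) w0] norm_scaleC
        using K by (intro mult_left_mono) auto
    qed
    moreover have "((\<lambda>w. cmod (w - w0) * (K * norm (H (R w0 x)))) \<longlongrightarrow> 0) (at w0)"
      by (intro tendsto_mult_left_zero tendsto_norm_zero LIM_zero tendsto_ident_at)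
    ultimately have "((\<lambda>w. R w x - R w0 x) \<longlongrightarrow> 0) (at w0)"
      by (rule Lim_null_comparison)
    then show ?thesis by (simp add: LIM_zero_iff)
  qed
  have deriv: "((\<lambda>w. cdual_apply \<phi> (R w x)) has_field_derivative cdual_apply \<phi> (R w0 (H (R w0 x)))) (at w0)"
    if w0: "w0 \<in> D" for w0 x \<phi>
    unfolding has_field_derivative_iff
  proof (rule Lim_transform_eventually)
    show "((\<lambda>w. cdual_apply \<phi> (R w (H (R w0 x)))) \<longlongrightarrow> cdual_apply \<phi> (R w0 (H (R w0 x)))) (at w0)"
      by (intro bounded_linear.tendsto[OF bounded_linear_cdual_apply] cont w0)
    have "\<forall>\<^sub>F w in at w0. w \<in> D - {w0}"
      using w0 by (intro eventually_at_in_open) (auto simp: D_def)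
    then show "\<forall>\<^sub>F w in at w0. cdual_apply \<phi> (R w (H (R w0 x))) =
        (cdual_apply \<phi> (R w x) - cdual_apply \<phi> (R w0 x)) / (w - w0)"
    proof eventually_elim
      case (elim w)
      then have "cdual_apply \<phi> (R w x) - cdual_apply \<phi> (R w0 x) = (w - w0) * cdual_apply \<phi> (R w (H (R w0 x)))"
        using resolvent[of w w0 x] w0 by (metis DiffD1 cdual_apply_vector(3,6))
      then show ?case using elim by simp
    qed
  qed
  define g where "g \<phi> x w = cdual_apply \<phi> (R w x)" for \<phi> x w
  have g_holo: "g \<phi> x holomorphic_on D" for \<phi> x
    unfolding holomorphic_on_def g_def
    using deriv has_field_derivative_at_within field_differentiable_def by blast
  have D0: "0 \<in> D" "open D" using s by (auto simp: D_def)
  have g_rec: "g \<phi> x w = cdual_apply \<phi> x + w * g \<phi> (H x) w" if "w \<in> D" for \<phi> x w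
  proof -
    have "R 0 x = x" using R(3)[OF D0(1), of x] by simp
    then have "R w x = x + w *\<^sub>C R w (H x)"
      using resolvent[OF that D0(1), of x] by (simp add: algebra_simps)
    then show ?thesis by (simp add: g_def cdual_apply_vector)
  qed
  \<comment> \<open>Iterating \<open>g_rec\<close> expands \<open>g\<close> into the series with
    coefficients \<open>\<phi> (H^n x)\<close>. In Leibniz' rule for \<open>w * g\<close> only the
    term \<open>i = 1\<close> is nonzero at the origin.\<close>
  have coeff: "(deriv ^^ n) (g \<phi> x) 0 = fact n * cdual_apply \<phi> ((H ^^ n) x)" for n \<phi> x
  proof (induction n arbitrary: x)
    case 0
    then show ?case using g_rec[OF D0(1), of \<phi> x] by simp
  next
    case (Suc n)
    have "(deriv ^^ Suc n) (g \<phi> x) 0 = (deriv ^^ Suc n) (\<lambda>w. cdual_apply \<phi> x + w * g \<phi> (H x) w) 0"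
      by (rule higher_deriv_transform_within_open[OF g_holo _ D0(2) D0(1) g_rec])
        (auto intro!: holomorphic_intros g_holo)
    also have "\<dots> = (deriv ^^ Suc n) (\<lambda>w. w * g \<phi> (H x) w) 0"
      by (subst higher_deriv_add[OF _ _ D0(2,1)])
        (auto intro!: holomorphic_intros g_holo simp del: funpow.simps)
    also have "\<dots> = (\<Sum>i = 0..Suc n. of_nat (Suc n choose i) * (deriv ^^ i) (\<lambda>w. w) 0 * (deriv ^^ (Suc n - i)) (g \<phi> (H x)) 0)"
      by (rule higher_deriv_mult[OF _ g_holo D0(2,1)]) (rule holomorphic_on_ident)
    also have "\<dots> = (\<Sum>i = 0..Suc n. if i = 1 then of_nat (Suc n) * (deriv ^^ n) (g \<phi> (H x)) 0 else 0)"
      by (intro sum.cong refl) (auto simp: higher_deriv_ident simp del: funpow.simps)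
    also have "\<dots> = of_nat (Suc n) * (deriv ^^ n) (g \<phi> (H x)) 0" by (simp add: sum.delta)
    also have "\<dots> = fact (Suc n) * cdual_apply \<phi> ((H ^^ Suc n) x)"
      by (simp add: Suc funpow_swap1 del: funpow.simps) (simp add: funpow_swap1)
    finally show ?case .
  qed
  define B where "B = cball (0::complex) (1 / r)"
  have r: "r > 0" using \<rho> by simp
  have BD: "B \<subseteq> D" 
  proof -
    have "1 / r < 1 / s" using s r by (intro divide_strict_left_mono) auto
    then show ?thesis unfolding B_def D_def by auto
  qed
  have "\<exists>M\<ge>0. \<forall>w\<in>B. \<forall>x. norm (R w x) \<le> M * norm x"
  proof -
    have "\<forall>w0\<in>B. \<exists>\<delta>>0. \<exists>K\<ge>0. \<forall>w\<in>D. dist w0 w < \<delta> \<longrightarrow> (\<forall>x. norm (R w x) \<le> K * norm x)"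
      using local_bound BD by blast
    then obtain \<delta> K where dK: "\<And>w0. w0 \<in> B \<Longrightarrow> \<delta> w0 > 0" "\<And>w0. w0 \<in> B \<Longrightarrow> K w0 \<ge> 0"
      "\<And>w0 w x. w0 \<in> B \<Longrightarrow> w \<in> D \<Longrightarrow> dist w0 w < \<delta> w0 \<Longrightarrow> norm (R w x) \<le> K w0 * norm x"
      by metis
    have "compact B" unfolding B_def by simp
    moreover have "B \<subseteq> (\<Union>w0\<in>B. ball w0 (\<delta> w0))" using dK(1) by force
    ultimately obtain F where F: "F \<subseteq> B" "finite F" "B \<subseteq> (\<Union>w0\<in>F. ball w0 (\<delta> w0))"
      using compactE_image[of B B "\<lambda>w0. ball w0 (\<delta> w0)"] by (metis open_ball)
    define M where "M = (\<Sum>w0\<in>F. K w0)"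
    have "norm (R w x) \<le> M * norm x" if "w \<in> B" for w x
    proof -
      obtain w0 where w0: "w0 \<in> F" "dist w0 w < \<delta> w0" using F(3) \<open>w \<in> B\<close> by auto
      then have "norm (R w x) \<le> K w0 * norm x" using dK(3)[of w0 w x] F(1) \<open>w \<in> B\<close> BD by auto
      also have "\<dots> \<le> M * norm x"
        unfolding M_def using F dK(2) w0 by (intro mult_right_mono member_le_sum) auto
      finally show ?thesis .
    qed
    moreover have "M \<ge> 0" unfolding M_def using F dK(2) by (intro sum_nonneg) auto
    ultimately show ?thesis by blast
  qed
  then obtain M where M: "M \<ge> 0" "\<And>w x. w \<in> B \<Longrightarrow> norm (R w x) \<le> M * norm x" by blast
  have "norm ((H ^^ n) v) \<le> M * r ^ n * norm v" for n v
  proof (rule norm_le_by_cdual)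
    fix \<phi> :: "'a cdual" assume \<phi>: "norm \<phi> \<le> 1"
    have bound: "cmod (g \<phi> v w) \<le> M * norm v" if "w \<in> B" for w
    proof -
      have "cmod (g \<phi> v w) \<le> norm \<phi> * norm (R w v)" unfolding g_def by (rule norm_cdual_apply)
      also have "\<dots> \<le> 1 * (M * norm v)" using \<phi> M that by (intro mult_mono) auto
      finally show ?thesis by simp
    qed
    have "norm ((deriv ^^ n) (g \<phi> v) 0) \<le> fact n * (M * norm v) / (1 / r) ^ n"
    proof (rule Cauchy_inequality)
      show "g \<phi> v holomorphic_on ball 0 (1 / r)" "continuous_on (cball 0 (1 / r)) (g \<phi> v)"
        using BD holomorphic_on_subset[OF g_holo] holomorphic_on_imp_continuous_on
        unfolding B_def by (meson ball_subset_cball order_trans)+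
      show "0 < 1 / r" using r by simp
      show "norm (g \<phi> v w) \<le> M * norm v" if "norm (0 - w) = 1 / r" for w
        using that by (intro bound) (simp add: B_def)
    qed
    then show "cmod (cdual_apply \<phi> ((H ^^ n) v)) \<le> M * r ^ n * norm v"
      by (simp add: coeff norm_mult power_one_over mult_ac)
  qed
  then show thesis using that M(1) by blast
qed

section \<open>Exponential series and the norm of hermitian operators\<close>

lemma op_exp_scaled_sums:
  fixes A :: "'a::cbanach \<Rightarrow> 'a"
  assumes A: "clinear A" "bounded_linear A"
  shows "(\<lambda>n. (z ^ n / fact n) *\<^sub>C (A ^^ n) v) sums op_exp (\<lambda>y. z *\<^sub>C A y) v"
    and "summable (\<lambda>n. norm ((z ^ n / fact n) *\<^sub>C (A ^^ n) v))"
proof -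
  obtain h where h: "h \<ge> 0" "\<And>x. norm (A x) \<le> h * norm x"
    using bounded_linear.nonneg_bounded[OF A(2)] by (auto simp: mult.commute)
  have pow: "((\<lambda>y. z *\<^sub>C A y) ^^ n) v = z ^ n *\<^sub>C (A ^^ n) v" for n
    by (induction n) (simp_all add: clinear_simps[OF A(1)] scaleC_scaleC)
  have summand: "((\<lambda>y. z *\<^sub>C A y) ^^ n) v /\<^sub>R fact n = (z ^ n / fact n) *\<^sub>C (A ^^ n) v" for n
    by (simp add: pow scaleC_of_real[symmetric] scaleC_scaleC divide_inverse mult.commute)
  have "norm (norm ((z ^ n / fact n) *\<^sub>C (A ^^ n) v)) \<le> (cmod z * h) ^ n /\<^sub>R fact n * norm v" for n
  proof -
    have "norm ((z ^ n / fact n) *\<^sub>C (A ^^ n) v) \<le> cmod z ^ n / fact n * (h ^ n * norm v)"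
      unfolding norm_scaleC
      by (intro mult_mono norm_funpow_le h) (auto simp: norm_divide norm_power)
    then show ?thesis by (simp add: power_mult_distrib divide_inverse mult_ac)
  qed
  moreover have "summable (\<lambda>n. (cmod z * h) ^ n /\<^sub>R fact n * norm v)"
    by (intro summable_mult2 summable_exp_generic)
  ultimately show s: "summable (\<lambda>n. norm ((z ^ n / fact n) *\<^sub>C (A ^^ n) v))"
    by (rule summable_comparison_test'[rotated, where N = 0])
  then have "summable (\<lambda>n. (z ^ n / fact n) *\<^sub>C (A ^^ n) v)" by (rule summable_norm_cancel)
  then show "(\<lambda>n. (z ^ n / fact n) *\<^sub>C (A ^^ n) v) sums op_exp (\<lambda>y. z *\<^sub>C A y) v"
    unfolding op_exp_def summand by (rule summable_sums)
qed

text \<open>The centre \<open>k/2\<close> is subtracted so that the spectrum \<open>[0, k]\<close> of \<open>A\<close> becomes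
  symmetric; Bernstein's inequality for \<open>z \<mapsto> \<phi> (exp (i z (A - k/2)) v)\<close> then gives
  Sinclair's theorem that the norm of a hermitian operator is its spectral radius.\<close>

lemma hermitian_op_norm_le_half_spectrum:
  fixes A :: "'a::cbanach \<Rightarrow> 'a"
  assumes herm: "hermitian_op A" and sp: "op_spectrum A \<subseteq> \<real>\<^sub>\<ge>\<^sub>0" and k: "k \<ge> 0"
    and below: "\<And>\<mu>. \<mu> > k \<Longrightarrow> \<exists>c>0. \<forall>v. c * norm v \<le> norm (A v - \<mu> *\<^sub>R v)"
  shows "norm (A v - (k / 2) *\<^sub>R v) \<le> k / 2 * norm v"
proof -
  have A: "clinear A" "bounded_linear A"
    and iso: "norm (op_exp (\<lambda>y. (\<i> * of_real t) *\<^sub>C A y) x) = norm x" for t x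
    using herm unfolding hermitian_op_def by auto
  note lin = clinear_simps[OF A(1)]
  obtain h where h: "h \<ge> 0" "\<And>x. norm (A x) \<le> h * norm x"
    using bounded_linear.nonneg_bounded[OF A(2)] by (auto simp: mult.commute)
  define H where "H v = A v - (k / 2) *\<^sub>R v" for v
  have H: "clinear H"
    by (simp add: H_def clinear_iff lin scaleC_diff_right scaleC_scaleR algebra_simps)
  have "bounded_linear H"
    unfolding H_def by (intro bounded_linear_sub A bounded_linear_scaleR_right)
  note linH = clinear_simps[OF H]
  have spA: "\<mu> \<notin> op_spectrum A" if "cmod (\<mu> - of_real (k / 2)) > k / 2" for \<mu>
  proof
    assume \<mu>: "\<mu> \<in> op_spectrum A"
    then obtain m where m: "\<mu> = of_real m" "m \<ge> 0" using sp by (auto simp: nonneg_Reals_def)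
    have "cmod (\<mu> - of_real (k / 2)) = \<bar>m - k / 2\<bar>"
      unfolding m of_real_diff[symmetric] norm_of_real by simp
    then have "m > k" using that m(2) by linarith
    then obtain c where c: "c > 0" "\<And>v. c * norm v \<le> norm (A v - m *\<^sub>R v)" using below by blast
    have "op_spectrum A \<subseteq> \<real>" using sp nonneg_Reals_subset_Reals by blast
    then show False
      using not_in_real_spectrum_if_bounded_below[OF A(1) _ c] \<mu> m by simp
  qed
  have spH: "\<mu> \<notin> op_spectrum H" if "cmod \<mu> > k / 2" for \<mu>
  proof -
    have "\<mu> + of_real (k / 2) \<notin> op_spectrum A" using spA that by simp
    moreover have "A x - (\<mu> + of_real (k / 2)) *\<^sub>C x = H x - \<mu> *\<^sub>C x" for x
      using scaleC_of_real[of "k / 2" x] by (simp add: H_def scaleC_add_left)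
    ultimately show ?thesis unfolding op_spectrum_def by simp
  qed
  \<comment> \<open>Growth of the powers like \<open>r^n\<close> is only known for \<open>r\<close>
    beyond the spectral radius, so the bound with \<open>k / 2\<close> is reached as a
    limit.\<close>
  have main: "norm (H v) \<le> r * norm v" if r: "r > k / 2" for r v
  proof -
    have r0: "r > 0" using r k by simp
    obtain C where C: "C \<ge> 0" "\<And>n v. norm ((H ^^ n) v) \<le> C * r ^ n * norm v"
      using funpow_growth[OF H \<open>bounded_linear H\<close> _ r spH] k by auto
    show ?thesis
    proof (rule norm_le_by_cdual)
      fix \<phi> :: "'a cdual" assume \<phi>: "norm \<phi> \<le> 1"
      have \<phi>_le: "cmod (cdual_apply \<phi> x) \<le> norm x" for x
        using norm_cdual_apply[of \<phi> x] mult_right_mono[OF \<phi> norm_ge_zero[of x]] by simp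
      define c where "c u n = cdual_apply \<phi> ((A ^^ n) u) * \<i> ^ n / fact n" for u n
      define F where "F u z = (\<Sum>n. c u n * z ^ n)" for u z
      have c_eq: "c u n * z ^ n = cdual_apply \<phi> (((\<i> * z) ^ n / fact n) *\<^sub>C (A ^^ n) u)" for u n z
        by (simp add: c_def cdual_apply_vector power_mult_distrib mult_ac)
      have sums: "(\<lambda>n. c u n * z ^ n) sums cdual_apply \<phi> (op_exp (\<lambda>y. (\<i> * z) *\<^sub>C A y) u)" for u z
        unfolding c_eq by (intro bounded_linear.sums[OF bounded_linear_cdual_apply] op_exp_scaled_sums A)
      have F_eq: "F u z = cdual_apply \<phi> (op_exp (\<lambda>y. (\<i> * z) *\<^sub>C A y) u)" for u z
        unfolding F_def using sums by (simp add: sums_iff)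
      have summ: "summable (\<lambda>n. c u n * z ^ n)" for u z using sums by (rule sums_summable)
      have diffs: "diffs (c u) n = \<i> * c (A u) n" for u n
      proof -
        have "(A ^^ Suc n) u = (A ^^ n) (A u)" by (simp add: funpow_swap1)
        then show ?thesis
          unfolding diffs_def c_def by (simp del: funpow.simps of_nat_Suc)
      qed
      have dF: "(F u has_field_derivative \<i> * F (A u) z) (at z)" for u z
      proof -
        have "(F u has_field_derivative (\<Sum>n. diffs (c u) n * z ^ n)) (at z)"
          unfolding F_def by (rule termdiffs_strong_converges_everywhere) (rule summ)
        also have "(\<Sum>n. diffs (c u) n * z ^ n) = \<i> * F (A u) z"
          unfolding diffs F_def by (simp add: mult.assoc suminf_mult summ)
        finally show ?thesis .
      qed
      have F_H: "F (H u) z = F (A u) z - of_real (k / 2) * F u z" for u z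
      proof -
        have cH: "c (H u) n = c (A u) n - of_real (k / 2) * c u n" for n
          unfolding c_def H_def clinear_simps[OF clinear_funpow[OF A(1)]] cdual_apply_vector
          by (simp add: field_simps)
        have "(\<lambda>n. c (A u) n * z ^ n - of_real (k / 2) * (c u n * z ^ n)) sums
            (F (A u) z - of_real (k / 2) * F u z)"
          unfolding F_def by (intro sums_diff sums_mult summable_sums summ)
        then show ?thesis unfolding F_def by (simp add: cH algebra_simps sums_iff)
      qed
      \<comment> \<open>\<open>G u z\<close> is \<open>\<phi> (exp (i z H) u)\<close>. The scalar
        factor has modulus 1 at real points, so the isometries \<open>exp (i t A)\<close> bound
        \<open>G\<close> on the real axis although \<open>H\<close> itself is a shifted
        operator.\<close>
      define G where "G u z = exp (- (\<i> * of_real (k / 2) * z)) * F u z" for u z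
      have dG: "(G u has_field_derivative \<i> * G (H u) z) (at z)" for u z
        unfolding G_def
        by (rule derivative_eq_intros dF refl)+ (simp add: F_H algebra_simps)
      have derivs: "(deriv ^^ n) (G u) = (\<lambda>z. \<i> ^ n * G ((H ^^ n) u) z)" for n u
      proof (induction n)
        case (Suc n)
        have "deriv (\<lambda>z. \<i> ^ n * G ((H ^^ n) u) z) z = \<i> ^ n * (\<i> * G (H ((H ^^ n) u)) z)" for z
          by (intro DERIV_imp_deriv DERIV_cmult dG)
        then show ?case by (simp add: Suc mult_ac)
      qed simp
      have G_holo: "G u holomorphic_on S" for u S
        using dG field_differentiable_at_within field_differentiable_def
        unfolding holomorphic_on_def by blast
      have G_real: "cmod (G u (of_real t)) \<le> norm u" for u t
      proof -
        have "cmod (G u (of_real t)) = cmod (F u (of_real t))"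
          unfolding G_def norm_mult by (simp add: norm_exp_eq_Re)
        also have "\<dots> \<le> norm u" unfolding F_eq using \<phi>_le iso[of t u] by metis
        finally show ?thesis .
      qed
      \<comment> \<open>The Taylor expansion is centred at \<open>Re z\<close> rather than 0, and
        the bound on the real axis is applied to the vectors \<open>H^n u\<close>. This yields
        growth in \<open>Im z\<close> alone.\<close>
      have G_growth: "cmod (G u z) \<le> C * norm u * exp (r * \<bar>Im z\<bar>)" for u z
      proof -
        define x where "x = complex_of_real (Re z)"
        define y where "y = z - x"
        have y: "cmod y = \<bar>Im z\<bar>" unfolding y_def x_def by (simp add: cmod_def)
        have sumsG: "(\<lambda>n. (deriv ^^ n) (G u) x / fact n * (z - x) ^ n) sums G u z"
          by (rule holomorphic_power_series[of _ _ "dist x z + 1"]) (auto intro: G_holo)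
        have sumsE: "(\<lambda>n. C * norm u * ((r * \<bar>Im z\<bar>) ^ n /\<^sub>R fact n)) sums (C * norm u * exp (r * \<bar>Im z\<bar>))"
          by (intro sums_mult exp_converges)
        have le: "cmod ((deriv ^^ n) (G u) x / fact n * (z - x) ^ n) \<le> C * norm u * ((r * \<bar>Im z\<bar>) ^ n /\<^sub>R fact n)" for n
        proof -
          have "cmod ((deriv ^^ n) (G u) x) \<le> C * r ^ n * norm u"
            unfolding derivs norm_mult norm_power x_def using G_real C(2) order_trans by fastforce
          then have "cmod ((deriv ^^ n) (G u) x) / fact n * \<bar>Im z\<bar> ^ n \<le> (C * r ^ n * norm u) / fact n * \<bar>Im z\<bar> ^ n"
            by (intro mult_right_mono divide_right_mono) auto
          then show ?thesis
            by (simp add: norm_mult norm_divide norm_power y_def[symmetric] y power_mult_distrib)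
              (simp add: divide_inverse mult_ac)
        qed
        have "cmod (\<Sum>n. (deriv ^^ n) (G u) x / fact n * (z - x) ^ n) \<le> (\<Sum>n. C * norm u * ((r * \<bar>Im z\<bar>) ^ n /\<^sub>R fact n))"
          by (rule norm_suminf_le[OF le sums_summable[OF sumsE]])
        then show ?thesis using sumsG sumsE by (simp add: sums_iff)
      qed
      have "cmod (deriv (G v) 0) \<le> r * norm v"
        by (rule bernstein[OF G_holo G_real G_growth r0])
      moreover have "deriv (G v) 0 = \<i> * cdual_apply \<phi> (H v)"
      proof -
        have "F (H v) 0 = cdual_apply \<phi> (H v)"
          unfolding F_def using powser_zero[of "c (H v)"] by (simp add: c_def)
        then show ?thesis using DERIV_imp_deriv[OF dG[of v 0]] by (simp add: G_def)
      qed
      ultimately show "cmod (cdual_apply \<phi> (H v)) \<le> r * norm v" by (simp add: norm_mult)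
    qed
  qed
  have "norm (H v) \<le> k / 2 * norm v"
  proof (rule tendsto_lowerbound)
    show "((\<lambda>r. r * norm v) \<longlongrightarrow> k / 2 * norm v) (at_right (k / 2))"
      by (intro tendsto_intros)
    show "\<forall>\<^sub>F r in at_right (k / 2). norm (H v) \<le> r * norm v"
      unfolding eventually_at_right_field using main by (meson gt_ex)
  qed simp
  then show ?thesis by (simp add: H_def)
qed

subsection \<open>Powers of averages of the identity and a contraction\<close>

text \<open>Puts this sum and the shifted one of \<open>sum_binomial_lower\<close> over the same
  binomial coefficients, so that they can be added and subtracted termwise; the extra term at
  \<open>k = Suc n\<close> is zero.\<close>

lemma sum_binomial_upper:
  fixes f :: "nat \<Rightarrow> 'a::real_vector"
  shows "(\<Sum>k\<le>n. real (n choose k) *\<^sub>R f k) =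
    (\<Sum>k\<le>Suc n. (real (Suc n choose k) * (real (Suc n) - real k) / real (Suc n)) *\<^sub>R f k)"
proof -
  have "real (n choose k) = real (Suc n choose k) * (real (Suc n) - real k) / real (Suc n)" if "k \<le> n" for k
  proof -
    have "real (Suc n - k) * real (Suc n choose k) = real (Suc n) * real (n choose k)"
      using binomial_absorb_comp[of "Suc n" k] by (metis diff_Suc_1 of_nat_mult)
    then show ?thesis using that by (simp add: of_nat_diff field_simps del: of_nat_Suc binomial_Suc_Suc)
  qed
  then have "(\<Sum>k\<le>n. real (n choose k) *\<^sub>R f k) =
      (\<Sum>k\<le>n. (real (Suc n choose k) * (real (Suc n) - real k) / real (Suc n)) *\<^sub>R f k)"
    by (intro sum.cong refl) simp
  then show ?thesis by simp
qed

lemma sum_binomial_lower: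
  fixes f :: "nat \<Rightarrow> 'a::real_vector"
  shows "(\<Sum>k\<le>n. real (n choose k) *\<^sub>R f (Suc k)) =
    (\<Sum>k\<le>Suc n. (real (Suc n choose k) * real k / real (Suc n)) *\<^sub>R f k)"
proof -
  have "real (n choose k) = real (Suc n choose Suc k) * real (Suc k) / real (Suc n)" for k
  proof -
    have "real (Suc k) * real (Suc n choose Suc k) = real (Suc n) * real (n choose k)"
      unfolding of_nat_mult[symmetric] of_nat_eq_iff using binomial_absorption[of k "Suc n"]
      by (simp only: diff_Suc_1)
    then show ?thesis
      using nonzero_mult_div_cancel_left[of "real (Suc n)" "real (n choose k)"]
      by (simp del: of_nat_Suc binomial_Suc_Suc add: mult.commute)
  qed
  then show ?thesis
    by (subst sum.atMost_Suc_shift) (simp del: of_nat_Suc binomial_Suc_Suc)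
qed

text \<open>The variance of the binomial distribution, read off from the moments of the Bernstein
  polynomials at 1/2, controls the mean absolute deviation; \<open>amgm\<close> plays the part of
  the Cauchy-Schwarz inequality.\<close>

lemma sum_binomial_abs_deviation:
  assumes "m > 0"
  shows "(\<Sum>k\<le>m. real (m choose k) * \<bar>real m - 2 * real k\<bar>) \<le> sqrt (real m) * 2 ^ m"
proof -
  define b where "b k = real (m choose k)" for k
  define s where "s = sqrt (real m)"
  have s: "s > 0" "s * s = real m" using assms by (auto simp: s_def)
  have Bernstein: "Bernstein m k (1/2) = b k / 2 ^ m" if "k \<le> m" for k
    using that by (simp add: Bernstein_def b_def power_add[symmetric] power_one_over
        flip: power_add)
  have b0: "(\<Sum>k\<le>m. b k) = 2 ^ m"
    using choose_row_sum[of m] unfolding b_def by (metis of_nat_sum of_nat_numeral of_nat_power)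
  have "(\<Sum>k\<le>m. real k * (b k / 2 ^ m)) = (\<Sum>k\<le>m. real k * Bernstein m k (1/2))"
    by (intro sum.cong refl) (simp add: Bernstein)
  then have b1: "(\<Sum>k\<le>m. real k * b k) = real m / 2 * 2 ^ m"
    unfolding times_divide_eq_right sum_divide_distrib[symmetric] sum_k_Bernstein divide_eq_eq by simp
  have "(\<Sum>k\<le>m. real k * (real k - 1) * (b k / 2 ^ m)) = (\<Sum>k\<le>m. real k * (real k - 1) * Bernstein m k (1/2))"
    by (intro sum.cong refl) (simp add: Bernstein)
  then have b2: "(\<Sum>k\<le>m. real k * (real k - 1) * b k) = real m * (real m - 1) / 4 * 2 ^ m"
    unfolding times_divide_eq_right sum_divide_distrib[symmetric] sum_kk_Bernstein divide_eq_eq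
    by (simp add: power2_eq_square)
  have "(\<Sum>k\<le>m. b k * (real m - 2 * real k)\<^sup>2) =
      (\<Sum>k\<le>m. (real m)\<^sup>2 * b k - (4 * real m - 4) * (real k * b k) + 4 * (real k * (real k - 1) * b k))"
    by (intro sum.cong refl) (simp add: power2_eq_square algebra_simps)
  also have "\<dots> = (real m)\<^sup>2 * 2 ^ m - (4 * real m - 4) * (real m / 2 * 2 ^ m)
      + 4 * (real m * (real m - 1) / 4 * 2 ^ m)"
    by (simp only: sum.distrib sum_subtractf sum_distrib_left[symmetric] b0 b1 b2)
  also have "\<dots> = real m * 2 ^ m" by (simp add: power2_eq_square algebra_simps)
  finally have var: "(\<Sum>k\<le>m. b k * (real m - 2 * real k)\<^sup>2) = real m * 2 ^ m" .
  have amgm: "\<bar>x\<bar> \<le> (x\<^sup>2 / s + s) / 2" for x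
  proof -
    have "0 \<le> (\<bar>x\<bar> - s)\<^sup>2" by simp
    then show ?thesis using s by (simp add: power2_eq_square field_simps)
  qed
  have "(\<Sum>k\<le>m. b k * \<bar>real m - 2 * real k\<bar>) \<le> (\<Sum>k\<le>m. b k * (((real m - 2 * real k)\<^sup>2 / s + s) / 2))"
    by (intro sum_mono mult_left_mono amgm) (auto simp: b_def)
  also have "\<dots> = (\<Sum>k\<le>m. (b k * (real m - 2 * real k)\<^sup>2) / (2 * s) + b k * (s / 2))"
    using s by (intro sum.cong refl) (simp add: field_simps)
  also have "\<dots> = real m * 2 ^ m / (2 * s) + 2 ^ m * (s / 2)"
    by (simp only: sum.distrib sum_divide_distrib[symmetric] sum_distrib_right[symmetric] var b0)
  also have "\<dots> = s * 2 ^ m" unfolding s(2)[symmetric] using s(1) by (simp add: field_simps)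
  finally show ?thesis unfolding b_def s_def .
qed

text \<open>With \<open>V = 2 A - 1\<close> and \<open>m = n + 1\<close>, the coefficient of
  \<open>V^k\<close> in \<open>2^m A^n (1 - A)\<close> is \<open>(m choose k) (m - 2 k) / m\<close>.
  The absolute values add up to at most \<open>2^m / sqrt m\<close>, and every \<open>V^k\<close> is
  a contraction.\<close>

lemma averaged_contraction_decay:
  fixes A :: "'a::real_normed_vector \<Rightarrow> 'a"
  assumes A: "linear A" and contr: "\<And>v. norm (2 *\<^sub>R A v - v) \<le> norm v"
  shows "norm ((A ^^ n) (v - A v)) \<le> norm v / sqrt (real (Suc n))"
proof -
  define V where "V v = 2 *\<^sub>R A v - v" for v
  have V: "linear V" unfolding V_def using A
    by (intro linearI) (simp_all add: linear_add linear_scale algebra_simps)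
  have linVk: "linear (V ^^ k)" for k
  proof (induction k)
    case (Suc k)
    then show ?case using linear_compose[OF Suc V] by (simp only: funpow.simps)
  qed (simp only: funpow.simps linear_id)
  have linAk: "linear (A ^^ k)" for k
  proof (induction k)
    case (Suc k)
    then show ?case using linear_compose[OF Suc A] by (simp only: funpow.simps)
  qed (simp only: funpow.simps linear_id)
  have A_V: "2 *\<^sub>R A u = u + V u" for u by (simp add: V_def)
  have Vk: "norm ((V ^^ k) u) \<le> norm u" for k u
    using norm_funpow_le[of V 1 k u] contr by (simp add: V_def)
  have pow: "2 ^ n *\<^sub>R (A ^^ n) u = (\<Sum>k\<le>n. real (n choose k) *\<^sub>R (V ^^ k) u)" for n u
  proof (induction n arbitrary: u)
    case (Suc n)
    have "2 ^ Suc n *\<^sub>R (A ^^ Suc n) u = 2 ^ n *\<^sub>R (A ^^ n) (2 *\<^sub>R A u)"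
      by (simp add: funpow_swap1 linear_scale[OF linAk] linear_scale[OF A] mult.commute)
    also have "\<dots> = (\<Sum>k\<le>n. real (n choose k) *\<^sub>R (V ^^ k) (u + V u))"
      unfolding A_V by (rule Suc)
    also have "\<dots> = (\<Sum>k\<le>n. real (n choose k) *\<^sub>R (V ^^ k) u) + (\<Sum>k\<le>n. real (n choose k) *\<^sub>R (V ^^ Suc k) u)"
      by (simp add: linear_add[OF linVk] funpow_swap1 scaleR_add_right sum.distrib)
    also have "\<dots> = (\<Sum>k\<le>Suc n. (real (Suc n choose k) * (real (Suc n) - real k) / real (Suc n)
        + real (Suc n choose k) * real k / real (Suc n)) *\<^sub>R (V ^^ k) u)"
      unfolding sum_binomial_upper[of n "\<lambda>k. (V ^^ k) u"] sum_binomial_lower[of n "\<lambda>k. (V ^^ k) u"]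
      by (simp only: sum.distrib scaleR_add_left)
    also have "\<dots> = (\<Sum>k\<le>Suc n. real (Suc n choose k) *\<^sub>R (V ^^ k) u)"
      by (intro sum.cong refl arg_cong2[of _ _ _ _ scaleR])
        (simp add: add_divide_distrib[symmetric] distrib_left[symmetric] del: of_nat_Suc binomial_Suc_Suc)
    finally show ?case .
  qed simp
  define m where "m = Suc n"
  have "2 ^ m *\<^sub>R (A ^^ n) (v - A v) = 2 ^ n *\<^sub>R (A ^^ n) (v - V v)"
  proof -
    have "v - V v = 2 *\<^sub>R (v - A v)" by (simp add: V_def scaleR_2 algebra_simps)
    then show ?thesis by (simp add: linear_scale[OF linAk] m_def mult.commute)
  qed
  also have "\<dots> = (\<Sum>k\<le>n. real (n choose k) *\<^sub>R (V ^^ k) v) - (\<Sum>k\<le>n. real (n choose k) *\<^sub>R (V ^^ Suc k) v)"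
    unfolding pow by (simp add: linear_diff[OF linVk] funpow_swap1 scaleR_diff_right sum_subtractf)
  also have "\<dots> = (\<Sum>k\<le>m. (real (m choose k) * (real m - real k) / real m
        - real (m choose k) * real k / real m) *\<^sub>R (V ^^ k) v)"
    unfolding sum_binomial_upper[of n "\<lambda>k. (V ^^ k) v"] sum_binomial_lower[of n "\<lambda>k. (V ^^ k) v"] m_def
    by (simp only: sum_subtractf scaleR_diff_left)
  finally have eq: "2 ^ m *\<^sub>R (A ^^ n) (v - A v) = \<dots>" .
  have "2 ^ m * norm ((A ^^ n) (v - A v)) = norm (2 ^ m *\<^sub>R (A ^^ n) (v - A v))" by simp
  also have "\<dots> \<le> (\<Sum>k\<le>m. real (m choose k) * \<bar>real m - 2 * real k\<bar> * (norm v / real m))"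
    unfolding eq
  proof (rule sum_norm_le)
    fix k
    have "real (m choose k) * (real m - real k) / real m - real (m choose k) * real k / real m
        = real (m choose k) * (real m - 2 * real k) / real m"
      by (simp add: diff_divide_distrib[symmetric] algebra_simps)
    then show "norm ((real (m choose k) * (real m - real k) / real m
        - real (m choose k) * real k / real m) *\<^sub>R (V ^^ k) v)
        \<le> real (m choose k) * \<bar>real m - 2 * real k\<bar> * (norm v / real m)"
      using mult_left_mono[OF Vk[of k v], of "real (m choose k) * \<bar>real m - 2 * real k\<bar> / real m"]
      by (simp add: abs_mult)
  qed
  also have "\<dots> = (\<Sum>k\<le>m. real (m choose k) * \<bar>real m - 2 * real k\<bar>) * (norm v / real m)"
    by (simp only: sum_distrib_right)
  also have "\<dots> \<le> sqrt (real m) * 2 ^ m * (norm v / real m)"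
    by (intro mult_right_mono sum_binomial_abs_deviation) (auto simp: m_def)
  also have "\<dots> = 2 ^ m * (norm v / sqrt (real m))"
  proof -
    have "sqrt (real m) / real m = 1 / sqrt (real m)"
      using real_div_sqrt[of "real m"] by (simp add: m_def divide_simps del: of_nat_Suc)
    then show ?thesis by (simp add: mult_ac divide_inverse)
  qed
  finally have "norm ((A ^^ n) (v - A v)) \<le> norm v / sqrt (real m)"
    by (rule mult_left_le_imp_le) simp
  then show ?thesis by (simp only: m_def)
qed

subsection \<open>Powers of an element of a JB*-triple\<close>

lemma conj_linear_simps:
  assumes "conj_linear f"
  shows "f 0 = 0" "f (x + y) = f x + f y" "f (x - y) = f x - f y" "f (- x) = - f x"
    "f (r *\<^sub>R x) = r *\<^sub>R f x" "f (c *\<^sub>C x) = cnj c *\<^sub>C f x"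
proof -
  show add: "f (x + y) = f x + f y" and scale: "f (c *\<^sub>C x) = cnj c *\<^sub>C f x" for x y c
    using assms by (auto simp: conj_linear_iff)
  show scaleR: "f (r *\<^sub>R x) = r *\<^sub>R f x" for r x
    using scale[of "of_real r" x] by (simp add: scaleC_of_real)
  show "f 0 = 0" using scaleR[of 0 0] by simp
  show minus: "f (- x) = - f x" for x using scaleR[of "-1" x] by simp
  show "f (x - y) = f x - f y" using add[of x "- y"] minus[of y] by simp
qed

lemma scaleR_3: "3 *\<^sub>R v = v + v + (v :: 'a::real_vector)"
  using scaleR_left_distrib[of 2 1 v] by (simp add: scaleR_2)

text \<open>For the recurring situation where two instances of the Jordan identity give
  \<open>X = 2 Y - p\<close> and \<open>Y = 2 X - p\<close>.\<close>

lemma eq_if_reflected_twice: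
  fixes x p :: "'a::real_vector"
  assumes "x = 2 *\<^sub>R (2 *\<^sub>R x - p) - p"
  shows "x = p"
proof -
  have "3 *\<^sub>R (x - p) = (2 *\<^sub>R (2 *\<^sub>R x - p) - p) - x"
    by (simp add: scaleR_3 scaleR_2)
  then have "3 *\<^sub>R (x - p) = 0" using assms by simp
  then show ?thesis by simp
qed

context jbstar_triple
begin

lemmas tp_left = clinear_simps[OF clinear_tp_left]
lemmas tp_middle = conj_linear_simps[OF conj_linear_tp_middle]

lemma clinear_tp_right: "clinear (\<lambda>z. tp x y z)"
  unfolding symmetric_tp[of x y] by (rule clinear_tp_left)

lemmas tp_right = clinear_simps[OF clinear_tp_right]

abbreviation pw :: "'a \<Rightarrow> nat \<Rightarrow> 'a" where "pw \<equiv> odd_power tp"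

text \<open>\<open>odd_power\<close> iterates the conjugate linear map \<open>{a, . , a}\<close>;
  here the same powers arise from the linear operator \<open>L(a, a)\<close>, to which the spectral
  estimates apply.\<close>

lemma tp_base_power: "tp a a (pw a n) = pw a (Suc n)"
proof (induction n)
  case (Suc n)
  define X where "X = tp a a (pw a (Suc n))"
  define Y where "Y = tp a (pw a n) (pw a 1)"
  have "tp a a (tp a (pw a n) a) =
      tp (tp a a a) (pw a n) a - tp a (tp a a (pw a n)) a + tp a (pw a n) (tp a a a)"
    by (rule Jordan_identity)
  then have 1: "X = 2 *\<^sub>R Y - pw a (Suc (Suc n))"
    unfolding X_def Y_def using Suc
    by (simp add: symmetric_tp[of "tp a a a" "pw a n" a] scaleR_2)
  have "tp a (pw a n) (tp a a a) =
      tp (tp a (pw a n) a) a a - tp a (tp (pw a n) a a) a + tp a a (tp a (pw a n) a)"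
    by (rule Jordan_identity)
  then have 2: "Y = 2 *\<^sub>R X - pw a (Suc (Suc n))"
    unfolding X_def Y_def using Suc
    by (simp add: symmetric_tp[of "pw a n" a a] symmetric_tp[of "tp a (pw a n) a" a a] scaleR_2)
  have "X = 2 *\<^sub>R (2 *\<^sub>R X - pw a (Suc (Suc n))) - pw a (Suc (Suc n))" using 1 2 by simp
  then show ?case unfolding X_def by (rule eq_if_reflected_twice)
qed simp

text \<open>The Jordan identity mixes the two placements of \<open>a\<close>, hence the joint
  induction: \<open>e2\<close> applied twice determines \<open>W\<close>, and then \<open>e1\<close>
  determines \<open>Z\<close>.\<close>

lemma tp_two_powers:
  "j + k = N \<Longrightarrow> tp a (pw a j) (pw a k) = pw a (Suc N) \<and> tp (pw a j) a (pw a k) = pw a (Suc N)"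
proof (induction N arbitrary: j k)
  case (Suc N)
  define W where "W j k = tp a (pw a j) (pw a k)" for j k
  define Z where "Z j k = tp (pw a j) a (pw a k)" for j k
  have IH: "W j k = pw a (Suc N)" "Z j k = pw a (Suc N)" if "j + k = N" for j k
    using Suc.IH[OF that] by (auto simp: W_def Z_def)
  have e1: "W j (Suc k) = Z (Suc j) k - W (Suc j) k + pw a (Suc (Suc N))" if jk: "j + k = N" for j k
  proof -
    have "tp a (pw a j) (tp a a (pw a k)) = tp (tp a (pw a j) a) a (pw a k)
        - tp a (tp (pw a j) a a) (pw a k) + tp a a (tp a (pw a j) (pw a k))"
      by (rule Jordan_identity)
    then show ?thesis
      using IH(1)[OF jk] tp_base_power[of a "Suc N"]
      by (simp add: W_def Z_def tp_base_power symmetric_tp[of "pw a j" a a] del: odd_power.simps)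
        simp
  qed
  have e2: "W j (Suc k) = 2 *\<^sub>R W k (Suc j) - pw a (Suc (Suc N))" if jk: "j + k = N" for j k
  proof -
    have "tp a (pw a j) (tp a (pw a k) a) = tp (tp a (pw a j) a) (pw a k) a
        - tp a (tp (pw a j) a (pw a k)) a + tp a (pw a k) (tp a (pw a j) a)"
      by (rule Jordan_identity)
    then show ?thesis
      using IH(2)[OF jk]
      by (simp add: W_def Z_def symmetric_tp[of "tp a (pw a j) a" "pw a k" a] scaleR_2)
  qed
  have W1: "W j (Suc k) = pw a (Suc (Suc N))" if "j + k = N" for j k
  proof -
    define p where "p = pw a (Suc (Suc N))"
    have "W j (Suc k) = 2 *\<^sub>R (2 *\<^sub>R W j (Suc k) - p) - p"
      using e2[of j k] e2[of k j] that by (simp add: add.commute p_def)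
    then have "W j (Suc k) = p" by (rule eq_if_reflected_twice)
    then show ?thesis by (simp add: p_def)
  qed
  have W: "W j k = pw a (Suc (Suc N))" if "j + k = Suc N" for j k
  proof (cases k)
    case 0
    then show ?thesis using that by (simp add: W_def)
  next
    case (Suc k')
    then show ?thesis using W1[of j k'] that by simp
  qed
  have Z: "Z j k = pw a (Suc (Suc N))" if "j + k = Suc N" for j k
  proof (cases j)
    case 0
    then show ?thesis using that tp_base_power[of a k] by (simp add: Z_def)
  next
    case (Suc j')
    then show ?thesis using e1[of j' k] W[of j' "Suc k"] W[of "Suc j'" k] that by simp
  qed
  show ?case using W[OF Suc.prems] Z[OF Suc.prems] by (simp add: W_def Z_def)
qed simp

lemma tp_powers: "tp (pw a i) (pw a j) (pw a k) = pw a (Suc (i + j + k))"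
proof (induction i arbitrary: j k)
  case 0
  then show ?case using tp_two_powers[of j k "j + k" a] by simp
next
  case (Suc i)
  have W: "tp a (pw a m) (pw a n) = pw a (Suc (m + n))"
    and Z: "tp (pw a m) a (pw a n) = pw a (Suc (m + n))" for m n
    using tp_two_powers[of m n "m + n" a] by auto
  have "tp (pw a k) (pw a j) (tp a a (pw a i)) = tp (tp (pw a k) (pw a j) a) a (pw a i)
      - tp a (tp (pw a j) (pw a k) a) (pw a i) + tp a a (tp (pw a k) (pw a j) (pw a i))"
    by (rule Jordan_identity)
  also have "tp (pw a k) (pw a j) a = pw a (Suc (j + k))"
    using W[of j k] symmetric_tp by metis
  also have "tp (pw a j) (pw a k) a = pw a (Suc (j + k))"
    using W[of k j] symmetric_tp by (metis add.commute)
  also have "tp (pw a k) (pw a j) (pw a i) = pw a (Suc (i + j + k))"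
    using Suc symmetric_tp by metis
  finally have "tp (pw a k) (pw a j) (pw a (Suc i)) = pw a (Suc (Suc (i + j + k)))"
    by (simp only: tp_base_power W Z) (simp add: add_ac del: odd_power.simps)
  then show ?case using symmetric_tp by (metis add_Suc)
qed

definition PL :: "'a \<Rightarrow> nat \<Rightarrow> 'a \<Rightarrow> 'a"
  where "PL a n z = tp (pw a n) a z"

lemma clinear_PL: "clinear (PL a n)"
  unfolding PL_def by (rule clinear_tp_right)

lemmas PL_simps = clinear_simps[OF clinear_PL]

lemma tp_powers_commutator:
  "tp (pw a i) (pw a j) (tp (pw a k) (pw a l) z) - tp (pw a k) (pw a l) (tp (pw a i) (pw a j) z) =
    tp (pw a (Suc (i + j + k))) (pw a l) z - tp (pw a k) (pw a (Suc (i + j + l))) z"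
proof -
  have "tp (pw a i) (pw a j) (tp (pw a k) (pw a l) z) = tp (tp (pw a i) (pw a j) (pw a k)) (pw a l) z
      - tp (pw a k) (tp (pw a j) (pw a i) (pw a l)) z + tp (pw a k) (pw a l) (tp (pw a i) (pw a j) z)"
    by (rule Jordan_identity)
  then show ?thesis by (simp add: tp_powers add_ac del: odd_power.simps)
qed

text \<open>A commutator changes sign when its factors are exchanged, which by
  \<open>tp_powers_commutator\<close> becomes linear relations between the values
  \<open>f m\<close>. They make \<open>f\<close> an arithmetic progression with difference
  \<open>\<delta> = f 0 - f N\<close>. Its last term gives \<open>- \<delta> = N \<delta>\<close>,
  so \<open>f\<close> is constant.\<close>

lemma tp_powers_eq_PL: "tp (pw a i) (pw a j) z = PL a (i + j) z"
proof (cases "i + j")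
  case 0
  then show ?thesis by (simp add: PL_def)
next
  case (Suc M)
  define N where "N = i + j"
  define f where "f m = tp (pw a m) (pw a (N - m)) z" for m
  have sym: "tp (pw a (Suc (i + j + k))) (pw a l) z + tp (pw a (Suc (i + k + l))) (pw a j) z =
      tp (pw a k) (pw a (Suc (i + j + l))) z + tp (pw a i) (pw a (Suc (j + k + l))) z" for i j k l
  proof -
    have "(tp (pw a (Suc (i + j + k))) (pw a l) z - tp (pw a k) (pw a (Suc (i + j + l))) z)
        + (tp (pw a (Suc (k + l + i))) (pw a j) z - tp (pw a i) (pw a (Suc (k + l + j))) z) = 0"
      unfolding tp_powers_commutator[symmetric] by simp
    then show ?thesis by (simp add: algebra_simps del: odd_power.simps)
  qed
  have e1: "f k + f (N - 1 - k) = 2 *\<^sub>R f N" if "k < N" for k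
    using sym[of "N - 1 - k" 0 k 0] that
    by (simp add: f_def scaleR_2 Suc_diff_Suc add.commute del: odd_power.simps(2))
  have e2: "f m + f (N + 1 - m) = 2 *\<^sub>R f 0" if "0 < m" "m \<le> N" for m
    using sym[of 0 "m - 1" 0 "N - m"] that
    by (simp add: f_def scaleR_2 Suc_diff_le del: odd_power.simps(2))
  define \<delta> where "\<delta> = f 0 - f N"
  have N: "N > 0" using Suc by (simp add: N_def)
  have step: "f (m + 2) = f m + 2 *\<^sub>R \<delta>" if "m + 2 \<le> N" for m
  proof -
    have "f m = 2 *\<^sub>R f N - f (N - 1 - m)"
      using e1[of m] that by (simp add: eq_diff_eq)
    moreover have "f (m + 2) = 2 *\<^sub>R f 0 - f (N - 1 - m)"
      using e2[of "m + 2"] that by (simp add: eq_diff_eq numeral_2_eq_2)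
    ultimately show ?thesis unfolding \<delta>_def scaleR_diff_right by simp
  qed
  have lin: "f m = f 0 + real m *\<^sub>R \<delta>" if "m \<le> N" for m
    using that
  proof (induction m rule: less_induct)
    case (less m)
    consider "m = 0" | "m = 1" | k where "m = k + 2" by (metis One_nat_def Suc_1 add_2_eq_Suc' not0_implies_Suc)
    then show ?case
    proof cases
      case 2
      have "f 1 = 2 *\<^sub>R f 0 - f N" using e2[of 1] N by (simp add: eq_diff_eq)
      then show ?thesis unfolding 2 \<delta>_def by (simp add: scaleR_2)
    next
      case (3 k)
      then have "f m = f 0 + real k *\<^sub>R \<delta> + 2 *\<^sub>R \<delta>" using step[of k] less.IH[of k] less.prems by simp
      then show ?thesis unfolding 3 by (simp add: scaleR_add_left add_ac)
    qed simp
  qed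
  have "f N = f 0 + real N *\<^sub>R \<delta>" by (rule lin) simp
  then have "(real N + 1) *\<^sub>R \<delta> = 0" unfolding \<delta>_def by (simp add: algebra_simps)
  then have "\<delta> = 0" by simp
  then have "f i = f N" using lin[of i] lin[of N] by (simp add: N_def)
  then show ?thesis by (simp add: f_def N_def PL_def)
qed

lemma PL_commute: "PL a m (PL a n z) = PL a n (PL a m z)"
  using tp_powers_commutator[of a m 0 n 0 z]
  unfolding tp_powers_eq_PL by (simp add: add.commute)

lemma tp_base_left: "tp a (pw a n) y = PL a n y"
  using tp_powers_eq_PL[of a 0 n y] by simp

lemma tp_base_right: "tp y (pw a n) a = PL a n y"
  unfolding symmetric_tp[of y] by (rule tp_base_left)

lemma tp_base_outer: "tp y a (pw a n) = PL a n y"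
  unfolding symmetric_tp[of y] PL_def ..

lemma PL_self: "PL a n a = pw a (Suc n)"
  using tp_base_power[of a n] by (simp add: PL_def symmetric_tp[of "pw a n" a a])

lemma tp_middle_power: "tp a y (pw a (Suc n)) = tp a (PL a n y) a"
proof -
  define U where "U = PL a n (tp a y a)"
  define V where "V = tp a (PL a n y) a"
  define X where "X = tp a y (pw a (Suc n))"
  note PL0 = tp_base_left tp_base_right PL_def[symmetric] tp_base_outer
  have "tp (pw a n) a (tp a y a) = tp (tp (pw a n) a a) y a
      - tp a (tp a (pw a n) y) a + tp a y (tp (pw a n) a a)"
    by (rule Jordan_identity)
  also have "tp (pw a n) a a = pw a (Suc n)"
    using symmetric_tp[of "pw a n" a a] tp_base_power[of a n] by simp
  finally have 1: "U = 2 *\<^sub>R X - V"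
    unfolding U_def V_def X_def PL0 using symmetric_tp[of "pw a (Suc n)" y a]
    by (simp only: scaleR_2 add_diff_eq diff_add_eq)
  have "tp a y (tp a (pw a n) a) = tp (tp a y a) (pw a n) a
      - tp a (tp y a (pw a n)) a + tp a (pw a n) (tp a y a)"
    by (rule Jordan_identity)
  then have 2: "X = 2 *\<^sub>R U - V"
    unfolding U_def V_def X_def PL0 PL_self by (simp only: scaleR_2 add_diff_eq diff_add_eq)
  have "U = 2 *\<^sub>R (2 *\<^sub>R U - V) - V" using 1 2 by simp
  then have "U = V" by (rule eq_if_reflected_twice)
  then have "X = V" using 2 by (simp add: scaleR_2)
  then show ?thesis by (simp add: X_def V_def)
qed

lemma PL_step: "PL a (Suc n) y = 2 *\<^sub>R PL a n (PL a 0 y) - tp a (tp a y (pw a n)) a"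
proof -
  have "tp y a (tp a (pw a n) a) = tp (tp y a a) (pw a n) a
      - tp a (tp a y (pw a n)) a + tp a (pw a n) (tp y a a)"
    by (rule Jordan_identity)
  then show ?thesis
    using tp_base_outer[of y a "Suc n"] tp_base_outer[of y a 0]
    by (simp add: tp_base_left tp_base_right scaleR_2 algebra_simps)
qed

lemma Q_squared: "tp a (tp a y a) a = 2 *\<^sub>R PL a 0 (PL a 0 y) - PL a 1 y"
  using PL_step[of a 0 y] by simp

text \<open>Reading \<open>PL a n\<close> as the power sum \<open>(S^(n+1) + T^(n+1)) / 2\<close>,
  one has \<open>2 PL a 0 = S + T\<close>, and the operator of \<open>Q_squared\<close> is
  \<open>S T\<close>; this is Newton's recursion. By it every \<open>PL a n\<close> is a polynomial
  in \<open>PL a 0\<close> and \<open>PL a 1\<close>.\<close>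

lemma PL_rec:
  "PL a (Suc (Suc n)) y = 2 *\<^sub>R PL a (Suc n) (PL a 0 y)
    - (2 *\<^sub>R PL a 0 (PL a 0 (PL a n y)) - PL a 1 (PL a n y))"
  using PL_step[of a "Suc n" y] unfolding tp_middle_power Q_squared .

lemma PL_2: "PL a 2 y = 3 *\<^sub>R PL a 1 (PL a 0 y) - 2 *\<^sub>R PL a 0 (PL a 0 (PL a 0 y))"
  using PL_rec[of a 0 y] by (simp add: numeral_2_eq_2 scaleR_3 scaleR_2)

end

lemma inverse_sqrt_lim: "(\<lambda>n. 1 / sqrt (real (Suc n))) \<longlonglongrightarrow> 0"
  using tendsto_real_sqrt[OF LIMSEQ_inverse_real_of_nat]
  by (simp add: real_sqrt_divide inverse_eq_divide del: of_nat_Suc)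

section \<open>Norm estimates and approximate eigenvectors of \<open>L(a, a)\<close>\<close>

context jbstar_triple
begin

lemma norm_tp_le: "norm (tp a a z) \<le> (norm a)\<^sup>2 * norm z"
proof -
  have "bounded_linear (tp a a)" using hermitian_L[of a] by (simp add: hermitian_op_def)
  from onorm[OF this, of z] show ?thesis by (simp add: norm_L)
qed

text \<open>For \<open>\<mu> > k\<close> the operator \<open>L(a, a) - \<mu>\<close> is bounded
  below because \<open>L(a, a)\<close> has norm at most \<open>k\<close>. With \<open>k = 1\<close>
  the result says that \<open>L(a, a)\<close> is the average of the identity and a contraction;
  \<open>k = 4\<close> serves for \<open>a - a^[3]\<close>.\<close>

lemma norm_tp_centred:
  assumes "(norm a)\<^sup>2 \<le> k"
  shows "norm (tp a a v - (k / 2) *\<^sub>R v) \<le> k / 2 * norm v"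
proof (rule hermitian_op_norm_le_half_spectrum[OF hermitian_L nonneg_spectrum_L])
  show "0 \<le> k" using assms zero_le_power2 order_trans by blast
  fix \<mu> assume \<mu>: "\<mu> > k"
  have "(\<mu> - k) * norm v \<le> norm (tp a a v - \<mu> *\<^sub>R v)" for v
  proof -
    have "\<mu> * norm v = norm (\<mu> *\<^sub>R v)" using \<mu> \<open>0 \<le> k\<close> by simp
    also have "\<dots> \<le> norm (tp a a v) + norm (tp a a v - \<mu> *\<^sub>R v)"
      by (metis norm_minus_commute norm_triangle_sub)
    also have "norm (tp a a v) \<le> k * norm v"
      using norm_tp_le[of a v] mult_right_mono[OF assms, of "norm v"] by simp
    finally show ?thesis by (simp add: algebra_simps)
  qed
  then show "\<exists>c>0. \<forall>v. c * norm v \<le> norm (tp a a v - \<mu> *\<^sub>R v)"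
    using \<mu> by (intro exI[of _ "\<mu> - k"]) simp
qed

text \<open>Otherwise the spectrum of \<open>L(a, a)\<close> would lie in \<open>[0, 1 - \<delta>/2]\<close>.\<close>

lemma approximate_eigenvector:
  assumes a: "norm a = 1" and \<delta>: "\<delta> > 0"
  obtains y where "norm y = 1" "norm (tp a a y - y) < \<delta>"
proof (rule ccontr)
  assume "\<not> thesis"
  then have ge: "\<delta> \<le> norm (tp a a y - y)" if "norm y = 1" for y
    using that \<open>\<And>y. norm y = 1 \<Longrightarrow> norm (tp a a y - y) < \<delta> \<Longrightarrow> thesis\<close> not_le by blast
  define d where "d = min \<delta> 1"
  \<comment> \<open>Between \<open>k\<close> and 1 the lower bound \<open>d\<close> valid at 1 loses
    at most \<open>d / 2\<close>; beyond 1 the norm of \<open>L(a, a)\<close> suffices. Capping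
    \<open>\<delta>\<close> at 1 keeps \<open>k\<close> nonnegative.\<close>
  define k where "k = 1 - d / 2"
  have d: "0 < d" "d \<le> 1" "d \<le> \<delta>" using \<delta> by (auto simp: d_def)
  have below: "d * norm v \<le> norm (tp a a v - v)" for v
  proof (cases "v = 0")
    case False
    define y where "y = v /\<^sub>R norm v"
    have y: "norm y = 1" "v = norm v *\<^sub>R y" using False by (auto simp: y_def)
    have "tp a a v - v = norm v *\<^sub>R (tp a a y - y)"
      using y(2) by (metis tp_right(5) scaleR_diff_right)
    then have "norm (tp a a v - v) = norm v * norm (tp a a y - y)" by simp
    also have "\<dots> \<ge> norm v * d" using ge[OF y(1)] d by (intro mult_left_mono) auto
    finally show ?thesis by (simp add: mult.commute)
  qed simp
  have *: "norm (tp a a v - (k / 2) *\<^sub>R v) \<le> k / 2 * norm v" for v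
  proof (rule hermitian_op_norm_le_half_spectrum[OF hermitian_L nonneg_spectrum_L])
    show "0 \<le> k" using d by (simp add: k_def)
    fix \<mu> assume \<mu>: "\<mu> > k"
    show "\<exists>c>0. \<forall>v. c * norm v \<le> norm (tp a a v - \<mu> *\<^sub>R v)"
    proof (cases "\<mu> > 1")
      case True
      have "(\<mu> - 1) * norm v \<le> norm (tp a a v - \<mu> *\<^sub>R v)" for v
      proof -
        have "\<mu> * norm v = norm (\<mu> *\<^sub>R v)" using True by simp
        also have "\<dots> \<le> norm (tp a a v) + norm (tp a a v - \<mu> *\<^sub>R v)"
          by (metis norm_minus_commute norm_triangle_sub)
        also have "norm (tp a a v) \<le> norm v" using norm_tp_le[of a v] a by simp
        finally show ?thesis by (simp add: algebra_simps)
      qed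
      then show ?thesis using True by (intro exI[of _ "\<mu> - 1"]) simp
    next
      case False
      have "d / 2 * norm v \<le> norm (tp a a v - \<mu> *\<^sub>R v)" for v
      proof -
        have "tp a a v - v = (tp a a v - \<mu> *\<^sub>R v) - (1 - \<mu>) *\<^sub>R v" by (simp add: algebra_simps)
        then have "d * norm v \<le> norm (tp a a v - \<mu> *\<^sub>R v) + norm ((1 - \<mu>) *\<^sub>R v)"
          using below[of v] norm_triangle_ineq4 order_trans by metis
        moreover have "norm ((1 - \<mu>) *\<^sub>R v) \<le> d / 2 * norm v"
          unfolding norm_scaleR using False \<mu> by (intro mult_right_mono) (auto simp: k_def)
        ultimately show ?thesis by (simp add: algebra_simps)
      qed
      then show ?thesis using d by (intro exI[of _ "d / 2"]) simp
    qed
  qed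
  have "norm (tp a a v) \<le> k * norm v" for v
  proof -
    have k0: "k \<ge> 0" using d by (simp add: k_def)
    have "norm (tp a a v) \<le> norm (tp a a v - (k / 2) *\<^sub>R v) + norm ((k / 2) *\<^sub>R v)"
      using norm_triangle_ineq[of "tp a a v - (k / 2) *\<^sub>R v" "(k / 2) *\<^sub>R v"] by simp
    also have "\<dots> \<le> k / 2 * norm v + k / 2 * norm v"
      using * k0 by (intro add_mono) auto
    finally show ?thesis by simp
  qed
  then have "onorm (tp a a) \<le> k" using d by (intro onorm_bound) (auto simp: k_def)
  then show False using d a by (simp add: norm_L k_def)
qed

lemma norm_cube_le_one: "norm a = 1 \<Longrightarrow> norm (pw a 1) \<le> 1"
  using norm_tp_le[of a a] by simp

lemma pw_eq_funpow: "pw a n = (tp a a ^^ n) a"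
proof (induction n)
  case (Suc n)
  then show ?case using tp_base_power[of a n] by simp
qed simp

lemma norm_pw_le_one:
  assumes "norm a = 1"
  shows "norm (pw a n) \<le> 1"
  using norm_funpow_le[of "tp a a" 1 n a] norm_tp_le[of a] assms by (simp add: pw_eq_funpow)

lemma linear_tp: "linear (tp x y)"
  by (intro linearI) (simp_all add: tp_right)

text \<open>Makes the weak* cluster points of the powers insensitive to a shift of the
  index.\<close>

lemma pw_asymptotically_regular:
  assumes a: "norm a = 1"
  shows "(\<lambda>n. pw a (Suc n) - pw a n) \<longlonglongrightarrow> 0"
proof -
  have "norm (2 *\<^sub>R tp a a v - v) \<le> norm v" for v
  proof -
    have "2 *\<^sub>R tp a a v - v = 2 *\<^sub>R (tp a a v - (1 / 2) *\<^sub>R v)" by (simp add: scaleR_diff_right)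
    then show ?thesis using norm_tp_centred[of a 1 v] a by simp
  qed
  from averaged_contraction_decay[OF linear_tp this]
  have le: "norm (pw a (Suc n) - pw a n) \<le> 1 / sqrt (real (Suc n))" for n
  proof -
    assume *: "\<And>n v. norm ((tp a a ^^ n) (v - tp a a v)) \<le> norm v / sqrt (real (Suc n))"
    have "(tp a a ^^ n) (a - tp a a a) = pw a n - pw a (Suc n)"
      using clinear_simps(3)[OF clinear_funpow[OF clinear_tp_right[of a a], of n], of a "tp a a a"]
        pw_eq_funpow[of a n] pw_eq_funpow[of a "Suc n"]
      by (simp add: funpow_swap1 del: odd_power.simps)
    then show ?thesis using *[of n a] a by (simp add: norm_minus_commute del: of_nat_Suc)
  qed
  then show ?thesis
    by (intro Lim_null_comparison[OF always_eventually inverse_sqrt_lim]) auto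
qed

end

text \<open>On approximate fixed vectors of \<open>h\<close> the operator \<open>c = 1 + R/2\<close> is almost a
  contraction, while its inverse is an average of the identity and a contraction. Hence
  \<open>R y = 2 c^(n+1) (c^-n (1 - c^-1) y)\<close> is small.\<close>

lemma positive_operator_vanishes_on_fixed_vectors:
  fixes R h J :: "'a::real_normed_vector \<Rightarrow> 'a" and Y :: "nat \<Rightarrow> 'a"
  defines "c \<equiv> \<lambda>v. v + (1/2) *\<^sub>R R v"
  assumes R: "linear R" and h: "linear h" and comm: "\<And>v. R (h v) = h (R v)"
    and J: "\<And>v. J (c v) = v" "\<And>v. c (J v) = v"
    and centred: "\<And>v. norm (R v - 2 *\<^sub>R v) \<le> 2 * norm v"
    and contr: "\<And>v. norm (c v) \<le> norm v + K * norm (v - h v)" and K: "K \<ge> 0"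
    and Y: "\<And>k. norm (Y k) = 1" "(\<lambda>k. Y k - h (Y k)) \<longlonglongrightarrow> 0"
  shows "(\<lambda>k. R (Y k)) \<longlonglongrightarrow> 0"
proof -
  have c: "linear c" unfolding c_def using R
    by (intro linearI) (simp_all add: linear_add linear_scale algebra_simps)
  have Jlin: "linear J"
    by (intro linearI; metis J linear_add[OF c] linear_scale[OF c])
  have c_h: "c (h v) = h (c v)" for v
    by (simp add: c_def comm linear_add[OF h] linear_scale[OF h])
  have J_h: "J (h v) = h (J v)" for v by (metis J c_h)
  \<comment> \<open>The factor 1/2 in \<open>c\<close> places it within distance 1 of twice the
    identity. Hence \<open>c\<close> does not decrease norms, and \<open>2 J - 1 = (2 - c) J\<close>
    is a contraction.\<close>
  have c_eq: "c v = 2 *\<^sub>R v + (1/2) *\<^sub>R (R v - 2 *\<^sub>R v)" for v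
    by (simp add: c_def scaleR_diff_right scaleR_2)
  have half: "norm ((1/2) *\<^sub>R (R v - 2 *\<^sub>R v)) \<le> norm v" for v
    using centred[of v] by simp
  have c_ge: "norm v \<le> norm (c v)" for v
    using half[of v] norm_triangle_ineq4[of "c v" "(1/2) *\<^sub>R (R v - 2 *\<^sub>R v)"]
    by (simp add: c_eq)
  have c_le: "norm (c v) \<le> 3 * norm v" for v
    using half[of v] norm_triangle_ineq[of "2 *\<^sub>R v" "(1/2) *\<^sub>R (R v - 2 *\<^sub>R v)"]
    by (simp add: c_eq)
  have J_le: "norm (J v) \<le> norm v" for v using c_ge[of "J v"] J by simp
  have "norm (2 *\<^sub>R J v - v) \<le> norm v" for v
  proof -
    have "v - 2 *\<^sub>R J v = (1/2) *\<^sub>R (R (J v) - 2 *\<^sub>R J v)"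
      using c_eq[of "J v"] J(2)[of v] by (simp add: algebra_simps)
    then have "norm (v - 2 *\<^sub>R J v) \<le> norm (J v)" using half by metis
    then show ?thesis using J_le[of v] by (simp add: norm_minus_commute)
  qed
  from averaged_contraction_decay[OF Jlin this]
  have decay: "norm ((J ^^ n) (v - J v)) \<le> norm v / sqrt (real (Suc n))" for n v .
  have cJ: "(c ^^ n) ((J ^^ n) v) = v" for n v
  proof (induction n arbitrary: v)
    case (Suc n)
    have "(c ^^ Suc n) ((J ^^ Suc n) v) = c ((c ^^ n) ((J ^^ n) (J v)))" by (simp add: funpow_swap1)
    then show ?case by (simp add: Suc J)
  qed simp
  have J_h_pow: "(J ^^ n) (h v) = h ((J ^^ n) v)" for n v by (induction n) (simp_all add: J_h)
  have J_diff_pow: "(J ^^ n) (u - v) = (J ^^ n) u - (J ^^ n) v" for n u v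
    by (induction n) (simp_all add: linear_diff[OF Jlin])
  have J_le_pow: "norm ((J ^^ n) v) \<le> norm v" for n v using norm_funpow_le[of J 1] J_le by simp
  \<comment> \<open>Each application of \<open>c\<close> multiplies the defect
    \<open>v - h v\<close> by at most 3, whence the geometric sum \<open>(3^n - 1) / 2\<close>. Its
    growth is harmless because \<open>n\<close> is fixed before \<open>k\<close> tends to
    infinity.\<close>
  have c_pow: "norm ((c ^^ n) v) \<le> norm v + K * (3 ^ n - 1) / 2 * norm (v - h v)" for n v
  proof (induction n arbitrary: v)
    case (Suc n)
    have e: "norm (c v - h (c v)) \<le> 3 * norm (v - h v)"
      using c_le[of "v - h v"] by (simp add: linear_diff[OF c] c_h)
    have "norm ((c ^^ Suc n) v) \<le> norm (c v) + K * (3 ^ n - 1) / 2 * norm (c v - h (c v))"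
      using Suc[of "c v"] by (simp add: funpow_swap1)
    also have "\<dots> \<le> (norm v + K * norm (v - h v)) + K * (3 ^ n - 1) / 2 * (3 * norm (v - h v))"
      using K by (intro add_mono contr mult_left_mono e) auto
    also have "\<dots> = norm v + K * (3 ^ Suc n - 1) / 2 * norm (v - h v)"
      by (simp add: field_simps)
    finally show ?case .
  qed simp
  have main: "norm (Y k - J (Y k)) \<le> 1 / sqrt (real (Suc n)) + K * (3 ^ n - 1) * norm (Y k - h (Y k))" for n k
  proof -
    define u where "u = (J ^^ n) (Y k - J (Y k))"
    have "u - h u = (J ^^ n) ((Y k - h (Y k)) - J (Y k - h (Y k)))"
      unfolding u_def by (simp add: J_diff_pow linear_diff[OF Jlin] J_h_pow linear_diff[OF h] J_h)
    then have "norm (u - h u) \<le> norm ((Y k - h (Y k)) - J (Y k - h (Y k)))" using J_le_pow by metis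
    also have "\<dots> \<le> 2 * norm (Y k - h (Y k))"
      using norm_triangle_ineq4[of "Y k - h (Y k)" "J (Y k - h (Y k))"] J_le[of "Y k - h (Y k)"] by simp
    finally have uh: "norm (u - h u) \<le> 2 * norm (Y k - h (Y k))" .
    have "norm (Y k - J (Y k)) = norm ((c ^^ n) u)" by (simp add: u_def cJ)
    also have "\<dots> \<le> norm u + K * (3 ^ n - 1) / 2 * norm (u - h u)" by (rule c_pow)
    also have "\<dots> \<le> 1 / sqrt (real (Suc n)) + K * (3 ^ n - 1) / 2 * (2 * norm (Y k - h (Y k)))"
      using decay[of n "Y k"] Y(1)[of k] K uh unfolding u_def by (intro add_mono mult_left_mono) auto
    finally show ?thesis by simp
  qed
  have lim: "(\<lambda>k. Y k - J (Y k)) \<longlonglongrightarrow> 0"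
  proof (rule tendstoI)
    fix \<epsilon> :: real assume \<epsilon>: "\<epsilon> > 0"
    have "\<forall>\<^sub>F n in sequentially. 1 / sqrt (real (Suc n)) < \<epsilon> / 2"
      using \<epsilon> inverse_sqrt_lim by (intro order_tendstoD) auto
    then obtain n where n: "1 / sqrt (real (Suc n)) < \<epsilon> / 2" by (meson eventually_sequentially order_refl)
    have "(\<lambda>k. K * (3 ^ n - 1) * norm (Y k - h (Y k))) \<longlonglongrightarrow> K * (3 ^ n - 1) * norm (0::'a)"
      by (intro tendsto_intros Y(2))
    then have "\<forall>\<^sub>F k in sequentially. K * (3 ^ n - 1) * norm (Y k - h (Y k)) < \<epsilon> / 2"
      using \<epsilon> by (intro order_tendstoD(2)) auto
    then show "\<forall>\<^sub>F k in sequentially. dist (Y k - J (Y k)) 0 < \<epsilon>"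
    proof eventually_elim
      case (elim k)
      then show ?case using main[of k n] n by simp
    qed
  qed
  have "R v = 2 *\<^sub>R c (v - J v)" for v
    by (simp add: linear_diff[OF c] J) (simp add: c_def scaleR_2)
  then have "norm (R (Y k)) \<le> norm (Y k - J (Y k)) * 6" for k
    using c_le[of "Y k - J (Y k)"] by simp
  then show ?thesis
    by (intro tendsto_0_le[OF lim, of _ 6] always_eventually) auto
qed

section \<open>Common approximate fixed vectors and norms of convex combinations of powers\<close>

context jbstar_triple
begin

text \<open>For \<open>x = a - a^[3]\<close> the operator \<open>R = L(x, x)\<close> acts on fixed
  vectors of \<open>h\<close> like \<open>P - 1\<close>, so that \<open>PL a 2\<close> acts there
  like \<open>1 + 3 R\<close>. As \<open>PL a 2\<close> is a contraction and \<open>R\<close> is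
  positive, \<open>R\<close> has to vanish asymptotically. Hence \<open>P\<close> fixes
  asymptotically what \<open>h\<close> fixes, and \<open>PL_rec\<close> carries this on to all
  \<open>n\<close>.\<close>

lemma PL_approximate_fixed:
  assumes a: "norm a = 1" and Y: "\<And>k. norm (Y k) = 1" "(\<lambda>k. Y k - tp a a (Y k)) \<longlonglongrightarrow> 0"
  shows "(\<lambda>k. PL a n (Y k) - Y k) \<longlonglongrightarrow> 0"
proof -
  define h where "h = PL a 0"
  define P where "P = PL a 1"
  have h_eq: "h v = tp a a v" for v by (simp add: h_def PL_def)
  have hP: "P (h v) = h (P v)" for v unfolding P_def h_def by (rule PL_commute)
  have h_lin: "h (u + v) = h u + h v" "h (u - v) = h u - h v" "h (r *\<^sub>R v) = r *\<^sub>R h v" for u v r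
    by (simp_all add: h_def PL_simps)
  have P_lin: "P (u + v) = P u + P v" "P (u - v) = P u - P v" "P (r *\<^sub>R v) = r *\<^sub>R P v" for u v r
    by (simp_all add: P_def PL_simps)
  define x where "x = a - pw a 1"
  define R where "R = tp x x"
  have PL2: "PL a 2 v = 3 *\<^sub>R P (h v) - 2 *\<^sub>R h (h (h v))" for v
    unfolding P_def h_def by (rule PL_2)
  have R_eq: "R v = h v - 2 *\<^sub>R P v + PL a 2 v" for v
  proof -
    have "R v = tp (pw a 0) (pw a 0) v - tp (pw a 0) (pw a 1) v - (tp (pw a 1) (pw a 0) v - tp (pw a 1) (pw a 1) v)"
      unfolding R_def x_def by (simp add: tp_left tp_middle algebra_simps)
    then show ?thesis unfolding tp_powers_eq_PL by (simp add: h_def P_def scaleR_2 numeral_2_eq_2)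
  qed
  have R_lin: "linear R" unfolding R_def by (rule linear_tp)
  have R_comm: "R (h v) = h (R v)" for v
    unfolding R_eq by (simp add: h_lin PL2 hP)
  have x: "(norm x)\<^sup>2 \<le> 4"
  proof -
    have "norm x \<le> 2" unfolding x_def
      using norm_triangle_ineq4[of a "pw a 1"] norm_cube_le_one[OF a] a by simp
    then have "(norm x)\<^sup>2 \<le> 2\<^sup>2" by (intro power_mono) auto
    then show ?thesis by simp
  qed
  have centred: "norm (R v - 2 *\<^sub>R v) \<le> 2 * norm v" for v
    using norm_tp_centred[OF x, of v] by (simp add: R_def)
  have h_le: "norm (h v) \<le> norm v" for v using norm_tp_le[of a v] a by (simp add: h_eq)
  have R_le: "norm (R v) \<le> 4 * norm v" for v
    using norm_tp_le[of x v] mult_right_mono[OF x norm_ge_zero[of v]] unfolding R_def by simp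
  have PL2_le: "norm (PL a 2 v) \<le> norm v" for v
  proof -
    have "PL a 2 v = tp (pw a 1) (pw a 1) v" unfolding tp_powers_eq_PL by (simp add: numeral_2_eq_2)
    then have "norm (PL a 2 v) \<le> (norm (pw a 1))\<^sup>2 * norm v" using norm_tp_le by simp
    also have "\<dots> \<le> 1\<^sup>2 * norm v"
      using norm_cube_le_one[OF a] by (intro mult_right_mono power_mono) auto
    finally show ?thesis by simp
  qed
  have P_le: "norm (P v) \<le> 3 * norm v" for v
  proof -
    have "2 *\<^sub>R P v = h v + PL a 2 v - R v" using R_eq[of v] by (simp add: algebra_simps)
    then have "2 * norm (P v) = norm (h v + PL a 2 v - R v)" by (metis norm_scaleR abs_numeral)
    also have "\<dots> \<le> norm (h v) + norm (PL a 2 v) + norm (R v)"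
      by (intro norm_triangle_le_diff add_mono norm_triangle_ineq) auto
    finally show ?thesis using h_le[of v] PL2_le[of v] R_le[of v] by simp
  qed
  define c where "c v = v + (1/2) *\<^sub>R R v" for v
  \<comment> \<open>Chosen so that \<open>1 + 3 R = PL a 2 - S (1 - h)\<close>. Then
    \<open>6 c = 5 + (1 + 3 R)\<close> is five times the identity plus a contraction, up to the
    defect \<open>v - h v\<close>.\<close>
  define S where "S u = 6 *\<^sub>R P u - (u + 4 *\<^sub>R h u + 4 *\<^sub>R h (h u))" for u
  have "6 *\<^sub>R c v = 5 *\<^sub>R v + (PL a 2 v - S (v - h v))" for v
  proof -
    have "6 *\<^sub>R c v = 6 *\<^sub>R v + 3 *\<^sub>R R v" by (simp add: c_def scaleR_add_right)
    also have "\<dots> = 5 *\<^sub>R v + (v + 3 *\<^sub>R R v)" using scaleR_add_left[of 5 1 v] by simp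
    also have "v + 3 *\<^sub>R R v = PL a 2 v - S (v - h v)"
    proof -
      have "4 *\<^sub>R u = u + u + u + u" "6 *\<^sub>R u = u + u + u + u + u + u"
        "9 *\<^sub>R u = u + u + u + u + u + u + u + u + u" for u :: 'a
        using scaleR_add_left[of 2 2 u] scaleR_add_left[of 3 3 u] scaleR_add_left[of 6 3 u]
        by (simp_all add: scaleR_2 scaleR_3)
      note scaleR_expand = this scaleR_2 scaleR_3
      define p q r s where pqrs: "p = P (h v)" "q = h (h (h v))" "r = h (h v)" "s = P v"
      show ?thesis
        unfolding S_def R_eq PL2 h_lin P_lin pqrs[symmetric]
        by (simp add: scaleR_expand algebra_simps)
    qed
    finally show ?thesis .
  qed
  then have c_S: "c v = (1/6) *\<^sub>R (5 *\<^sub>R v + (PL a 2 v - S (v - h v)))" for v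
    by (metis divide_self scaleR_one scaleR_scaleR times_divide_eq_left mult_1 zero_neq_numeral)
  have S_le: "norm (S u) \<le> 27 * norm u" for u
  proof -
    have "norm (S u) \<le> norm (6 *\<^sub>R P u) + (norm u + norm (4 *\<^sub>R h u) + norm (4 *\<^sub>R h (h u)))"
      unfolding S_def by (intro norm_triangle_le_diff add_mono norm_triangle_le) auto
    then show ?thesis using P_le[of u] h_le[of u] h_le[of "h u"] by simp
  qed
  have c_contr: "norm (c v) \<le> norm v + 5 * norm (v - h v)" for v
  proof -
    have "6 * norm (c v) = norm (5 *\<^sub>R v + (PL a 2 v - S (v - h v)))" by (simp add: c_S)
    also have "\<dots> \<le> norm (5 *\<^sub>R v) + (norm (PL a 2 v) + norm (S (v - h v)))"
      by (intro norm_triangle_le add_mono norm_triangle_ineq4) auto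
    finally show ?thesis using PL2_le[of v] S_le[of "v - h v"] by simp (smt (verit) norm_ge_zero)
  qed
  \<comment> \<open>\<open>c\<close> is half of \<open>R + 2\<close>, so the nonnegative spectrum of
    \<open>R\<close> supplies the inverse \<open>J\<close>.\<close>
  have "- 2 \<notin> op_spectrum R"
    using nonneg_spectrum_L[of x] by (auto simp: R_def nonneg_Reals_def dest!: subsetD)
      (metis Re_complex_of_real complex_Re_numeral neg_numeral_le_zero not_numeral_le_zero uminus_complex.sel(1) neg_0_le_iff_le)
  then obtain B where B: "clinear B" "\<And>v. B (R v - (- 2) *\<^sub>C v) = v" "\<And>v. R (B v) - (- 2) *\<^sub>C B v = v"
    unfolding op_spectrum_def by blast
  have two: "2 *\<^sub>C v = 2 *\<^sub>R v" for v :: 'a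
    by (metis of_real_numeral scaleC_of_real)
  define J where "J v = 2 *\<^sub>R B v" for v
  have J1: "J (c v) = v" for v
  proof -
    have "J (c v) = B (2 *\<^sub>R c v)" by (simp add: J_def clinear_simps[OF B(1)])
    also have "2 *\<^sub>R c v = R v - (- 2) *\<^sub>C v" by (simp add: c_def two scaleR_add_right)
    finally show ?thesis using B(2) by simp
  qed
  have J2: "c (J v) = v" for v
    using B(3)[of v] by (simp add: J_def c_def two linear_scale[OF R_lin] add.commute)
  have lim_h: "(\<lambda>k. Y k - h (Y k)) \<longlonglongrightarrow> 0" using Y(2) by (simp add: h_eq)
  have h_linear: "linear h" by (intro linearI) (simp_all add: h_lin)
  have lim_R: "(\<lambda>k. R (Y k)) \<longlonglongrightarrow> 0"
    by (rule positive_operator_vanishes_on_fixed_vectors[where h = h and J = J and K = 5 and Y = Y,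
          OF R_lin h_linear R_comm _ _ centred _ _ Y(1) lim_h])
      (use J1 J2 c_contr in \<open>simp_all add: c_def\<close>)
  have bl_h: "bounded_linear h" using h_le by (intro bounded_linear_intro[where K = 1]) (simp_all add: h_lin)
  have bl_P: "bounded_linear P"
    using P_le by (intro bounded_linear_intro[where K = 3]) (simp_all add: P_lin mult.commute)
  note lim0 = bounded_linear.tendsto_zero[OF bl_h] bounded_linear.tendsto_zero[OF bl_P]
  have E0: "(\<lambda>k. h (Y k) - Y k) \<longlonglongrightarrow> 0" using tendsto_minus[OF lim_h] by simp
  have E1: "(\<lambda>k. P (Y k) - Y k) \<longlonglongrightarrow> 0"
  proof -
    define D where "D k = Y k - h (Y k)" for k
    \<comment> \<open>\<open>P - 1\<close> equals \<open>R\<close> up to multiples of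
      \<open>1 - h\<close>; the factor \<open>h^2 + h + 1\<close> comes from
      \<open>1 - h^3\<close>.\<close>
    have "P v - v = R v + (v - h v) - 2 *\<^sub>R (h (h (v - h v)) + h (v - h v) + (v - h v)) + 3 *\<^sub>R P (v - h v)" for v
    proof -
      define p q r s where pqrs: "p = P (h v)" "q = h (h (h v))" "r = h (h v)" "s = P v"
      show ?thesis
        unfolding R_eq PL2 h_lin P_lin pqrs[symmetric]
        by (simp add: scaleR_3 scaleR_2 algebra_simps)
    qed
    then have "(\<lambda>k. P (Y k) - Y k) = (\<lambda>k. R (Y k) + D k - 2 *\<^sub>R (h (h (D k)) + h (D k) + D k) + 3 *\<^sub>R P (D k))"
      by (simp add: D_def)
    moreover have "(\<lambda>k. R (Y k) + D k - 2 *\<^sub>R (h (h (D k)) + h (D k) + D k) + 3 *\<^sub>R P (D k))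
        \<longlonglongrightarrow> 0 + 0 - 2 *\<^sub>R (0 + 0 + 0) + 3 *\<^sub>R 0"
      using lim_h unfolding D_def[symmetric] by (intro tendsto_intros lim_R lim0)
    ultimately show ?thesis by simp
  qed
  have "(\<lambda>k. PL a n (Y k) - Y k) \<longlonglongrightarrow> 0 \<and> (\<lambda>k. PL a (Suc n) (Y k) - Y k) \<longlonglongrightarrow> 0"
  proof (induction n)
    case 0
    then show ?case using E0 E1 by (simp add: h_def P_def)
  next
    case (Suc n)
    define E where "E k = PL a n (Y k) - Y k" for k
    define F where "F k = PL a (Suc n) (Y k) - Y k" for k
    have eq: "PL a (Suc (Suc n)) (Y k) - Y k = 2 *\<^sub>R h (F k) - 2 *\<^sub>R h (h (E k)) + P (E k)
        + 2 *\<^sub>R (h (Y k - h (Y k))) + (P (Y k) - Y k)" for k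
    proof -
      have "PL a (Suc n) (h (Y k)) = h (PL a (Suc n) (Y k))" unfolding h_def by (rule PL_commute)
      then have "PL a (Suc (Suc n)) (Y k) = 2 *\<^sub>R h (F k + Y k) - (2 *\<^sub>R h (h (E k + Y k)) - P (E k + Y k))"
        unfolding PL_rec h_def[symmetric] P_def[symmetric] by (simp add: E_def F_def)
      then show ?thesis by (simp add: h_lin P_lin algebra_simps)
    qed
    have "E \<longlonglongrightarrow> 0" "F \<longlonglongrightarrow> 0" using Suc unfolding E_def[abs_def] F_def[abs_def] by auto
    then have "(\<lambda>k. 2 *\<^sub>R h (F k) - 2 *\<^sub>R h (h (E k)) + P (E k) + 2 *\<^sub>R (h (Y k - h (Y k))) + (P (Y k) - Y k))
        \<longlonglongrightarrow> 2 *\<^sub>R 0 - 2 *\<^sub>R 0 + 0 + 2 *\<^sub>R 0 + 0"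
      by (intro tendsto_intros lim0 lim_h E1)
    then show ?case using Suc unfolding eq by simp
  qed
  then show ?thesis by simp
qed

lemma norm_convex_hull_powers:
  assumes a: "norm a = 1" and z: "z \<in> convex hull (range (pw a))"
  shows "1 \<le> norm z"
proof -
  have "\<exists>y. norm y = 1 \<and> norm (tp a a y - y) < 1 / real (Suc k)" for k
    using approximate_eigenvector[OF a, of "1 / real (Suc k)"] by (metis divide_pos_pos of_nat_0_less_iff zero_less_Suc zero_less_one)
  then obtain Y where Y: "\<And>k. norm (Y k) = 1" "\<And>k. norm (tp a a (Y k) - Y k) < 1 / real (Suc k)"
    by metis
  have "(\<lambda>k. Y k - tp a a (Y k)) \<longlonglongrightarrow> 0"
    by (rule Lim_null_comparison[OF always_eventually LIMSEQ_inverse_real_of_nat])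
      (use Y(2) in \<open>simp add: norm_minus_commute inverse_eq_divide less_imp_le\<close>)
  note PL_lim = PL_approximate_fixed[OF a Y(1) this]
  \<comment> \<open>The weights sum to 1, so \<open>Y k\<close> splits along with the combination.
    Below, this is applied to one slot of the triple product at a time.\<close>
  have convex: "convex {z. (\<lambda>k. f z k - Y k) \<longlonglongrightarrow> 0}"
    if "\<And>u v k. f (u + v) k = f u k + f v k" "\<And>r u k. f (r *\<^sub>R u) k = r *\<^sub>R f u k" for f :: "'a \<Rightarrow> nat \<Rightarrow> 'a"
  proof (rule convexI)
    fix u v and s t :: real
    assume uv: "u \<in> {z. (\<lambda>k. f z k - Y k) \<longlonglongrightarrow> 0}" "v \<in> {z. (\<lambda>k. f z k - Y k) \<longlonglongrightarrow> 0}"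
      and st: "0 \<le> s" "0 \<le> t" "s + t = 1"
    have "f (s *\<^sub>R u + t *\<^sub>R v) k - Y k = s *\<^sub>R (f u k - Y k) + t *\<^sub>R (f v k - Y k)" for k
    proof -
      have "Y k = s *\<^sub>R Y k + t *\<^sub>R Y k" using st(3) by (metis scaleR_add_left scaleR_one)
      then show ?thesis unfolding that by (simp add: algebra_simps)
    qed
    moreover have "(\<lambda>k. s *\<^sub>R (f u k - Y k) + t *\<^sub>R (f v k - Y k)) \<longlonglongrightarrow> s *\<^sub>R 0 + t *\<^sub>R 0"
      using uv by (intro tendsto_intros) auto
    ultimately show "s *\<^sub>R u + t *\<^sub>R v \<in> {z. (\<lambda>k. f z k - Y k) \<longlonglongrightarrow> 0}" by simp
  qed
  have left: "convex hull (range (pw a)) \<subseteq> {z. (\<lambda>k. tp z (pw a j) (Y k) - Y k) \<longlonglongrightarrow> 0}" for j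
    by (intro hull_minimal convex) (auto simp: tp_left tp_powers_eq_PL PL_lim)
  have "convex hull (range (pw a)) \<subseteq> {u. (\<lambda>k. tp z u (Y k) - Y k) \<longlonglongrightarrow> 0}"
    using z left by (intro hull_minimal convex) (auto simp: tp_middle)
  then have "(\<lambda>k. tp z z (Y k) - Y k) \<longlonglongrightarrow> 0" using z by blast
  then have "(\<lambda>k. (norm z)\<^sup>2 + norm (tp z z (Y k) - Y k)) \<longlonglongrightarrow> (norm z)\<^sup>2 + norm (0::'a)"
    by (intro tendsto_intros)
  moreover have "1 \<le> (norm z)\<^sup>2 + norm (tp z z (Y k) - Y k)" for k
    using norm_triangle_sub[of "Y k" "tp z z (Y k)"] norm_tp_le[of z "Y k"] Y(1)[of k]
    by (simp add: norm_minus_commute)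
  ultimately have "1 \<le> (norm z)\<^sup>2"
    by (intro LIMSEQ_le_const) auto
  then show ?thesis by (metis norm_ge_zero one_power2 power2_le_imp_le)
qed

lemma functional_ge_one_on_powers:
  assumes "norm a = 1"
  obtains \<phi> where "norm \<phi> \<le> 1" "\<And>n. 1 \<le> Re (cdual_apply \<phi> (pw a n))"
  using cdual_separation[of "convex hull (range (pw a))"] norm_convex_hull_powers[OF assms]
    hull_subset[of "range (pw a)" convex]
  by (metis convex_convex_hull emptyE rangeI subsetD)

end

subsection \<open>Weak* limits in the bidual\<close>

text \<open>The Banach-Alaoglu theorem in terms of filters: a weak* compact ball need not be
  sequentially compact, so the limit is taken along a finer filter instead of a subsequence.\<close>

lemma weak_star_cluster_point:
  fixes X :: "nat \<Rightarrow> 'b::complex_normed_vector cdual"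
  assumes X: "\<And>n. norm (X n) \<le> 1" and F: "F \<noteq> bot"
  obtains G u where "G \<le> F" "G \<noteq> bot" "limitin weak_star_topology X u G" "norm u \<le> 1"
proof -
  define E where "E n = cdual_apply (X n)" for n
  define K where "K = (\<Pi>\<^sub>E x\<in>UNIV. cball (0::complex) (norm (x::'b)))"
  have E_le: "cmod (E n x) \<le> norm x" for n x
    using norm_cdual_apply[of "X n" x] mult_right_mono[OF X[of n] norm_ge_zero[of x]] by (simp add: E_def)
  have "compactin (product_topology (\<lambda>_. euclidean) UNIV) K"
    unfolding K_def compactin_PiE by simp
  then have "compact K" by (metis compactin_euclidean_iff euclidean_product_topology)
  moreover have "filtermap E F \<noteq> bot" using F by (simp add: filtermap_bot_iff)
  moreover have "eventually (\<lambda>f. f \<in> K) (filtermap E F)"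
    unfolding eventually_filtermap K_def using E_le by (intro always_eventually) auto
  ultimately obtain f where f: "f \<in> K" "inf (nhds f) (filtermap E F) \<noteq> bot"
    unfolding compact_filter by blast
  define G where "G = inf F (filtercomap E (nhds f))"
  have "G \<noteq> bot"
  proof
    assume "G = bot"
    then have "eventually (\<lambda>_. False) G" by simp
    then obtain P Q where PQ: "eventually P F" "eventually Q (filtercomap E (nhds f))" "\<And>n. P n \<Longrightarrow> Q n \<Longrightarrow> False"
      unfolding G_def eventually_inf by auto
    then obtain R where R: "eventually R (nhds f)" "\<And>n. R (E n) \<Longrightarrow> Q n"
      unfolding eventually_filtercomap by auto
    have "eventually (\<lambda>g. \<not> R g) (filtermap E F)"
      unfolding eventually_filtermap using PQ(1) by (rule eventually_mono) (use PQ(3) R(2) in blast)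
    with R(1) have "eventually (\<lambda>_. False) (inf (nhds f) (filtermap E F))"
      unfolding eventually_inf by blast
    then show False using f(2) by (simp add: eventually_False)
  qed
  have E_lim: "filterlim E (nhds f) G"
    unfolding G_def by (rule filterlim_mono[OF filterlim_filtercomap order_refl]) simp
  have lim: "((\<lambda>n. E n x) \<longlongrightarrow> f x) G" for x
  proof (rule topological_tendstoI)
    fix U :: "complex set" assume U: "open U" "f x \<in> U"
    have "open ((\<lambda>g. g x) -` U)"
      by (rule open_vimage[OF U(1) continuous_on_product_coordinates])
    then have "\<forall>\<^sub>F n in G. E n \<in> (\<lambda>g. g x) -` U"
      using U(2) E_lim by (intro topological_tendstoD) auto
    then show "\<forall>\<^sub>F n in G. E n x \<in> U" by simp
  qed
  have f_le: "cmod (f x) \<le> norm x" for x using f(1) unfolding K_def by (auto dest: PiE_mem)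
  have f_add: "f (x + y) = f x + f y" for x y
    by (rule tendsto_unique[OF \<open>G \<noteq> bot\<close> lim]) (use tendsto_add[OF lim lim] in \<open>simp add: E_def cdual_apply_vector\<close>)
  have f_scale: "f (c *\<^sub>C x) = c * f x" for c x
    by (rule tendsto_unique[OF \<open>G \<noteq> bot\<close> lim]) (use tendsto_mult_left[OF lim] in \<open>simp add: E_def cdual_apply_vector\<close>)
  have cl: "clinear f" by (simp add: clinear_iff f_add f_scale scaleC_complex_def)
  have bl: "bounded_linear f"
    by (rule bounded_linear_intro[where K = 1]) (auto simp: clinear_simps[OF cl] f_le)
  define u where "u = Abs_cdual (Blinfun f)"
  have Rep: "Rep_cdual u = Blinfun f"
    unfolding u_def by (rule Abs_cdual_inverse) (simp add: bl bounded_linear_Blinfun_apply cl)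
  have ap: "cdual_apply u x = f x" for x
    by (simp add: cdual_apply.rep_eq Rep bl bounded_linear_Blinfun_apply)
  show thesis
  proof
    show "G \<le> F" unfolding G_def by simp
    show "limitin weak_star_topology X u G"
      unfolding limitin_weak_star_iff ap using lim by (simp add: E_def)
    show "norm u \<le> 1"
      unfolding norm_cdual.rep_eq Rep
      by (rule norm_blinfun_bound) (auto simp: bl bounded_linear_Blinfun_apply f_le)
  qed (rule \<open>G \<noteq> bot\<close>)
qed

lemma norm_bidual_embed_le: "norm (bidual_embed x) \<le> norm x"
  unfolding norm_cdual_onorm
  by (rule onorm_bound) (simp_all add: bidual_embed_apply norm_cdual_apply mult.commute[of "norm x"])

lemma clinear_bidual_embed: "clinear bidual_embed"
  unfolding clinear_iff
  by (auto intro!: cdual_eqI simp: bidual_embed_apply cdual_apply_simps cdual_apply_vector)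

lemmas bidual_embed_simps = clinear_simps[OF clinear_bidual_embed]

section \<open>Convergence of the odd powers to the support tripotent\<close>

locale jbstar_triple_with_bidual = jbstar_triple tp
  for tp :: "'a::cbanach \<Rightarrow> 'a \<Rightarrow> 'a \<Rightarrow> 'a" +
  fixes tpb :: "'a cdual cdual \<Rightarrow> 'a cdual cdual \<Rightarrow> 'a cdual cdual \<Rightarrow> 'a cdual cdual"
  assumes bidual_triple: "bidual_triple_product tp tpb"
begin

sublocale bidual: jbstar_triple tpb
  using bidual_triple by (simp add: bidual_triple_product_def)

abbreviation ws :: "'a cdual cdual topology" where "ws \<equiv> weak_star_topology"

lemma tpb_embed: "tpb (bidual_embed x) (bidual_embed y) (bidual_embed z) = bidual_embed (tp x y z)"
  using bidual_triple by (simp add: bidual_triple_product_def)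

lemma tpb_limit:
  assumes "limitin ws X s F"
  shows "limitin ws (\<lambda>i. tpb (X i) u v) (tpb s u v) F"
    "limitin ws (\<lambda>i. tpb u (X i) v) (tpb u s v) F"
    "limitin ws (\<lambda>i. tpb u v (X i)) (tpb u v s) F"
proof -
  have c: "continuous_map ws ws (\<lambda>w. tpb w u v)" "continuous_map ws ws (\<lambda>w. tpb u w v)"
    "continuous_map ws ws (\<lambda>w. tpb u v w)"
    using bidual_triple by (auto simp: bidual_triple_product_def)
  from c[THEN continuous_map_limit, OF assms]
  show "limitin ws (\<lambda>i. tpb (X i) u v) (tpb s u v) F"
    "limitin ws (\<lambda>i. tpb u (X i) v) (tpb u s v) F"
    "limitin ws (\<lambda>i. tpb u v (X i)) (tpb u v s) F"
    by (simp_all add: o_def)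
qed

lemma limitin_ws_const_eq:
  assumes "limitin ws X s F" "\<And>i. X i = t" "F \<noteq> bot"
  shows "s = t"
proof -
  have "limitin ws X t F" unfolding limitin_weak_star_iff assms(2) by simp
  then show ?thesis using limitin_weak_star_unique[OF assms(1) _ assms(3)] by blast
qed

context
  fixes a :: 'a
  assumes a: "norm a = 1"
begin

definition emb_pw :: "nat \<Rightarrow> 'a cdual cdual" where "emb_pw n = bidual_embed (pw a n)"

lemma tpb_emb_pw: "tpb (emb_pw i) (emb_pw j) (emb_pw k) = emb_pw (Suc (i + j + k))"
  by (simp add: emb_pw_def tpb_embed tp_powers del: odd_power.simps)

lemma norm_emb_pw: "norm (emb_pw n) \<le> 1"
  using norm_bidual_embed_le[of "pw a n"] norm_pw_le_one[OF a, of n] by (simp add: emb_pw_def)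

lemma limitin_emb_pw_shift:
  assumes F: "F \<le> sequentially" and s: "limitin ws emb_pw s F"
  shows "limitin ws (\<lambda>n. emb_pw (n + k)) s F"
proof (induction k)
  case (Suc k)
  have "((\<lambda>n. cdual_apply (emb_pw (n + Suc k)) \<phi>) \<longlongrightarrow> cdual_apply s \<phi>) F" for \<phi>
  proof -
    have "(\<lambda>n. pw a (Suc (n + k)) - pw a (n + k)) \<longlonglongrightarrow> 0"
      using LIMSEQ_ignore_initial_segment[OF pw_asymptotically_regular[OF a], of k] .
    then have "(\<lambda>n. cdual_apply \<phi> (pw a (Suc (n + k)) - pw a (n + k))) \<longlonglongrightarrow> 0"
      by (rule bounded_linear.tendsto_zero[OF bounded_linear_cdual_apply])
    then have "((\<lambda>n. cdual_apply \<phi> (pw a (Suc (n + k)) - pw a (n + k))) \<longlongrightarrow> 0) F"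
      by (rule tendsto_mono[OF F])
    moreover have "((\<lambda>n. cdual_apply (emb_pw (n + k)) \<phi>) \<longlongrightarrow> cdual_apply s \<phi>) F"
      using Suc unfolding limitin_weak_star_iff by blast
    ultimately have "((\<lambda>n. cdual_apply (emb_pw (n + k)) \<phi> + cdual_apply \<phi> (pw a (Suc (n + k)) - pw a (n + k)))
        \<longlongrightarrow> cdual_apply s \<phi> + 0) F" by (intro tendsto_add)
    then show ?thesis
      by (simp add: emb_pw_def bidual_embed_apply cdual_apply_vector del: odd_power.simps)
  qed
  then show ?case unfolding limitin_weak_star_iff by blast
qed (use s in simp)

context
  fixes F s
  assumes F: "F \<le> sequentially" "F \<noteq> bot" and s: "limitin ws emb_pw s F"
begin

lemma tpb_emb_emb_cluster: "tpb (emb_pw i) (emb_pw j) s = s"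
proof (rule limitin_weak_star_unique[OF _ _ F(2)])
  show "limitin ws (\<lambda>n. tpb (emb_pw i) (emb_pw j) (emb_pw n)) (tpb (emb_pw i) (emb_pw j) s) F" by (rule tpb_limit[OF s])
  show "limitin ws (\<lambda>n. tpb (emb_pw i) (emb_pw j) (emb_pw n)) s F"
    using limitin_emb_pw_shift[OF F(1) s, of "Suc (i + j)"] by (simp add: tpb_emb_pw add_ac)
qed

lemma tpb_emb_cluster_emb: "tpb (emb_pw i) s (emb_pw j) = s"
proof (rule limitin_weak_star_unique[OF _ _ F(2)])
  show "limitin ws (\<lambda>n. tpb (emb_pw i) (emb_pw n) (emb_pw j)) (tpb (emb_pw i) s (emb_pw j)) F" by (rule tpb_limit[OF s])
  show "limitin ws (\<lambda>n. tpb (emb_pw i) (emb_pw n) (emb_pw j)) s F"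
    using limitin_emb_pw_shift[OF F(1) s, of "Suc (i + j)"] by (simp add: tpb_emb_pw add_ac)
qed

end

text \<open>With only separate weak* continuity at hand, one variable moves at a time. Writing
  \<open>A_i\<close> for \<open>emb_pw i\<close>, \<open>{A_i, A_j, s} = s\<close> becomes
  \<open>{A_i, t, s} = s\<close>, and \<open>{A_i, t, A_j} = t\<close> becomes
  \<open>{s, t, A_j} = t\<close>; the symmetry of the outer variables identifies the two.\<close>

lemma cluster_point_unique:
  assumes F: "F \<le> sequentially" "F \<noteq> bot" and s: "limitin ws emb_pw s F"
    and G: "G \<le> sequentially" "G \<noteq> bot" and t: "limitin ws emb_pw t G"
  shows "s = t" "tpb (emb_pw i) t s = s"
proof -
  show 1: "tpb (emb_pw i) t s = s" for i
    using limitin_ws_const_eq[OF tpb_limit(2)[OF t] tpb_emb_emb_cluster[OF F s] G(2)] .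
  have "tpb s t (emb_pw j) = t" for j
    using limitin_ws_const_eq[OF tpb_limit(1)[OF s] tpb_emb_cluster_emb[OF G t] F(2)] .
  then show "s = t" using 1 bidual.symmetric_tp by metis
qed

lemma odd_powers_converge:
  obtains s where "limitin ws emb_pw s sequentially" "norm s \<le> 1"
proof -
  obtain G s where G: "G \<le> sequentially" "G \<noteq> bot" "limitin ws emb_pw s G" "norm s \<le> 1"
    by (rule weak_star_cluster_point[OF norm_emb_pw sequentially_bot])
  have "(\<lambda>n. cdual_apply (emb_pw n) \<phi>) \<longlonglongrightarrow> cdual_apply s \<phi>" for \<phi>
  proof (rule ccontr)
    assume "\<not> ?thesis"
    then obtain \<epsilon> where \<epsilon>: "\<epsilon> > 0"
      "\<not> (\<forall>\<^sub>F n in sequentially. dist (cdual_apply (emb_pw n) \<phi>) (cdual_apply s \<phi>) < \<epsilon>)"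
      unfolding tendsto_iff by blast
    \<comment> \<open>The powers with indices in \<open>N\<close> have a cluster point of their own;
      by uniqueness it is \<open>s\<close>, although their values at \<open>\<phi>\<close> stay away
      from that of \<open>s\<close>.\<close>
    define N where "N = {n. \<not> dist (cdual_apply (emb_pw n) \<phi>) (cdual_apply s \<phi>) < \<epsilon>}"
    have "inf sequentially (principal N) \<noteq> bot"
      using \<epsilon>(2) unfolding trivial_limit_def eventually_inf_principal N_def by simp
    then obtain F t where F: "F \<le> inf sequentially (principal N)" "F \<noteq> bot" "limitin ws emb_pw t F"
      by (rule weak_star_cluster_point[OF norm_emb_pw])
    then have "t = s" using cluster_point_unique(1)[OF _ F(2,3) G(1,2,3)] by simp
    then have "((\<lambda>n. cdual_apply (emb_pw n) \<phi>) \<longlongrightarrow> cdual_apply s \<phi>) F"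
      using F(3) unfolding limitin_weak_star_iff by blast
    then have "\<forall>\<^sub>F n in F. dist (cdual_apply (emb_pw n) \<phi>) (cdual_apply s \<phi>) < \<epsilon>"
      using \<epsilon>(1) by (rule tendstoD)
    moreover have "\<forall>\<^sub>F n in F. n \<in> N"
      using F(1) by (simp add: le_principal)
    ultimately have "\<forall>\<^sub>F n in F. False" by eventually_elim (simp add: N_def)
    then show False using F(2) by (simp add: eventually_False)
  qed
  then show thesis using that G(4) unfolding limitin_weak_star_iff by blast
qed

lemma support_tripotent_properties:
  defines "s \<equiv> support_tripotent tp a"
  shows "tripotent tpb s" "tpb s s (bidual_embed a) = s" "norm s = 1"
proof -
  obtain t where t: "limitin ws emb_pw t sequentially" "norm t \<le> 1" by (rule odd_powers_converge)
  then have st: "s = t" unfolding s_def emb_pw_def by (intro support_tripotent_eqI)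
  note s = t[folded st]
  have seq: "sequentially \<le> sequentially" by simp
  have As: "tpb (emb_pw i) s s = s" for i
    by (rule cluster_point_unique(2)[OF seq sequentially_bot s(1) seq sequentially_bot s(1)])
  show "tripotent tpb s"
    unfolding tripotent_def
    by (rule limitin_ws_const_eq[OF tpb_limit(1)[OF s(1)] As sequentially_bot])
  show "tpb s s (bidual_embed a) = s"
    using As[of 0] bidual.symmetric_tp by (metis emb_pw_def odd_power.simps(1))
  obtain \<phi> where \<phi>: "norm \<phi> \<le> 1" "\<And>n. 1 \<le> Re (cdual_apply \<phi> (pw a n))"
    using functional_ge_one_on_powers[OF a] by blast
  have "(\<lambda>n. Re (cdual_apply (emb_pw n) \<phi>)) \<longlonglongrightarrow> Re (cdual_apply s \<phi>)"
    using s(1) unfolding limitin_weak_star_iff by (intro tendsto_Re) blast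
  then have "1 \<le> Re (cdual_apply s \<phi>)"
    by (rule LIMSEQ_le_const) (use \<phi>(2) in \<open>auto simp: emb_pw_def bidual_embed_apply\<close>)
  also have "\<dots> \<le> norm s * norm \<phi>" using complex_Re_le_cmod norm_cdual_apply order_trans by blast
  also have "\<dots> \<le> norm s * 1" using \<phi>(1) by (intro mult_left_mono) auto
  finally show "norm s = 1" using s(2) by simp
qed

end

end

subsection \<open>Peirce projections and numerical range\<close>

lemma op_exp_eigenvector:
  fixes A :: "'a::cbanach \<Rightarrow> 'a"
  assumes A: "clinear A" "bounded_linear A" and v: "A v = l *\<^sub>R v"
  shows "op_exp (\<lambda>y. z *\<^sub>C A y) v = exp (z * of_real l) *\<^sub>C v"
proof (rule sums_unique2[OF op_exp_scaled_sums(1)[OF A]])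
  have pow: "(A ^^ n) v = l ^ n *\<^sub>R v" for n
    by (induction n) (simp_all add: clinear_simps[OF A(1)] v)
  have "bounded_linear (\<lambda>c. c *\<^sub>C v)"
    by (rule bounded_linear_intro[where K = "norm v"])
      (auto simp: scaleC_add_left norm_scaleC scaleR_conv_of_real scaleC_scaleC[symmetric] scaleC_of_real)
  then have "(\<lambda>n. ((z * of_real l) ^ n /\<^sub>R fact n) *\<^sub>C v) sums (exp (z * of_real l) *\<^sub>C v)"
    using exp_converges by (rule bounded_linear.sums)
  moreover have "((z * of_real l) ^ n /\<^sub>R fact n) *\<^sub>C v = (z ^ n / fact n) *\<^sub>C (A ^^ n) v" for n
  proof -
    have "(z * of_real l) ^ n /\<^sub>R fact n = z ^ n / fact n * of_real (l ^ n)"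
      by (simp add: power_mult_distrib scaleR_conv_of_real divide_inverse mult_ac)
    then show ?thesis by (simp only: pow scaleC_scaleC[symmetric] scaleC_of_real)
  qed
  ultimately show "(\<lambda>n. (z ^ n / fact n) *\<^sub>C (A ^^ n) v) sums (exp (z * of_real l) *\<^sub>C v)" by simp
qed

lemma op_exp_add:
  fixes A :: "'a::cbanach \<Rightarrow> 'a"
  assumes A: "clinear A" "bounded_linear A"
  shows "op_exp (\<lambda>y. z *\<^sub>C A y) (u + v) = op_exp (\<lambda>y. z *\<^sub>C A y) u + op_exp (\<lambda>y. z *\<^sub>C A y) v"
proof (rule sums_unique2[OF op_exp_scaled_sums(1)[OF A]])
  show "(\<lambda>n. (z ^ n / fact n) *\<^sub>C (A ^^ n) (u + v)) sums
      (op_exp (\<lambda>y. z *\<^sub>C A y) u + op_exp (\<lambda>y. z *\<^sub>C A y) v)"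
    using sums_add[OF op_exp_scaled_sums(1)[OF A, of z u] op_exp_scaled_sums(1)[OF A, of z v]]
    by (simp add: clinear_simps[OF clinear_funpow[OF A(1)]] scaleC_add_right)
qed

text \<open>By convexity, a loss \<open>c\<close> at \<open>t\<close> forces a loss of at least
  \<open>l c\<close> at \<open>l t\<close>, which exceeds \<open>C (l t)^2\<close> for small
  \<open>l\<close>.\<close>

lemma norm_nondecreasing_if_quadratic_bound:
  fixes u v :: "'a::real_normed_vector"
  assumes C: "C \<ge> 0" and le: "\<And>t. 0 < t \<Longrightarrow> t < 1 \<Longrightarrow> norm u - C * t\<^sup>2 \<le> norm (u + t *\<^sub>R v)"
    and t: "t > 0"
  shows "norm u \<le> norm (u + t *\<^sub>R v)"
proof (rule ccontr)
  define c where "c = norm u - norm (u + t *\<^sub>R v)"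
  assume "\<not> ?thesis"
  then have c: "c > 0" by (simp add: c_def)
  \<comment> \<open>Large enough for \<open>l = 1 / d\<close> to satisfy \<open>l < 1\<close>,
    \<open>l t < 1\<close> and \<open>C l t^2 < c\<close>.\<close>
  define d where "d = 1 + t + C * t\<^sup>2 / c"
  define l where "l = 1 / d"
  have Ct: "C * t\<^sup>2 / c \<ge> 0" using C c by simp
  have d: "d > 1" "d > t" using Ct t by (simp_all add: d_def add_pos_nonneg)
  have l: "0 < l" "l < 1" "l * t < 1" using d t by (simp_all add: l_def)
  have "u + (l * t) *\<^sub>R v = (1 - l) *\<^sub>R u + l *\<^sub>R (u + t *\<^sub>R v)" by (simp add: algebra_simps)
  then have "norm (u + (l * t) *\<^sub>R v) \<le> (1 - l) * norm u + l * norm (u + t *\<^sub>R v)"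
    using l norm_triangle_ineq[of "(1 - l) *\<^sub>R u" "l *\<^sub>R (u + t *\<^sub>R v)"] by simp
  also have "\<dots> = norm u - l * c" by (simp add: c_def algebra_simps)
  finally have "l * c \<le> C * (l * t)\<^sup>2" using le[of "l * t"] l t by simp
  then have "c \<le> C * t\<^sup>2 * l" using l(1) by (simp add: power2_eq_square field_simps)
  then have "c * d \<le> C * t\<^sup>2" using d by (simp add: l_def field_simps)
  moreover have "c * d = c + c * t + C * t\<^sup>2" using c by (simp add: d_def field_simps)
  ultimately show False using c t by (smt (verit) mult_pos_pos)
qed

text \<open>The isometry \<open>exp (i r t A)\<close> sends \<open>v\<close> to
  \<open>v + t w\<close> up to an error of order \<open>t^2\<close>, which the previous lemma
  removes. This is the norm form of the statement that the numerical range of \<open>A\<close> is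
  real.\<close>

lemma hermitian_op_expansive:
  fixes A :: "'a::cbanach \<Rightarrow> 'a"
  assumes herm: "hermitian_op A"
  shows "norm v \<le> norm (v + (\<i> * of_real r) *\<^sub>C A v)"
proof -
  have A: "clinear A" "bounded_linear A"
    and iso: "norm (op_exp (\<lambda>y. (\<i> * of_real t) *\<^sub>C A y) x) = norm x" for t x
    using herm unfolding hermitian_op_def by auto
  define w where "w = (\<i> * of_real r) *\<^sub>C A v"
  define g where "g n = norm (((\<i> * of_real r) ^ (n + 2) / fact (n + 2)) *\<^sub>C (A ^^ (n + 2)) v)" for n
  define C where "C = suminf g"
  have summ_g: "summable g"
    unfolding g_def using op_exp_scaled_sums(2)[OF A, of "\<i> * of_real r" v]
    by (rule summable_ignore_initial_segment)
  have C: "C \<ge> 0" unfolding C_def by (intro suminf_nonneg summ_g) (simp add: g_def)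
  have "norm v - C * t\<^sup>2 \<le> norm (v + t *\<^sub>R w)" if t: "0 < t" "t < 1" for t
  proof -
    define z where "z = \<i> * of_real (r * t)"
    define f where "f n = (z ^ n / fact n) *\<^sub>C (A ^^ n) v" for n
    have f: "f sums op_exp (\<lambda>y. z *\<^sub>C A y) v" unfolding f_def by (rule op_exp_scaled_sums(1)[OF A])
    have "f 0 + f 1 = v + t *\<^sub>R w"
      by (simp add: f_def w_def z_def scaleC_of_real[symmetric] scaleC_scaleC mult_ac)
    then have rest: "(\<lambda>n. f (n + 2)) sums (op_exp (\<lambda>y. z *\<^sub>C A y) v - (v + t *\<^sub>R w))"
      using sums_split_initial_segment[OF f, of 2] by (simp add: numeral_2_eq_2)
    have "norm (f (n + 2)) \<le> t\<^sup>2 * g n" for n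
    proof -
      have "norm (f (n + 2)) = t ^ (n + 2) * g n"
        using t by (simp add: f_def g_def z_def norm_scaleC norm_divide norm_mult norm_power
            power_mult_distrib del: funpow.simps fact_Suc power_Suc)
      also have "t ^ (n + 2) \<le> t\<^sup>2" using t by (intro power_decreasing) auto
      finally show ?thesis by (simp add: g_def mult_right_mono)
    qed
    then have "norm (suminf (\<lambda>n. f (n + 2))) \<le> (\<Sum>n. t\<^sup>2 * g n)"
      by (intro norm_suminf_le summable_mult summ_g)
    then have "norm (op_exp (\<lambda>y. z *\<^sub>C A y) v - (v + t *\<^sub>R w)) \<le> C * t\<^sup>2"
      using rest suminf_mult[OF summ_g, of "t\<^sup>2"] by (simp add: sums_iff C_def mult.commute[of "suminf g"])
    moreover have "norm (op_exp (\<lambda>y. z *\<^sub>C A y) v) = norm v" unfolding z_def by (rule iso)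
    ultimately show ?thesis
      using norm_triangle_sub[of "op_exp (\<lambda>y. z *\<^sub>C A y) v" "v + t *\<^sub>R w"] by simp
  qed
  from norm_nondecreasing_if_quadratic_bound[OF C this, of 1]
  show ?thesis by (simp add: w_def)
qed

section \<open>The Peirce-2 projection of a tripotent and its skew elements\<close>

context jbstar_triple
begin

context
  fixes s
  assumes s: "tripotent tp s"
begin

lemma pw_tripotent: "pw s n = s"
  using s by (induction n) (simp_all add: tripotent_def)

lemma PL_tripotent: "PL s n = tp s s"
  by (simp add: PL_def fun_eq_iff pw_tripotent)

lemma Q_squared_tripotent: "tp s (tp s y s) s = 2 *\<^sub>R tp s s (tp s s y) - tp s s y"
  using Q_squared[of s y] by (simp add: PL_tripotent)

lemma tripotent_cubic: "tp s s y + 2 *\<^sub>R tp s s (tp s s (tp s s y)) = 3 *\<^sub>R tp s s (tp s s y)"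
  using PL_2[of s y] unfolding PL_tripotent by (simp only: eq_diff_eq)

lemma L_Q_squared_tripotent: "tp s s (tp s (tp s y s) s) = tp s (tp s y s) s"
  unfolding Q_squared_tripotent tp_right using tripotent_cubic[of y]
  by (simp add: scaleR_3 scaleR_2 algebra_simps)

text \<open>The Peirce projection is an average of isometries \<open>exp (i \<theta> L(s, s))\<close> over cube roots
  of unity, because \<open>L(s, s)\<close> has eigenvalues \<open>0, 1/2, 1\<close>.\<close>

lemma norm_Q_squared_le: "norm (tp s (tp s w s) s) \<le> norm w"
proof -
  define L where "L = tp s s"
  have L: "clinear L" "bounded_linear L"
    and iso: "norm (op_exp (\<lambda>y. (\<i> * of_real t) *\<^sub>C L y) x) = norm x" for t x
    using hermitian_L[of s] unfolding hermitian_op_def L_def by auto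
  note lin = clinear_simps[OF L(1)]
  have cubic: "2 *\<^sub>R L (L (L y)) = 3 *\<^sub>R L (L y) - L y" for y
    using tripotent_cubic[of y] by (simp add: L_def eq_diff_eq add.commute)
  \<comment> \<open>By \<open>cubic\<close> the eigenvalues satisfy
    \<open>\<lambda> (2 \<lambda> - 1) (\<lambda> - 1) = 0\<close>; the Lagrange polynomials
    \<open>\<lambda> (2 \<lambda> - 1)\<close> and \<open>4 \<lambda> (1 - \<lambda>)\<close> cut
    out the components at 1 and at 1/2.\<close>
  define v2 where "v2 = 2 *\<^sub>R L (L w) - L w"
  define v1 where "v1 = 4 *\<^sub>R L w - 4 *\<^sub>R L (L w)"
  define v0 where "v0 = w - v2 - v1"
  have L2: "L v2 = 1 *\<^sub>R v2"
    unfolding v2_def lin cubic by (simp add: scaleR_3 scaleR_2)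
  have four: "4 *\<^sub>R u = 2 *\<^sub>R (2 *\<^sub>R u)" for u :: 'a by simp
  have L1: "L v1 = (1/2) *\<^sub>R v1"
  proof -
    have "L v1 = 4 *\<^sub>R L (L w) - 2 *\<^sub>R (3 *\<^sub>R L (L w) - L w)"
      unfolding v1_def lin four[of "L (L (L w))"] cubic ..
    also have "\<dots> = (1/2) *\<^sub>R v1"
      using scaleR_add_left[of 4 2 "L (L w)"] by (simp add: v1_def scaleR_diff_right algebra_simps)
    finally show ?thesis .
  qed
  have L0: "L v0 = 0 *\<^sub>R v0"
    unfolding v0_def lin L2 L1
    using scaleR_add_left[of 2 2 "L w"] by (simp add: v1_def v2_def scaleR_diff_right scaleR_2)
  have eigen: "norm (exp (\<i> * of_real t) *\<^sub>C v2 + exp (\<i> * of_real (t / 2)) *\<^sub>C v1 + v0) = norm w" for t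
  proof -
    have "op_exp (\<lambda>y. (\<i> * of_real t) *\<^sub>C L y) w
        = exp (\<i> * of_real t) *\<^sub>C v2 + exp (\<i> * of_real (t / 2)) *\<^sub>C v1 + v0"
    proof -
      have w: "w = v2 + v1 + v0" by (simp add: v0_def)
      show ?thesis
        by (subst w)
          (simp add: op_exp_add[OF L] op_exp_eigenvector[OF L L2] op_exp_eigenvector[OF L L1]
            op_exp_eigenvector[OF L L0])
    qed
    then show ?thesis using iso[of t w] by simp
  qed
  define \<omega> where "\<omega> = cis (2 * pi / 3)"
  have w3: "\<omega> ^ 3 = 1" unfolding \<omega>_def using Complex.DeMoivre[of "2 * pi / 3" 3] by simp
  have w_ne: "\<omega> \<noteq> 1"
  proof
    assume "\<omega> = 1"
    then have "cos (2 * pi / 3) = 1" by (simp add: \<omega>_def complex_eq_iff)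
    then show False by (simp add: cos_120)
  qed
  have w_sum: "1 + \<omega> + \<omega>\<^sup>2 = 0"
  proof -
    have "(\<omega> - 1) * (1 + \<omega> + \<omega>\<^sup>2) = \<omega> ^ 3 - 1" by (simp add: power2_eq_square power3_eq_cube algebra_simps)
    then show ?thesis using w3 w_ne by simp
  qed
  have norm_w: "cmod \<omega> = 1" by (simp add: \<omega>_def)
  have g: "norm ((\<omega> ^ k)\<^sup>2 *\<^sub>C v2 + \<omega> ^ k *\<^sub>C v1 + v0) = norm w" for k
  proof -
    have k: "\<omega> ^ k = cis (real k * (2 * pi / 3))" by (simp only: \<omega>_def Complex.DeMoivre)
    then have "\<omega> ^ k = exp (\<i> * of_real (2 * (real k * (2 * pi / 3)) / 2))"
      by (simp add: cis_conv_exp mult_ac)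
    moreover have "(\<omega> ^ k)\<^sup>2 = exp (\<i> * of_real (2 * (real k * (2 * pi / 3))))"
      unfolding k by (simp only: Complex.DeMoivre) (simp add: cis_conv_exp mult_ac)
    ultimately show ?thesis using eigen[of "2 * (real k * (2 * pi / 3))"] by simp
  qed
  \<comment> \<open>The factor \<open>\<omega>^k\<close> turns the coefficient of \<open>v2\<close>
    into \<open>\<omega>^(3 k) = 1\<close>, while those of \<open>v1\<close> and \<open>v0\<close>
    run through all cube roots of unity and cancel in the sum.\<close>
  define u where "u k = \<omega> ^ k *\<^sub>C ((\<omega> ^ k)\<^sup>2 *\<^sub>C v2 + \<omega> ^ k *\<^sub>C v1 + v0)" for k
  have "u 0 + u 1 + u 2 = 3 *\<^sub>R v2"
  proof -
    have w4: "\<omega> * \<omega>\<^sup>2 = 1" "\<omega>\<^sup>2 * \<omega> = 1" "\<omega> * \<omega> = \<omega>\<^sup>2" "\<omega> ^ 4 = \<omega>" "\<omega> ^ 6 = 1"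
      using w3 power_add[of \<omega> 3 1] power_add[of \<omega> 3 3]
      by (simp_all add: power2_eq_square power3_eq_cube mult.assoc)
    have "u 0 + u 1 + u 2 = (v2 + v2 + v2) + (1 + \<omega> + \<omega>\<^sup>2) *\<^sub>C v1 + (1 + \<omega> + \<omega>\<^sup>2) *\<^sub>C v0"
      by (simp add: u_def scaleC_add_right scaleC_scaleC scaleC_add_left w4)
    then show ?thesis by (simp add: w_sum scaleR_3)
  qed
  then have "3 * norm v2 = norm (u 0 + u 1 + u 2)" by simp
  also have "\<dots> \<le> norm (u 0) + norm (u 1) + norm (u 2)"
    by (intro norm_triangle_le add_mono norm_triangle_ineq) auto
  also have "\<dots> = 3 * norm w" by (simp only: u_def norm_scaleC norm_power norm_w g) simp
  finally have "norm v2 \<le> norm w" by simp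
  then show ?thesis by (simp add: Q_squared_tripotent v2_def L_def)
qed

text \<open>The polarization formula writes the skew element \<open>x\<close> as \<open>i/4\<close> times the difference of two
  hermitian operators applied to \<open>s\<close>.\<close>

lemma norm_tripotent_minus_skew:
  assumes x: "tp s s x = x" "tp s x s = - x"
  shows "\<exists>C\<ge>0. \<forall>t. norm s - C * t\<^sup>2 \<le> norm (s - t *\<^sub>R x)"
proof -
  define H1 where "H1 = tp (x + \<i> *\<^sub>C s) (x + \<i> *\<^sub>C s)"
  define H2 where "H2 = tp (x - \<i> *\<^sub>C s) (x - \<i> *\<^sub>C s)"
  have sss: "tp s s s = s" using s by (simp add: tripotent_def)
  have xss: "tp x s s = x" using x(1) symmetric_tp by metis
  have H1s: "H1 s = (tp x x s + s) - 2 *\<^sub>R (\<i> *\<^sub>C x)"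
    unfolding H1_def by (simp add: tp_left tp_middle x xss sss scaleC_add_right scaleC_diff_right scaleC_scaleC scaleR_2)
  have H2s: "H2 s = (tp x x s + s) + 2 *\<^sub>R (\<i> *\<^sub>C x)"
    unfolding H2_def by (simp add: tp_left tp_middle x xss sss scaleC_add_right scaleC_diff_right scaleC_scaleC scaleR_2)
  have lin1: "H1 (u + v) = H1 u + H1 v" "H1 (c *\<^sub>C u) = c *\<^sub>C H1 u" for u v c
    unfolding H1_def by (simp_all add: tp_right)
  have "norm s - (norm (H1 (H2 s)) / 16) * t\<^sup>2 \<le> norm (s - t *\<^sub>R x)" for t
  proof -
    \<comment> \<open>As \<open>(H2 - H1) s = 4 i x\<close>, applying \<open>1 + i r H2\<close> and
      then \<open>1 - i r H1\<close> to \<open>s\<close> gives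
      \<open>s - 4 r x + r^2 H1 (H2 s)\<close>. Neither factor decreases norms, and
      \<open>r^2 = t^2 / 16\<close> explains the constant.\<close>
    define r where "r = t / 4"
    define v where "v = s + (\<i> * of_real r) *\<^sub>C H2 s"
    have "norm s \<le> norm v"
      unfolding v_def H2_def by (rule hermitian_op_expansive[OF hermitian_L])
    also have "\<dots> \<le> norm (v + (\<i> * of_real (- r)) *\<^sub>C H1 v)"
      unfolding H1_def by (rule hermitian_op_expansive[OF hermitian_L])
    also have "v + (\<i> * of_real (- r)) *\<^sub>C H1 v = (s - t *\<^sub>R x) + (r\<^sup>2) *\<^sub>R H1 (H2 s)"
    proof -
      have "v + (\<i> * of_real (- r)) *\<^sub>C H1 v
          = s + (\<i> * of_real r) *\<^sub>C (H2 s - H1 s) + (of_real (r\<^sup>2)) *\<^sub>C H1 (H2 s)"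
        by (simp add: v_def lin1 scaleC_add_right scaleC_diff_right scaleC_scaleC power2_eq_square mult_ac
            algebra_simps)
      also have "H2 s - H1 s = (4 * \<i>) *\<^sub>C x"
      proof -
        have "H2 s - H1 s = (2 + 2) *\<^sub>R (\<i> *\<^sub>C x)"
          unfolding H1s H2s scaleR_add_left by simp
        also have "\<dots> = of_real 4 *\<^sub>C (\<i> *\<^sub>C x)" unfolding scaleC_of_real by simp
        finally show ?thesis by (simp add: scaleC_scaleC)
      qed
      also have "(\<i> * of_real r) *\<^sub>C (4 * \<i>) *\<^sub>C x = - (t *\<^sub>R x)"
      proof -
        have "(\<i> * of_real r) * (4 * \<i>) = of_real (- t)"
          by (simp add: r_def complex_eq_iff)
        then show ?thesis unfolding scaleC_scaleC by (simp only: scaleC_of_real) simp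
      qed
      also have "of_real (r\<^sup>2) *\<^sub>C H1 (H2 s) = (r\<^sup>2) *\<^sub>R H1 (H2 s)" by (rule scaleC_of_real)
      finally show ?thesis by simp
    qed
    also have "norm \<dots> \<le> norm (s - t *\<^sub>R x) + norm ((r\<^sup>2) *\<^sub>R H1 (H2 s))" by (rule norm_triangle_ineq)
    finally show ?thesis by (simp add: r_def power_divide mult.commute)
  qed
  then show ?thesis by (intro exI[of _ "norm (H1 (H2 s)) / 16"]) simp
qed

end

end

subsection \<open>The closed graph theorem\<close>

text \<open>By Baire's theorem some \<open>closure (B n)\<close> contains a ball. Taking differences
  and scaling, every \<open>x\<close> is within half its norm of some \<open>z\<close> with
  \<open>T z\<close> under control. Repeating this with the remainders expresses \<open>x\<close> as
  a series whose image under \<open>T\<close> converges geometrically, and closedness identifies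
  that sum with \<open>T x\<close>.\<close>

lemma closed_graph_bounded:
  fixes T :: "'a::banach \<Rightarrow> 'b::banach"
  assumes T: "linear T"
    and closed: "\<And>X x y. X \<longlonglongrightarrow> x \<Longrightarrow> (\<lambda>n. T (X n)) \<longlonglongrightarrow> y \<Longrightarrow> T x = y"
  shows "bounded_linear T"
proof -
  define B where "B n = {x. norm (T x) \<le> real n}" for n
  have "\<exists>n. interior (closure (B n)) \<noteq> {}"
  proof (rule ccontr)
    assume "\<not> ?thesis"
    then have "Met_TC.mtopology interior_of \<Union>(range (\<lambda>n. closure (B n))) = {}"
      by (intro Met_TC.metric_Baire_category_alt) (auto simp: complete_UNIV)
    moreover have "\<Union>(range (\<lambda>n. closure (B n))) = UNIV"
    proof -
      have "x \<in> B (nat \<lceil>norm (T x)\<rceil>)" for x unfolding B_def by (simp add: real_nat_ceiling_ge)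
      then show ?thesis using closure_subset by blast
    qed
    ultimately show False by simp
  qed
  then obtain n x0 where "x0 \<in> interior (closure (B n))" by blast
  then obtain \<delta> where \<delta>: "\<delta> > 0" "cball x0 \<delta> \<subseteq> closure (B n)"
    using mem_interior_cball by blast
  have approx: "\<exists>z. norm (x - z) \<le> \<delta> / 2 \<and> norm (T z) \<le> 2 * real n" if "norm x \<le> \<delta>" for x
  proof -
    have "x0 + x \<in> closure (B n)" "x0 \<in> closure (B n)"
      using that \<delta> by (auto simp: dist_norm subset_eq)
    then obtain u v where u: "u \<in> B n" "dist u (x0 + x) < \<delta> / 4" and v: "v \<in> B n" "dist v x0 < \<delta> / 4"
      using \<delta>(1) unfolding closure_approachable by (metis zero_less_divide_iff zero_less_numeral)
    have "x - (u - v) = (v - x0) - (u - (x0 + x))" by simp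
    then have "norm (x - (u - v)) \<le> norm (v - x0) + norm (u - (x0 + x))" by (metis norm_triangle_ineq4)
    then have "norm (x - (u - v)) \<le> \<delta> / 2" using u v by (simp add: dist_norm)
    moreover have "norm (T (u - v)) \<le> 2 * real n"
      using u v norm_triangle_ineq4[of "T u" "T v"] by (simp add: B_def linear_diff[OF T])
    ultimately show ?thesis by blast
  qed
  define K where "K = 2 * real n / \<delta>"
  have K: "K \<ge> 0" using \<delta> by (simp add: K_def)
  have "\<exists>z. norm (x - z) \<le> norm x / 2 \<and> norm (T z) \<le> K * norm x" for x
  proof (cases "x = 0")
    case True
    then show ?thesis by (intro exI[of _ 0]) (simp add: linear_0[OF T])
  next
    case False
    define r where "r = \<delta> / norm x"
    have r: "r > 0" "r * norm x = \<delta>" using False \<delta> by (auto simp: r_def)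
    obtain z where z: "norm (r *\<^sub>R x - z) \<le> \<delta> / 2" "norm (T z) \<le> 2 * real n"
      using approx[of "r *\<^sub>R x"] r by auto
    have "x - (1/r) *\<^sub>R z = (1/r) *\<^sub>R (r *\<^sub>R x - z)" using r by (simp add: scaleR_diff_right)
    then have "norm (x - (1/r) *\<^sub>R z) = (1/r) * norm (r *\<^sub>R x - z)" using r by simp
    also have "\<dots> \<le> (1/r) * (\<delta> / 2)" using z r by (intro mult_left_mono) auto
    also have "\<dots> = norm x / 2" using \<delta> by (simp add: r_def)
    finally have "norm (x - (1/r) *\<^sub>R z) \<le> norm x / 2" .
    moreover have "norm (T ((1/r) *\<^sub>R z)) \<le> K * norm x"
    proof -
      have "norm (T ((1/r) *\<^sub>R z)) = (1/r) * norm (T z)" using r by (simp add: linear_scale[OF T])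
      also have "\<dots> \<le> (1/r) * (2 * real n)" using z r by (intro mult_left_mono) auto
      finally show ?thesis by (simp add: K_def r_def mult.commute)
    qed
    ultimately show ?thesis by blast
  qed
  then obtain z where z: "\<And>x. norm (x - z x) \<le> norm x / 2" "\<And>x. norm (T (z x)) \<le> K * norm x" by metis
  have "norm (T x) \<le> norm x * (2 * K)" for x
  proof -
    define r where "r k = ((\<lambda>y. y - z y) ^^ k) x" for k
    have r_Suc: "r (Suc k) = r k - z (r k)" for k by (simp add: r_def)
    have r_le: "norm (r k) \<le> norm x * (1/2) ^ k" for k
    proof (induction k)
      case (Suc k)
      then show ?case using z(1)[of "r k"] by (simp add: r_Suc)
    qed (simp add: r_def)
    have sum: "(\<Sum>k<n. z (r k)) = x - r n" for n
      by (induction n) (simp_all add: r_Suc, simp add: r_def)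
    have geo: "(\<lambda>k. K * (norm x * (1/2) ^ k)) sums (K * (norm x * 2))"
      using geometric_sums[of "1/2::real"] by (intro sums_mult) simp
    have T_le: "norm (T (z (r k))) \<le> K * (norm x * (1/2) ^ k)" for k
      using z(2)[of "r k"] mult_left_mono[OF r_le[of k] K] by simp
    have summ: "summable (\<lambda>k. T (z (r k)))"
      using T_le by (intro summable_comparison_test'[OF sums_summable[OF geo], of 0]) auto
    have "(\<lambda>n. norm x * (1/2) ^ n) \<longlonglongrightarrow> norm x * 0"
      by (intro tendsto_intros LIMSEQ_realpow_zero) auto
    then have "r \<longlonglongrightarrow> 0"
      by (intro Lim_null_comparison[of r "\<lambda>n. norm x * (1/2) ^ n"] always_eventually) (use r_le in auto)
    then have "(\<lambda>n. x - r n) \<longlonglongrightarrow> x - 0" by (intro tendsto_intros)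
    then have "(\<lambda>n. \<Sum>k<n. z (r k)) \<longlonglongrightarrow> x" by (simp add: sum)
    moreover have "(\<lambda>n. T (\<Sum>k<n. z (r k))) \<longlonglongrightarrow> (\<Sum>k. T (z (r k)))"
      using summable_LIMSEQ[OF summ] by (simp add: linear_sum[OF T])
    ultimately have "T x = (\<Sum>k. T (z (r k)))" by (rule closed)
    moreover have "norm (\<Sum>k. T (z (r k))) \<le> (\<Sum>k. K * (norm x * (1/2) ^ k))"
      by (rule norm_suminf_le[OF T_le sums_summable[OF geo]])
    ultimately show ?thesis using geo by (simp add: sums_iff mult_ac)
  qed
  then show ?thesis
    by (intro bounded_linear_intro[where K = "2 * K"]) (simp_all add: linear_add[OF T] linear_scale[OF T])
qed

text \<open>If \<open>X n\<close> tends to 0 and \<open>T (X n)\<close> to \<open>y\<close>, the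
  inequality for \<open>X n + t y\<close> becomes \<open>t |y| <= t^2 |T y|\<close> in the limit.
  Dividing by \<open>t\<close> and letting \<open>t\<close> tend to 0 gives \<open>y = 0\<close>, so
  the graph is closed.\<close>

lemma bounded_if_norm_nondecreasing:
  fixes T :: "'a::banach \<Rightarrow> 'a"
  assumes T: "linear T" and ge: "\<And>a t. t > 0 \<Longrightarrow> norm a \<le> norm (a - t *\<^sub>R T a)"
  shows "bounded_linear T"
proof (rule closed_graph_bounded[OF T])
  have null: "y = 0" if X: "X \<longlonglongrightarrow> 0" and TX: "(\<lambda>n. T (X n)) \<longlonglongrightarrow> y" for X y
  proof -
    have "norm y \<le> t * norm (T y)" if t: "t > 0" for t
    proof -
      have "norm (0 + t *\<^sub>R y) \<le> norm (0 + t *\<^sub>R y - t *\<^sub>R (y + t *\<^sub>R T y))"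
      proof (rule LIMSEQ_le)
        show "(\<lambda>n. norm (X n + t *\<^sub>R y)) \<longlonglongrightarrow> norm (0 + t *\<^sub>R y)" by (intro tendsto_intros X)
        show "(\<lambda>n. norm (X n + t *\<^sub>R y - t *\<^sub>R (T (X n) + t *\<^sub>R T y)))
            \<longlonglongrightarrow> norm (0 + t *\<^sub>R y - t *\<^sub>R (y + t *\<^sub>R T y))"
          by (intro tendsto_intros X TX)
        show "\<exists>N. \<forall>n\<ge>N. norm (X n + t *\<^sub>R y) \<le> norm (X n + t *\<^sub>R y - t *\<^sub>R (T (X n) + t *\<^sub>R T y))"
          using ge[OF t, of "X n + t *\<^sub>R y" for n] by (simp add: linear_add[OF T] linear_scale[OF T])
      qed
      also have "0 + t *\<^sub>R y - t *\<^sub>R (y + t *\<^sub>R T y) = - ((t * t) *\<^sub>R T y)"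
        by (simp add: scaleR_add_right)
      finally show ?thesis using t by simp
    qed
    moreover have "((\<lambda>t. t * norm (T y)) \<longlongrightarrow> 0 * norm (T y)) (at_right 0)"
      by (intro tendsto_intros)
    ultimately have "norm y \<le> 0 * norm (T y)"
      by (intro tendsto_lowerbound[of "\<lambda>t. t * norm (T y)" _ "at_right 0"])
        (auto simp: eventually_at_right_field intro!: exI[of _ 1])
    then show ?thesis by simp
  qed
  fix X x y assume "X \<longlonglongrightarrow> x" "(\<lambda>n. T (X n)) \<longlonglongrightarrow> y"
  then have "(\<lambda>n. X n - x) \<longlonglongrightarrow> 0" "(\<lambda>n. T (X n - x)) \<longlonglongrightarrow> y - T x"
    unfolding linear_diff[OF T] by (auto intro: LIM_zero tendsto_diff)
  then have "y - T x = 0" by (rule null)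
  then show "T x = y" by simp
qed

subsection \<open>Dissipativity\<close>

context jbstar_triple_with_bidual
begin

lemma norm_minus_le_if_skew_at_support:
  assumes a: "norm a = 1" and t: "t > 0"
    and skew: "P2_op tpb (support_tripotent tp a) (bidual_embed b) =
      - Q_op tpb (support_tripotent tp a) (bidual_embed b)"
  shows "norm a \<le> norm (a - t *\<^sub>R b)"
proof -
  define s where "s = support_tripotent tp a"
  have s: "tripotent tpb s" "tpb s s (bidual_embed a) = s" "norm s = 1"
    using support_tripotent_properties[OF a] by (simp_all add: s_def)
  define x where "x = tpb s (tpb s (bidual_embed b) s) s"
  have Qb: "tpb s (bidual_embed b) s = - x"
    using skew by (simp add: P2_op_def Q_op_def x_def s_def)
  \<comment> \<open>\<open>Q(s)\<close> maps \<open>- x = Q(s) b\<close> to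
    \<open>P_2(s) b = x\<close>.\<close>
  have Qx: "tpb s x s = - x"
  proof -
    have "tpb s (- x) s = x" using x_def Qb by simp
    then show ?thesis by (simp add: bidual.tp_middle minus_equation_iff)
  qed
  have Lx: "tpb s s x = x" unfolding x_def by (rule bidual.L_Q_squared_tripotent[OF s(1)])
  obtain C where C: "C \<ge> 0" "\<And>t. norm s - C * t\<^sup>2 \<le> norm (s - t *\<^sub>R x)"
    using bidual.norm_tripotent_minus_skew[OF s(1) Lx Qx] by blast
  have "norm a - C * t\<^sup>2 \<le> norm (a + t *\<^sub>R (- b))" for t
  proof -
    have sss: "tpb s s s = s" using s(1) by (simp add: tripotent_def)
    \<comment> \<open>\<open>L(s, s)\<close> sends \<open>a\<close> to \<open>s\<close> and fixes
      \<open>s\<close>, so \<open>P_2(s) = 2 L(s, s)^2 - L(s, s)\<close> sends \<open>a\<close> to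
      \<open>s\<close>.\<close>
    have "tpb s (tpb s (bidual_embed a) s) s = s"
      unfolding bidual.Q_squared_tripotent[OF s(1)] s(2) sss by (simp add: scaleR_2)
    then have "s - t *\<^sub>R x = tpb s (tpb s (bidual_embed (a - t *\<^sub>R b)) s) s"
      by (simp add: x_def bidual_embed_simps bidual.tp_middle)
    then have "norm (s - t *\<^sub>R x) \<le> norm (bidual_embed (a - t *\<^sub>R b))"
      using bidual.norm_Q_squared_le[OF s(1)] by simp
    also have "\<dots> \<le> norm (a - t *\<^sub>R b)" by (rule norm_bidual_embed_le)
    finally show ?thesis using C(2)[of t] s(3) a by simp
  qed
  then show ?thesis
    using norm_nondecreasing_if_quadratic_bound[OF C(1) _ t, of a "- b"] by simp
qed

end

theorem proposition2p14:
  fixes tp :: "'a::cbanach \<Rightarrow> 'a \<Rightarrow> 'a \<Rightarrow> 'a"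
    and tpb :: "'a cdual cdual \<Rightarrow> 'a cdual cdual \<Rightarrow> 'a cdual cdual \<Rightarrow> 'a cdual cdual"
    and T :: "'a \<Rightarrow> 'a"
  assumes "jbstar_triple tp"
    and "bidual_triple_product tp tpb"
    and "clinear T"
    and "\<And>a e. norm a = 1 \<Longrightarrow> tripotent tpb e \<Longrightarrow> tripotent_le tpb e (support_tripotent tp a) \<Longrightarrow>
      P2_op tpb e (bidual_embed (T a)) = - Q_op tpb e (bidual_embed (T a))"
  shows "continuous_on UNIV T"
proof -
  interpret jbstar_triple_with_bidual tp tpb
    using assms(1,2) by (intro jbstar_triple_with_bidual.intro jbstar_triple_with_bidual_axioms.intro)
  note T = clinear_simps[OF assms(3)]
  have unit: "norm a \<le> norm (a - t *\<^sub>R T a)" if a: "norm a = 1" and t: "t > 0" for a t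
  proof (rule norm_minus_le_if_skew_at_support[OF a t assms(4)[OF a]])
    show "tripotent tpb (support_tripotent tp a)" by (rule support_tripotent_properties(1)[OF a])
    \<comment> \<open>The choice \<open>e = s(a)\<close> is admissible because the difference is
      0.\<close>
    show "tripotent_le tpb (support_tripotent tp a) (support_tripotent tp a)"
      by (simp add: tripotent_le_def tripotent_def orthogonal_elems_def bidual.tp_left)
  qed
  have ge: "norm a \<le> norm (a - t *\<^sub>R T a)" if t: "t > 0" for a t
  proof (cases "a = 0")
    case False
    define u where "u = a /\<^sub>R norm a"
    have u: "norm u = 1" "a = norm a *\<^sub>R u" using False by (auto simp: u_def)
    have "norm a * norm u \<le> norm a * norm (u - t *\<^sub>R T u)"
      using unit[OF u(1) t] by (intro mult_left_mono) auto
    also have "\<dots> = norm (norm a *\<^sub>R (u - t *\<^sub>R T u))" by simp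
    also have "norm a *\<^sub>R (u - t *\<^sub>R T u) = a - t *\<^sub>R T a"
      by (subst (2 3) u(2)) (simp add: T scaleR_diff_right mult.commute)
    finally show ?thesis using u(1) by simp
  qed simp
  have "linear T" by (intro linearI) (simp_all add: T)
  then have "bounded_linear T" using ge by (rule bounded_if_norm_nondecreasing)
  then show ?thesis by (rule linear_continuous_on)
qed

end
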